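(* Let $R=S^G$ be the invariant subring of $S=\Bbbk[[x,y]]$ under the cyclic group $G=\frac1n(1,a)$, with $i$-series $(i_1,\dots,i_r)$. (i) Take any sequence $i_{k(1)}>i_{k(2)}>\cdots>i_{k(2b)}$ of elements of the $i$-series (with $k(1),\dots,k(2b)\in\{1,\dots,r\}$ and $b\ge1$) such that $i_{k(2c-1)}\in\mathtt I_{n-1}$ for all $c=1,\dots,b$. If $$t=n-1-\sum_{c=1}^b\bigl(i_{k(2c-1)}-i_{k(2c)}\bigr)\quad\text{or}\quad t=n-1,$$ then $M_t$ is an Ulrich module. (ii) Conversely, if $t\in\{0,1,\dots,n-1\}$, $t\ne n-1$, and $M_t$ is an Ulrich module, then there exists a sequence $i_{k(1)}>i_{k(2)}>\cdots>i_{k(2b)}$ of elements of the $i$-series with $i_{k(2c-1)}\in\mathtt I_{n-1}$ for all $c=1,\dots,b$ and $$t=n-1-\sum_{c=1}^b\bigl(i_{k(2c-1)}-i_{k(2c)}\bigr).$$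
   Context: $\Bbbk$ is an algebraically closed field; $n,a$ are integers with $1\le a\le n-1$, $\gcd(a,n)=1$, and $n$ is invertible in $\Bbbk$. $\frac1n(1,a)$ denotes the cyclic group generated by $\sigma=\mathrm{diag}(\zeta_n,\zeta_n^a)$, $\zeta_n$ a primitive $n$-th root of unity, acting on $S=\Bbbk[[x,y]]$ by $x\mapsto\zeta_n x$, $y\mapsto\zeta_n^a y$. $R=S^G$ is a local ring with maximal ideal $\mathfrak m$. For an integer $t$, $M_t\subset S$ is the $R$-submodule generated by the monomials $x^iy^j$ with $i+ja\equiv t \pmod n$; $M_0=R$, and $M_0,\dots,M_{n-1}$ are, up to isomorphism, exactly the indecomposable maximal Cohen-Macaulay (MCM) $R$-modules, pairwise non-isomorphic and of rank one. Ulrich module: an MCM $R$-module $M$ is Ulrich if $\mu_R(M)=\mathrm{e}_{\mathfrak m}(M)$, where $\mu_R(M)=\dim_\Bbbk M/\mathfrak mM$ and $\mathrm{e}_{\mathfrak m}(M)$ is the multiplicity of $M$ with respect to $\mathfrak m$. $i$-series: write the Hirzebruch-Jung continued fraction $n/a=[\alpha_1,\dots,\alpha_r]=\alpha_1-\cfrac{1}{\alpha_2-\cfrac{1}{\cdots-\frac{1}{\alpha_r}}}$ with integers $\alpha_u\ge2$. Put $i_0=n$, $i_1=a$, $i_u=\alpha_{u-1}i_{u-1}-i_{u-2}$ for $u=2,\dots,r+1$; then $i_1>i_2>\cdots>i_r=1$, $i_{r+1}=0$. The $i$-series is $(i_1,\dots,i_r)$. The set $\mathtt I_{n-1}$ is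 $\mathtt I_{n-1}=\{i_1\}\cup\{i_s\mid \alpha_s>2\text{ and }2\le s\le r-1\}$. *)

theory Defs
  imports
    "HOL-Algebra.Algebraic_Closure_Type"
    "HOL-Algebra.Generated_Groups"
    "HOL-Algebra.Bij"
    "HOL-Algebra.Ideal_Product"
    "HOL-Library.Extended_Nat"
    "HOL-Computational_Algebra.Formal_Power_Series"
    "HOL-Number_Theory.Cong"
    "Jordan_Normal_Form.Missing_VectorSpace"
begin

section \<open>Modules over a commutative ring\<close>

text \<open>
  The AFP entry VectorSpace has its own locale \<open>submodule\<close>; the submodules used here are those
  of HOL-Algebra, hence the qualified name \<open>Module.submodule\<close>.
\<close>

definition submodule_gen :: "('a, 'r) ring_scheme \<Rightarrow> ('a, 'b, 'm) module_scheme \<Rightarrow> 'b set \<Rightarrow> 'b set"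
  where "submodule_gen R M A = \<Inter>{N. Module.submodule N R M \<and> A \<subseteq> N}"

definition finitely_generated :: "('a, 'r) ring_scheme \<Rightarrow> ('a, 'b, 'm) module_scheme \<Rightarrow> bool"
  where "finitely_generated R M \<longleftrightarrow>
    (\<exists>A. finite A \<and> A \<subseteq> carrier M \<and> submodule_gen R M A = carrier M)"

definition ideal_smult :: "('a, 'r) ring_scheme \<Rightarrow> 'a set \<Rightarrow> ('a, 'b, 'm) module_scheme \<Rightarrow> 'b set"
  where "ideal_smult R I M = submodule_gen R M {c \<odot>\<^bsub>M\<^esub> x | c x. c \<in> I \<and> x \<in> carrier M}"

text \<open>
  The quotient module, built from cosets in the same way as \<^const>\<open>FactRing\<close>. The record type of
  modules extends that of rings, so the (meaningless) fields \<open>mult\<close> and \<open>one\<close> must be filled.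
\<close>

definition quot_module :: "('a, 'b, 'm) module_scheme \<Rightarrow> 'b set \<Rightarrow> ('a, 'b set) module"
  where "quot_module M N =
    \<lparr>carrier = a_rcosets\<^bsub>M\<^esub> N, monoid.mult = undefined, one = undefined, ring.zero = N,
     add = set_add M,
     module.smult = (\<lambda>c A. \<Union>x\<in>A. N +>\<^bsub>M\<^esub> (c \<odot>\<^bsub>M\<^esub> x))\<rparr>"

definition module_length :: "('a, 'r) ring_scheme \<Rightarrow> ('a, 'b, 'm) module_scheme \<Rightarrow> enat"
  where "module_length R M =
    Sup {enat k | k. \<exists>C. (\<forall>i\<le>k. Module.submodule (C i) R M) \<and> (\<forall>i<k. C i \<subset> C (Suc i))}"

definition restrict_scalars :: "('k \<Rightarrow> 'a) \<Rightarrow> ('a, 'b, 'm) module_scheme \<Rightarrow> ('k, 'b) module"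
  where "restrict_scalars h M =
    \<lparr>carrier = carrier M, monoid.mult = monoid.mult M, one = one M,
     ring.zero = ring.zero M, add = add M,
     module.smult = (\<lambda>c x. h c \<odot>\<^bsub>M\<^esub> x)\<rparr>"


section \<open>Maximal Cohen-Macaulay and Ulrich modules over a local ring\<close>

definition krull_dim :: "('a, 'r) ring_scheme \<Rightarrow> enat"
  where "krull_dim R =
    Sup {enat k | k. \<exists>P. (\<forall>i\<le>k. primeideal (P i) R) \<and> (\<forall>i<k. P i \<subset> P (Suc i))}"

text \<open>Only meaningful if \<open>R\<close> is local.\<close>

definition max_ideal :: "('a, 'r) ring_scheme \<Rightarrow> 'a set"
  where "max_ideal R = (THE I. maximalideal I R)"

fun ideal_power :: "('a, 'r) ring_scheme \<Rightarrow> 'a set \<Rightarrow> nat \<Rightarrow> 'a set"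
  where
    "ideal_power R I 0 = carrier R"
  | "ideal_power R I (Suc l) = ideal_prod R I (ideal_power R I l)"

definition regular_sequence ::
    "('a, 'r) ring_scheme \<Rightarrow> ('a, 'b, 'm) module_scheme \<Rightarrow> 'a list \<Rightarrow> bool"
  where "regular_sequence R M fs \<longleftrightarrow>
    set fs \<subseteq> carrier R \<and>
    (\<forall>i<length fs.
      let Q = quot_module M (ideal_smult R (genideal R (set (take i fs))) M)
      in \<forall>x\<in>carrier Q. fs ! i \<odot>\<^bsub>Q\<^esub> x = \<zero>\<^bsub>Q\<^esub> \<longrightarrow> x = \<zero>\<^bsub>Q\<^esub>) \<and>
    ideal_smult R (genideal R (set fs)) M \<noteq> carrier M"

definition depth :: "('a, 'r) ring_scheme \<Rightarrow> ('a, 'b, 'm) module_scheme \<Rightarrow> enat"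
  where "depth R M =
    Sup {enat (length fs) | fs. set fs \<subseteq> max_ideal R \<and> regular_sequence R M fs}"

definition MCM :: "('a, 'r) ring_scheme \<Rightarrow> ('a, 'b, 'm) module_scheme \<Rightarrow> bool"
  where "MCM R M \<longleftrightarrow> Module.module R M \<and> finitely_generated R M \<and> depth R M = krull_dim R"

text \<open>
  The multiplicity of \<open>M\<close> with respect to the maximal ideal \<open>\<mm>\<close> is
  \<open>lim d! \<cdot> length(M / \<mm>\<^sup>l\<^sup>+\<^sup>1M) / l\<^sup>d\<close>, where \<open>d\<close> is the dimension of the ring.
\<close>

definition multiplicity_of :: "('a, 'r) ring_scheme \<Rightarrow> ('a, 'b, 'm) module_scheme \<Rightarrow> real"
  where "multiplicity_of R M =
    (let d = the_enat (krull_dim R) in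
      lim (\<lambda>l::nat. fact d * real (the_enat (module_length R
        (quot_module M (ideal_smult R (ideal_power R (max_ideal R) (Suc l)) M)))) / real l ^ d))"

text \<open>
  \<open>dim\<^sub>k M / \<mm>M\<close>, where \<open>R\<close> is a local \<open>k\<close>-algebra with residue field \<open>k\<close>, via \<open>h : k \<rightarrow> R\<close>.
\<close>

definition num_gens ::
    "('k::field \<Rightarrow> 'a) \<Rightarrow> ('a, 'r) ring_scheme \<Rightarrow> ('a, 'b, 'm) module_scheme \<Rightarrow> nat"
  where "num_gens h R M =
    vectorspace.dim (ring_of_type_algebra :: 'k ring)
      (restrict_scalars h (quot_module M (ideal_smult R (max_ideal R) M)))"

definition Ulrich ::
    "('k::field \<Rightarrow> 'a) \<Rightarrow> ('a, 'r) ring_scheme \<Rightarrow> ('a, 'b, 'm) module_scheme \<Rightarrow> bool"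
  where "Ulrich h R M \<longleftrightarrow> MCM R M \<and> real (num_gens h R M) = multiplicity_of R M"


section \<open>The cyclic quotient singularity\<close>

text \<open>
  The ring \<open>k[[x,y]]\<close> is represented as \<open>k[[x]][[y]]\<close>, i.e. by the type \<open>'k fps fps\<close>: the
  coefficient of \<open>x\<^sup>i y\<^sup>j\<close> in \<open>f\<close> is \<open>fps_nth (fps_nth f j) i\<close>.
\<close>

definition const_xy :: "'k::field \<Rightarrow> 'k fps fps"
  where "const_xy c = fps_const (fps_const c)"

definition var_x :: "'k::field fps fps"
  where "var_x = fps_const fps_X"

definition var_y :: "'k::field fps fps"
  where "var_y = fps_X"

text \<open>The action of \<open>diag(\<alpha>, \<beta>)\<close>, i.e. the substitution \<open>x \<mapsto> \<alpha>x\<close>, \<open>y \<mapsto> \<beta>y\<close>.\<close>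

definition diag_act :: "'k::field \<Rightarrow> 'k \<Rightarrow> 'k fps fps \<Rightarrow> 'k fps fps"
  where "diag_act \<alpha> \<beta> f =
    Abs_fps (\<lambda>j. Abs_fps (\<lambda>i. \<alpha> ^ i * \<beta> ^ j * fps_nth (fps_nth f j) i))"

definition primitive_root_of_unity :: "nat \<Rightarrow> 'k::field \<Rightarrow> bool"
  where "primitive_root_of_unity n \<zeta> \<longleftrightarrow> 0 < n \<and> \<zeta> ^ n = 1 \<and> (\<forall>m. 0 < m \<and> m < n \<longrightarrow> \<zeta> ^ m \<noteq> 1)"

text \<open>
  The group \<open>1/n (1,a)\<close>, as a group of bijections of \<open>k[[x,y]]\<close>. The order \<open>n\<close> enters only through
  the choice of the primitive \<open>n\<close>-th root of unity \<open>\<zeta>\<close>.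
\<close>

definition cyclic_grp :: "'k::field \<Rightarrow> nat \<Rightarrow> ('k fps fps \<Rightarrow> 'k fps fps) set"
  where "cyclic_grp \<zeta> a = generate (BijGroup UNIV) {diag_act \<zeta> (\<zeta> ^ a)}"

definition invariant_ring :: "'k::field \<Rightarrow> nat \<Rightarrow> 'k fps fps ring"
  where "invariant_ring \<zeta> a =
    (ring_of_type_algebra :: 'k fps fps ring)
      \<lparr>carrier := {f. \<forall>g\<in>cyclic_grp \<zeta> a. g f = f}\<rparr>"

text \<open>
  A set of power series, with scalars acting by multiplication.
\<close>

definition series_module :: "'k::field fps fps set \<Rightarrow> ('k fps fps, 'k fps fps) module"
  where "series_module N =
    \<lparr>carrier = N, monoid.mult = (*), one = 1, ring.zero = 0, add = (+), module.smult = (*)\<rparr>"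

definition M_mod ::
    "nat \<Rightarrow> nat \<Rightarrow> 'k::field \<Rightarrow> int \<Rightarrow> ('k fps fps, 'k fps fps) module"
  where "M_mod n a \<zeta> t =
    series_module (submodule_gen (invariant_ring \<zeta> a) (series_module UNIV)
      {var_x ^ i * var_y ^ j | i j. [int i + int j * int a = t] (mod int n)})"


section \<open>The i-series\<close>

fun HJ_fraction :: "int list \<Rightarrow> rat"
  where
    "HJ_fraction [] = 0"
  | "HJ_fraction [\<alpha>] = of_int \<alpha>"
  | "HJ_fraction (\<alpha> # \<beta> # \<gamma>s) = of_int \<alpha> - 1 / HJ_fraction (\<beta> # \<gamma>s)"

definition HJ_expansion :: "nat \<Rightarrow> nat \<Rightarrow> int list \<Rightarrow> bool"
  where "HJ_expansion n a \<alpha>s \<longleftrightarrow>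
    \<alpha>s \<noteq> [] \<and> (\<forall>\<alpha>\<in>set \<alpha>s. 2 \<le> \<alpha>) \<and> HJ_fraction \<alpha>s = of_nat n / of_nat a"

text \<open>
  Lists are indexed from 0, so \<open>\<alpha>\<^sub>u\<close> is \<open>\<alpha>s ! (u - 1)\<close> and the last equation below reads
  \<open>i\<^sub>u\<^sub>+\<^sub>2 = \<alpha>\<^sub>u\<^sub>+\<^sub>1 i\<^sub>u\<^sub>+\<^sub>1 - i\<^sub>u\<close>. The \<open>i\<close>-series consists of the values at \<open>1, \<dots>, length \<alpha>s\<close>.
\<close>

fun i_ser :: "nat \<Rightarrow> nat \<Rightarrow> int list \<Rightarrow> nat \<Rightarrow> int"
  where
    "i_ser n a \<alpha>s 0 = int n"
  | "i_ser n a \<alpha>s (Suc 0) = int a"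
  | "i_ser n a \<alpha>s (Suc (Suc u)) = \<alpha>s ! u * i_ser n a \<alpha>s (Suc u) - i_ser n a \<alpha>s u"

definition I_last :: "nat \<Rightarrow> nat \<Rightarrow> int list \<Rightarrow> int set"
  where "I_last n a \<alpha>s =
    {i_ser n a \<alpha>s 1} \<union>
    {i_ser n a \<alpha>s s | s. \<alpha>s ! (s - 1) > 2 \<and> 2 \<le> s \<and> s \<le> length \<alpha>s - 1}"

text \<open>The sequences \<open>i\<^sub>k\<^sub>(\<^sub>1\<^sub>) > \<dots> > i\<^sub>k\<^sub>(\<^sub>2\<^sub>b\<^sub>)\<close> of the \<open>i\<close>-series whose odd members lie in \<^const>\<open>I_last\<close>.\<close>

definition admissible_seq :: "nat \<Rightarrow> nat \<Rightarrow> int list \<Rightarrow> nat \<Rightarrow> (nat \<Rightarrow> nat) \<Rightarrow> bool"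
  where "admissible_seq n a \<alpha>s b k \<longleftrightarrow>
    1 \<le> b \<and>
    (\<forall>l\<in>{1..2*b}. k l \<in> {1..length \<alpha>s}) \<and>
    (\<forall>l\<in>{1..<2*b}. i_ser n a \<alpha>s (k l) > i_ser n a \<alpha>s (k (l + 1))) \<and>
    (\<forall>c\<in>{1..b}. i_ser n a \<alpha>s (k (2*c - 1)) \<in> I_last n a \<alpha>s)"

definition t_of_seq :: "nat \<Rightarrow> nat \<Rightarrow> int list \<Rightarrow> nat \<Rightarrow> (nat \<Rightarrow> nat) \<Rightarrow> int"
  where "t_of_seq n a \<alpha>s b k =
    int n - 1 - (\<Sum>c=1..b. i_ser n a \<alpha>s (k (2*c - 1)) - i_ser n a \<alpha>s (k (2*c)))"

end

theory Submission
  imports Defs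
begin

text \<open>
  Everything is reduced to counting monomials. The invariant ring \<open>R\<close> consists of the series all of
  whose monomials \<open>x\<^sup>iy\<^sup>j\<close> have weight \<open>i + j a \<equiv> 0\<close> modulo \<open>n\<close>, and \<open>M\<^sub>t\<close> of those of weight \<open>t\<close>. Each
  submodule \<open>\<mm>\<^sup>kM\<^sub>t\<close> is determined by its monomials, so \<open>\<mu>(M\<^sub>t)\<close> is the number of minimal monomials
  (\<open>num_gens_eq\<close>), and the length of \<open>M\<^sub>t/\<mm>\<^sup>kM\<^sub>t\<close> is the number of monomials of \<open>M\<^sub>t\<close> outside \<open>\<mm>\<^sup>kM\<^sub>t\<close>
  (\<open>length_monomial_quotient\<close>).

  The multiplicity. The invariant monomials on the Newton boundary between \<open>x\<^sup>n\<close> and \<open>y\<^sup>n\<close> cut the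
  quadrant into \<open>e = \<Sum> (\<alpha>\<^sub>u - 2) + 2\<close> unimodular cones (\<open>lattice_chain_exists\<close>). In each cone the
  monomials of \<open>M\<^sub>t\<close> outside \<open>\<mm>\<^sup>lM\<^sub>t\<close> correspond, up to a bounded shift, to the pairs of natural
  numbers with sum below \<open>l\<close>. Hence every \<open>M\<^sub>t\<close> has multiplicity \<open>e\<close> (\<open>colength_limit\<close>).

  The number of generators. The minimal monomials of \<open>M\<^sub>t\<close> are reached from \<open>x\<^sup>t\<close> by successive steps
  \<open>(-i\<^sub>u, j\<^sub>u)\<close> with the largest possible \<open>i\<^sub>u\<close> (\<open>gens_step\<close>). Therefore \<open>\<mu>(M\<^sub>t)\<close> is 1 plus the sum of the
  digits of the greedy expansion \<open>t = \<Sum> d\<^sub>u i\<^sub>u\<close>. In such an expansion \<open>d\<^sub>u \<le> \<alpha>\<^sub>u - 1\<close>, and between two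
  digits \<open>\<alpha>\<^sub>u - 1\<close> there is one smaller than \<open>\<alpha>\<^sub>u - 2\<close>. Hence the sum of the digits is at most
  \<open>\<Sum> (\<alpha>\<^sub>u - 2) + 1 = e - 1\<close>, with equality if and only if the differences \<open>d\<^sub>u - (\<alpha>\<^sub>u - 2)\<close> read
  \<open>+1, -1, +1, \<dots>, -1, +1\<close>, with zeros in between. The expansion of \<open>n - 1\<close> has the single \<open>+1\<close> at
  \<open>u = 1\<close>, and comparing a general pattern with it gives exactly the sums over admissible sequences
  (\<open>gen_count_maximal_iff_admissible\<close>): a digit can be lowered below \<open>\<alpha>\<^sub>u - 2\<close> only if \<open>\<alpha>\<^sub>u > 2\<close>, or if it
  is the raised first digit.

  The modules \<open>M\<^sub>t\<close> are maximal Cohen-Macaulay: \<open>(x\<^sup>n, y\<^sup>n)\<close> is a regular sequence, and an elementary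
  exchange argument shows that the quotient by any regular sequence of length two has a socle, so
  that the depth is 2 (\<open>depth_V\<close>). The Krull dimension of \<open>R\<close> is 2 by Weierstrass division
  (\<open>krull_dim_R\<close>).
\<close>

section \<open>The i-series and the j-series\<close>

text \<open>
  The companion series \<open>j\<^sub>0 = 0, j\<^sub>1 = 1\<close> with the same recursion as the \<open>i\<close>-series. The vectors
  \<open>(j\<^sub>u, i\<^sub>u)/n\<close> are the primitive generators of the rays in the toric minimal resolution, and
  \<open>(-i\<^sub>u, j\<^sub>u)\<close> is the primitive exponent vector of an invariant Laurent monomial orthogonal to it.
\<close>

fun j_ser :: "int list \<Rightarrow> nat \<Rightarrow> int" where
  "j_ser \<alpha>s 0 = 0"
| "j_ser \<alpha>s (Suc 0) = 1"
| "j_ser \<alpha>s (Suc (Suc u)) = \<alpha>s ! u * j_ser \<alpha>s (Suc u) - j_ser \<alpha>s u"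

lemma HJ_fraction_gt_1:
  assumes "\<alpha>s \<noteq> []" "\<forall>\<alpha>\<in>set \<alpha>s. 2 \<le> \<alpha>"
  shows "HJ_fraction \<alpha>s > 1"
  using assms
proof (induction \<alpha>s rule: HJ_fraction.induct)
  case (3 \<alpha> \<beta> \<gamma>s)
  then have h: "HJ_fraction (\<beta> # \<gamma>s) > 1" and "2 \<le> \<alpha>" by auto
  from h have "1 / HJ_fraction (\<beta> # \<gamma>s) < 1" by simp
  moreover have "(of_int \<alpha> :: rat) \<ge> 2" using \<open>2 \<le> \<alpha>\<close> by simp
  ultimately show ?case by simp
qed auto

locale cyclic_type =
  fixes n a :: nat
  assumes a_pos: "1 \<le> a" and a_less: "a < n" and coprime_an: "gcd a n = 1"

locale HJ_type = cyclic_type +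
  fixes \<alpha>s :: "int list"
  assumes HJ: "HJ_expansion n a \<alpha>s"
begin

abbreviation "r \<equiv> length \<alpha>s"
abbreviation "I \<equiv> i_ser n a \<alpha>s"
abbreviation "J \<equiv> j_ser \<alpha>s"

lemma r_pos: "1 \<le> r"
  using HJ by (cases \<alpha>s) (auto simp: HJ_expansion_def)

lemma alpha_ge_2: "u < r \<Longrightarrow> 2 \<le> \<alpha>s ! u"
  using HJ by (auto simp: HJ_expansion_def)

text \<open>
  The tails of the continued fraction are the ratios of consecutive members of the \<open>i\<close>-series, because
  both satisfy the same recursion. As these ratios exceed 1, the series decreases.
\<close>

lemma I_tail_fraction:
  "u < r \<Longrightarrow> 0 < I (Suc u) \<and> HJ_fraction (drop u \<alpha>s) = of_int (I u) / of_int (I (Suc u))"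
proof (induction u)
  case 0
  then show ?case using HJ a_pos by (auto simp: HJ_expansion_def)
next
  case (Suc u)
  then have IH: "0 < I (Suc u)" "HJ_fraction (drop u \<alpha>s) = of_int (I u) / of_int (I (Suc u))" by auto
  have d: "drop u \<alpha>s = \<alpha>s ! u # drop (Suc u) \<alpha>s" using Suc.prems by (simp add: Cons_nth_drop_Suc)
  define h where "h = HJ_fraction (drop (Suc u) \<alpha>s)"
  have h1: "h > 1" unfolding h_def
    using HJ Suc.prems by (intro HJ_fraction_gt_1) (auto simp: HJ_expansion_def dest: in_set_dropD)
  obtain b bs where b: "drop (Suc u) \<alpha>s = b # bs" using Suc.prems by (cases "drop (Suc u) \<alpha>s") auto
  have "of_int (\<alpha>s ! u) - 1 / h = of_int (I u) / of_int (I (Suc u))"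
    using IH(2) d b by (simp add: h_def)
  then have e: "1 / h = of_int (I (Suc (Suc u))) / of_int (I (Suc u))"
    using IH(1) by (simp add: field_simps)
  have "1 / h > 0" using h1 by simp
  then have "(of_int (I (Suc (Suc u))) :: rat) > 0"
    using e IH(1) by (simp add: zero_less_divide_iff)
  then have p: "0 < I (Suc (Suc u))" by linarith
  have "h = of_int (I (Suc u)) / of_int (I (Suc (Suc u)))"
    using arg_cong[OF e, of inverse] by (simp add: divide_inverse mult.commute)
  then show ?case using p by (simp add: h_def)
qed

lemma I_Suc_less: "u < r \<Longrightarrow> I (Suc u) < I u"
proof -
  assume u: "u < r"
  have "HJ_fraction (drop u \<alpha>s) > 1"
    using HJ u by (intro HJ_fraction_gt_1) (auto simp: HJ_expansion_def dest: in_set_dropD)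
  then have "(of_int (I (Suc u)) :: rat) < of_int (I u)"
    using I_tail_fraction[OF u] by (auto simp: less_divide_eq)
  then show ?thesis by linarith
qed

lemma I_end: "I (Suc r) = 0"
proof -
  obtain u where u: "r = Suc u" using r_pos by (cases r) auto
  have "drop u \<alpha>s = [\<alpha>s ! u]" using u by (metis Cons_nth_drop_Suc drop_all lessI order_refl)
  then have "of_int (\<alpha>s ! u) = (of_int (I u) / of_int (I (Suc u)) :: rat)" and "0 < I (Suc u)"
    using I_tail_fraction[of u] u by auto
  then have "(of_int (\<alpha>s ! u * I (Suc u)) :: rat) = of_int (I u)" by (simp add: field_simps)
  then have "\<alpha>s ! u * I (Suc u) = I u" by (simp only: of_int_eq_iff)
  then show ?thesis using u by simp
qed

lemma I_gcd: "gcd (I u) (I (Suc u)) = 1"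
proof (induction u)
  case 0
  then show ?case using coprime_an by (simp add: gcd.commute)
next
  case (Suc u)
  show ?case
  proof (rule gcd_unique_int[THEN iffD1, symmetric], intro conjI allI impI)
    fix e assume e: "e dvd I (Suc u) \<and> e dvd I (Suc (Suc u))"
    then have "e dvd \<alpha>s ! u * I (Suc u) - I (Suc (Suc u))" by (intro dvd_diff dvd_mult) auto
    then have "e dvd I u" by simp
    then have "e dvd gcd (I u) (I (Suc u))" using e by (intro gcd_greatest) auto
    then show "e dvd 1" using Suc by simp
  qed auto
qed

lemma I_length: "I r = 1"
proof -
  have "\<bar>I r\<bar> = 1" using I_gcd[of r] I_end by simp
  moreover have "0 < I r" using I_tail_fraction[of "r - 1"] r_pos by (cases r) auto
  ultimately show ?thesis by simp
qed

lemma I_pos: "u \<le> r \<Longrightarrow> 0 < I u"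
  using I_tail_fraction[of "u - 1"] a_less by (cases u) auto

lemma I_strict: "u < v \<Longrightarrow> v \<le> Suc r \<Longrightarrow> I v < I u"
proof (induction v)
  case (Suc v)
  have "I (Suc v) < I v"
    using I_Suc_less[of v] I_end I_length Suc.prems by (cases "v < r") (auto simp: not_less le_less_Suc_eq)
  then show ?case using Suc by (cases "u = v") auto
qed auto

lemma I_less_iff: "u \<le> Suc r \<Longrightarrow> v \<le> Suc r \<Longrightarrow> I v < I u \<longleftrightarrow> u < v"
  using I_strict[of u v] I_strict[of v u] by (cases u v rule: linorder_cases) auto

lemma I_eq_iff: "u \<le> Suc r \<Longrightarrow> v \<le> Suc r \<Longrightarrow> I v = I u \<longleftrightarrow> u = v"
  using I_strict[of u v] I_strict[of v u] by (cases u v rule: linorder_cases) auto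

lemma J_mono: "u \<le> r \<Longrightarrow> 0 \<le> J u \<and> J u < J (Suc u)"
proof (induction u)
  case (Suc u)
  then have h: "0 \<le> J u" "J u < J (Suc u)" "2 \<le> \<alpha>s ! u" using alpha_ge_2[of u] by auto
  have "2 * J (Suc u) \<le> \<alpha>s ! u * J (Suc u)" using h by (intro mult_right_mono) auto
  then have "J (Suc u) < \<alpha>s ! u * J (Suc u) - J u" using h(2) by linarith
  then show ?case using h by simp
qed auto

lemma J_pos: "1 \<le> u \<Longrightarrow> u \<le> Suc r \<Longrightarrow> 0 < J u"
  using J_mono[of "u - 1"] by (cases u) auto

text \<open>
  Both series are solutions of the same second-order recursion, so this Wronskian is constant.
\<close>

lemma IJ_det: "J (Suc u) * I u - J u * I (Suc u) = int n"
  by (induction u) (auto simp: algebra_simps)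

lemma I_cong_J: "[I u = int a * J u] (mod int n)"
proof -
  have "[I u = int a * J u] (mod int n) \<and> [I (Suc u) = int a * J (Suc u)] (mod int n)"
  proof (induction u)
    case (Suc u)
    then have "[\<alpha>s ! u * I (Suc u) - I u = \<alpha>s ! u * (int a * J (Suc u)) - int a * J u] (mod int n)"
      by (intro cong_diff cong_scalar_left) auto
    then show ?case using Suc by (simp add: algebra_simps)
  qed (auto simp: cong_def)
  then show ?thesis by simp
qed

lemma J_last: "J (Suc r) = int n"
  using IJ_det[of r] I_end I_length by simp

end

section \<open>Exponents of monomials\<close>

context cyclic_type
begin

text \<open>
  Exponents of the monomials in \<open>M\<^sub>t\<close>; those of the monomials in \<open>\<mm>\<^sup>kM\<^sub>t\<close>; and those of the minimal
  monomial generators of \<open>M\<^sub>t\<close>.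
\<close>

definition expo :: "int \<Rightarrow> (nat \<times> nat) set" where
  "expo t = {(i, j). [int i + int j * int a = t] (mod int n)}"

fun power_expo :: "int \<Rightarrow> nat \<Rightarrow> (nat \<times> nat) set" where
  "power_expo t 0 = expo t"
| "power_expo t (Suc k) =
    {(p + i, q + j) | p q i j. (p, q) \<in> expo 0 - {(0, 0)} \<and> (i, j) \<in> power_expo t k}"

definition gens :: "int \<Rightarrow> (nat \<times> nat) set" where
  "gens t = expo t - power_expo t 1"

lemma n_gt_1: "1 < n"
  using a_pos a_less by simp

lemma expo_iff: "(i, j) \<in> expo t \<longleftrightarrow> [int i + int j * int a = t] (mod int n)"
  by (simp add: expo_def)

lemma expo_cong: "[s = t] (mod int n) \<Longrightarrow> expo s = expo t"
  by (auto simp: expo_def cong_def)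

lemma expo_add:
  assumes "(p, q) \<in> expo s" "(i, j) \<in> expo t"
  shows "(p + i, q + j) \<in> expo (s + t)"
  using cong_add[OF assms[unfolded expo_iff]] by (simp add: expo_iff algebra_simps)

lemma expo_diff:
  assumes "(p, q) \<in> expo s" "(i, j) \<in> expo t" "i \<le> p" "j \<le> q"
  shows "(p - i, q - j) \<in> expo (s - t)"
  using cong_diff[OF assms(1,2)[unfolded expo_iff]] assms(3,4)
  by (simp add: expo_iff algebra_simps of_nat_diff)

lemma power_expo_subset: "power_expo t k \<subseteq> expo t"
proof (induction k)
  case (Suc k)
  then show ?case using expo_add[of _ _ 0 _ _ t] by auto
qed auto

lemma gens_iff:
  "(i, j) \<in> gens t \<longleftrightarrow>
    (i, j) \<in> expo t \<and> (\<forall>p q. (p, q) \<in> expo 0 \<longrightarrow> p \<le> i \<longrightarrow> q \<le> j \<longrightarrow> p = 0 \<and> q = 0)"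
proof
  assume g: "(i, j) \<in> gens t"
  show "(i, j) \<in> expo t \<and> (\<forall>p q. (p, q) \<in> expo 0 \<longrightarrow> p \<le> i \<longrightarrow> q \<le> j \<longrightarrow> p = 0 \<and> q = 0)"
  proof (intro conjI allI impI)
    show e: "(i, j) \<in> expo t" using g by (simp add: gens_def)
    fix p q assume pq: "(p, q) \<in> expo 0" "p \<le> i" "q \<le> j"
    have "(i - p, j - q) \<in> expo t" using expo_diff[OF e pq] by simp
    then have "(p, q) = (0, 0) \<or> (p + (i - p), q + (j - q)) \<in> power_expo t 1"
      unfolding One_nat_def power_expo.simps using pq(1) by blast
    then show "p = 0" "q = 0" using g pq by (auto simp: gens_def)
  qed
qed (auto simp: gens_def)

lemma gens_0: "gens 0 = {(0, 0)}"
proof -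
  have "(i, j) \<in> gens 0 \<longleftrightarrow> (i, j) = (0, 0)" for i j
    unfolding gens_iff by (auto simp: expo_iff)
  then show ?thesis by auto
qed

end

context HJ_type
begin

text \<open>
  The numbers \<open>i\<^sub>u\<close> are the successive minima of the residues of \<open>a q\<close> modulo \<open>n\<close>, attained at
  \<open>q = j\<^sub>u\<close>.  The reason is that \<open>(j\<^sub>u, i\<^sub>u)\<close> and \<open>(j\<^sub>u\<^sub>+\<^sub>1, i\<^sub>u\<^sub>+\<^sub>1)\<close> form a basis of the lattice of all
  \<open>(q, c)\<close> with \<open>c \<equiv> a q\<close>. A point \<open>x (j\<^sub>u, i\<^sub>u) + y (j\<^sub>u\<^sub>+\<^sub>1, i\<^sub>u\<^sub>+\<^sub>1)\<close> with \<open>0 < q < j\<^sub>u\<^sub>+\<^sub>1\<close> and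
  \<open>0 < c < i\<^sub>u\<close> is impossible for every choice of signs of \<open>x\<close> and \<open>y\<close>.
\<close>

lemma successive_minima:
  assumes u: "u \<le> r" and q: "0 < q" "q < J (Suc u)"
    and c: "0 < c" "[c = int a * q] (mod int n)"
  shows "I u \<le> c"
proof (rule ccontr)
  assume "\<not> I u \<le> c"
  then have lt: "c < I u" by simp
  have "[c * J (Suc u) - q * I (Suc u) = (int a * q) * J (Suc u) - q * (int a * J (Suc u))] (mod int n)"
    by (intro cong_diff cong_scalar_right cong_scalar_left c(2) I_cong_J)
  then have "int n dvd c * J (Suc u) - q * I (Suc u)" by (simp add: cong_iff_dvd_diff algebra_simps)
  then obtain x where x: "c * J (Suc u) - q * I (Suc u) = int n * x" by blast
  have "[q * I u - c * J u = q * (int a * J u) - (int a * q) * J u] (mod int n)"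
    by (intro cong_diff cong_scalar_right cong_scalar_left c(2) I_cong_J)
  then have "int n dvd q * I u - c * J u" by (simp add: cong_iff_dvd_diff algebra_simps)
  then obtain y where y: "q * I u - c * J u = int n * y" by blast
  have n0: "int n \<noteq> 0" using a_less by simp
  have "int n * q = int n * (x * J u + y * J (Suc u))"
  proof -
    have "int n * (x * J u + y * J (Suc u)) = (int n * x) * J u + (int n * y) * J (Suc u)"
      by (simp add: algebra_simps)
    also have "\<dots> = (J (Suc u) * I u - J u * I (Suc u)) * q"
      unfolding x[symmetric] y[symmetric] by (simp add: algebra_simps)
    finally show ?thesis unfolding IJ_det by (rule sym)
  qed
  then have qe: "q = x * J u + y * J (Suc u)" using n0 mult_cancel_left by blast
  have "int n * c = int n * (x * I u + y * I (Suc u))"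
  proof -
    have "int n * (x * I u + y * I (Suc u)) = (int n * x) * I u + (int n * y) * I (Suc u)"
      by (simp add: algebra_simps)
    also have "\<dots> = (J (Suc u) * I u - J u * I (Suc u)) * c"
      unfolding x[symmetric] y[symmetric] by (simp add: algebra_simps)
    finally show ?thesis unfolding IJ_det by (rule sym)
  qed
  then have ce: "c = x * I u + y * I (Suc u)" using n0 mult_cancel_left by blast
  have J: "0 \<le> J u" "J u < J (Suc u)" using J_mono[OF u] by auto
  have "0 \<le> I (Suc u)" using I_pos[of "Suc u"] I_end u by (cases "u = r") auto
  then have I: "0 < I u" "I (Suc u) < I u" "0 \<le> I (Suc u)"
    using I_pos[OF u] I_strict[of u "Suc u"] u by auto
  show False
  proof (cases "1 \<le> x")
    case True
    show False
    proof (cases "0 \<le> y")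
      case True
      have "1 * I u \<le> x * I u" using \<open>1 \<le> x\<close> I by (intro mult_right_mono) auto
      moreover have "0 \<le> y * I (Suc u)" using True I by simp
      ultimately show False using ce lt by linarith
    next
      case False
      then have "(- y) * J u \<le> (- y) * J (Suc u)" using J by (intro mult_left_mono) auto
      then have "0 < (x + y) * J u" using q(1) qe by (simp add: algebra_simps)
      then have "1 \<le> x + y" using J(1) by (simp add: zero_less_mult_iff)
      then have "1 * I u \<le> (x + y) * I u" using I by (intro mult_right_mono) auto
      moreover have "0 \<le> (- y) * (I u - I (Suc u))" using False I by (intro mult_nonneg_nonneg) auto
      ultimately show False using ce lt by (simp add: algebra_simps)
    qed
  next
    case False
    then have "(- x) * I (Suc u) \<le> (- x) * I u" using I by (intro mult_left_mono) auto
    then have "0 < (x + y) * I (Suc u)" using c(1) ce by (simp add: algebra_simps)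
    then have "1 \<le> x + y" using I by (simp add: zero_less_mult_iff)
    then have "1 * J (Suc u) \<le> (x + y) * J (Suc u)" using J by (intro mult_right_mono) auto
    moreover have "0 \<le> (- x) * (J (Suc u) - J u)" using False J by (intro mult_nonneg_nonneg) auto
    ultimately show False using qe q(2) by (simp add: algebra_simps)
  qed
qed

lemma gens_first:
  assumes t: "0 \<le> t" "t < int n" and g: "(i, j) \<in> gens t"
  shows "(i, j) = (nat t, 0) \<or> int i < t \<and> 0 < j"
proof (cases "nat t \<le> i")
  case True
  have "(nat t, 0) \<in> expo t" using t by (simp add: expo_iff)
  moreover have "(i, j) \<in> expo t" using g by (simp add: gens_iff)
  ultimately have "(i - nat t, j) \<in> expo 0" using expo_diff[of i j t "nat t" 0 t] True by simp
  then have "i - nat t = 0 \<and> j = 0" using g True unfolding gens_iff by (meson diff_le_self order_refl)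
  then show ?thesis using True by simp
next
  case False
  have "0 < j"
  proof (rule ccontr)
    assume "\<not> 0 < j"
    then have "[int i = t] (mod int n)" using g by (simp add: gens_iff expo_iff)
    then have "int i = t" using False t by (simp add: cong_def)
    then show False using False by simp
  qed
  then show ?thesis using False t by auto
qed

text \<open>
  Below the row \<open>j\<^sub>u\<^sub>+\<^sub>1\<close> no monomial of \<open>M\<^sub>t\<close> lies to the left of \<open>x\<^sup>t\<close>: moving left from \<open>x\<^sup>t\<close> to row
  \<open>j\<close> takes a positive residue of \<open>a j\<close>, which is at least \<open>i\<^sub>u > t\<close>.
\<close>

lemma expo_below_J:
  assumes u: "u < r" and t: "t < I u"
    and ij: "(i, j) \<in> expo t" "0 < j" "int j < J (Suc u)"
  shows "t \<le> int i"
proof (rule ccontr)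
  assume "\<not> t \<le> int i"
  then have "0 < t - int i" by simp
  moreover have "[t - int i = int a * int j] (mod int n)"
    using ij(1) by (simp add: expo_iff cong_iff_dvd_diff algebra_simps dvd_diff_commute)
  ultimately have "I u \<le> t - int i" using successive_minima[of u "int j" "t - int i"] u ij by auto
  then show False using t by simp
qed

text \<open>
  The minimal generators of \<open>M\<^sub>t\<close> are found by walking from \<open>x\<^sup>t\<close> towards the \<open>y\<close>-axis: the next
  generator is reached by the step \<open>(- i\<^sub>u, j\<^sub>u)\<close> with the largest \<open>i\<^sub>u \<le> t\<close>. All monomials in the rows
  before that step are multiples of \<open>x\<^sup>t\<close>, and above it the problem repeats itself with
  \<open>t - i\<^sub>u\<close> in place of \<open>t\<close>.
\<close>

lemma gens_step:
  assumes u: "u < r" and t: "I (Suc u) \<le> t" "t < I u"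
  shows "gens t = insert (nat t, 0) ((\<lambda>(i, j). (i, j + nat (J (Suc u)))) ` gens (t - I (Suc u)))"
proof -
  define w where "w = nat (J (Suc u))"
  have w: "int w = J (Suc u)" "0 < w" using J_pos[of "Suc u"] u by (auto simp: w_def)
  have Ipos: "0 < I (Suc u)" using I_pos[of "Suc u"] u by simp
  have tn: "0 \<le> t" "t < int n" using t Ipos I_strict[of 0 u] u by (cases u; simp; linarith)+
  have we: "[int w * int a = I (Suc u)] (mod int n)"
    using I_cong_J[of "Suc u"] w by (simp add: cong_sym mult.commute)
  have shift: "(i, j + w) \<in> expo t \<longleftrightarrow> (i, j) \<in> expo (t - I (Suc u))" for i j
  proof -
    have "[int i + int (j + w) * int a - t = (int i + int j * int a + I (Suc u)) - t] (mod int n)"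
      using cong_add[OF cong_refl we, of "int i + int j * int a - t"] by (simp add: algebra_simps)
    then have "int n dvd (int i + int (j + w) * int a - t) - ((int i + int j * int a + I (Suc u)) - t)"
      by (simp add: cong_iff_dvd_diff)
    from dvd_add_right_iff[OF this, of "(int i + int j * int a + I (Suc u)) - t"]
    show ?thesis by (simp add: expo_iff cong_iff_dvd_diff algebra_simps)
  qed
  show ?thesis
    unfolding set_eq_iff split_paired_All
  proof (intro allI)
    fix i j
    have "(i, j) \<in> gens t \<longleftrightarrow> (i, j) = (nat t, 0) \<or> (w \<le> j \<and> (i, j - w) \<in> gens (t - I (Suc u)))"
    proof
      assume g: "(i, j) \<in> gens t"
      then have e: "(i, j) \<in> expo t" by (simp add: gens_iff)
      consider "(i, j) = (nat t, 0)" | "int i < t" "0 < j" using gens_first[OF tn g] by auto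
      then show "(i, j) = (nat t, 0) \<or> (w \<le> j \<and> (i, j - w) \<in> gens (t - I (Suc u)))"
      proof cases
        case 2
        then have "w \<le> j" using expo_below_J[OF u t(2) e] w by (cases "w \<le> j") auto
        moreover have "(i, j - w) \<in> expo (t - I (Suc u))" using shift[of i "j - w"] e \<open>w \<le> j\<close> by simp
        ultimately show ?thesis using g by (auto simp: gens_iff)
      qed auto
    next
      assume "(i, j) = (nat t, 0) \<or> (w \<le> j \<and> (i, j - w) \<in> gens (t - I (Suc u)))"
      then consider "i = nat t" "j = 0" | "w \<le> j" "(i, j - w) \<in> gens (t - I (Suc u))" by auto
      then show "(i, j) \<in> gens t"
      proof cases
        case 1
        have "p = 0" if "[int p = 0] (mod int n)" "p \<le> nat t" for p
          using that tn by (simp add: cong_def)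
        then show ?thesis using 1 tn by (auto simp: gens_iff expo_iff)
      next
        case 2
        have e: "(i, j) \<in> expo t" using shift[of i "j - w"] 2 by (simp add: gens_iff)
        have t': "0 \<le> t - I (Suc u)" "t - I (Suc u) < int n" using t Ipos tn by auto
        have i: "int i < t" using gens_first[OF t' 2(2)] Ipos t by auto
        show ?thesis unfolding gens_iff
        proof (intro conjI e allI impI)
          fix p q assume pq: "(p, q) \<in> expo 0" "p \<le> i" "q \<le> j"
          have "p = 0 \<and> q = 0"
          proof (cases "q \<le> j - w")
            case True
            then show ?thesis using 2(2) pq by (auto simp: gens_iff)
          next
            case False
            have d: "(i - p, j - q) \<in> expo t" using expo_diff[OF e pq] by simp
            show ?thesis
            proof (cases "j - q = 0")
              case True
              then have "[int (i - p) = t] (mod int n)" using d by (simp add: expo_iff)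
              then have "int (i - p) = t" using i tn by (simp add: cong_def)
              then show ?thesis using i by linarith
            next
              case jq: False
              have "int (j - q) < J (Suc u)" using False w pq by linarith
              then have "t \<le> int (i - p)" using expo_below_J[OF u t(2) d] jq by simp
              then show ?thesis using i by linarith
            qed
          qed
          then show "p = 0" "q = 0" by auto
        qed
      qed
    qed
    moreover have "(i, j) \<in> (\<lambda>(i, j). (i, j + w)) ` gens (t - I (Suc u)) \<longleftrightarrow>
        w \<le> j \<and> (i, j - w) \<in> gens (t - I (Suc u))"
      by (force intro: rev_image_eqI[of "(i, j - w)"])
    ultimately show "(i, j) \<in> gens t \<longleftrightarrow>
        (i, j) \<in> insert (nat t, 0) ((\<lambda>(i, j). (i, j + nat (J (Suc u)))) ` gens (t - I (Suc u)))"
      unfolding w_def by simp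
  qed
qed

lemma obtain_level:
  assumes "0 < t" "t < int n"
  obtains u where "u < r" "I (Suc u) \<le> t" "t < I u"
proof -
  have ex: "I r \<le> t" using assms I_length by simp
  define v where "v = (LEAST v. I v \<le> t)"
  have v: "I v \<le> t" "v \<le> r" unfolding v_def using LeastI[of "\<lambda>v. I v \<le> t", OF ex] Least_le[of "\<lambda>v. I v \<le> t", OF ex] by auto
  have "v \<noteq> 0" using v(1) assms by (cases v) auto
  then obtain u where "v = Suc u" by (cases v) auto
  moreover have "\<not> I u \<le> t" using not_less_Least[of u "\<lambda>v. I v \<le> t"] calculation v_def by simp
  ultimately show ?thesis using that[of u] v by simp
qed

lemma finite_gens: "0 \<le> t \<Longrightarrow> t < int n \<Longrightarrow> finite (gens t)"
proof (induction "nat t" arbitrary: t rule: less_induct)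
  case less
  show ?case
  proof (cases "t = 0")
    case True
    then show ?thesis by (simp add: gens_0)
  next
    case False
    then obtain u where u: "u < r" "I (Suc u) \<le> t" "t < I u" using obtain_level[of t] less by auto
    have "0 < I (Suc u)" using I_pos[of "Suc u"] u by simp
    then have "finite (gens (t - I (Suc u)))" using less u by auto
    then show ?thesis unfolding gens_step[OF u] by simp
  qed
qed

definition gen_count :: "int \<Rightarrow> int" where "gen_count t = int (card (gens t))"

lemma gen_count_0: "gen_count 0 = 1"
  by (simp add: gen_count_def gens_0)

lemma gen_count_step:
  assumes u: "u < r" and t: "I (Suc u) \<le> t" "t < I u"
  shows "gen_count t = 1 + gen_count (t - I (Suc u))"
proof -
  have Ipos: "0 < I (Suc u)" using I_pos[of "Suc u"] u by simp
  have tn: "0 \<le> t - I (Suc u)" "t - I (Suc u) < int n"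
    using t Ipos I_strict[of 0 u] u by (cases u; simp; linarith)+
  let ?f = "\<lambda>(i, j). (i, j + nat (J (Suc u)))"
  have "0 < nat (J (Suc u))" using J_pos[of "Suc u"] u by simp
  then have "(nat t, 0) \<notin> ?f ` gens (t - I (Suc u))" by auto
  moreover have "inj_on ?f (gens (t - I (Suc u)))" by (auto simp: inj_on_def)
  ultimately show ?thesis unfolding gen_count_def gens_step[OF assms]
    using finite_gens[OF tn] by (simp add: card_image)
qed

text \<open>
  Iterating the step with a fixed \<open>u\<close>: the greedy expansion of \<open>t\<close> in the \<open>i\<close>-series contributes its
  digits one level at a time, so \<open>M\<^sub>t\<close> has one generator more than the sum of the digits.
\<close>

lemma gen_count_digit:
  assumes u: "u < r" and "0 \<le> d" "0 \<le> t" "d * I (Suc u) + t < I u"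
  shows "gen_count (d * I (Suc u) + t) = d + gen_count t"
proof -
  have Ipos: "0 < I (Suc u)" using I_pos[of "Suc u"] u by simp
  have "int k * I (Suc u) + t < I u \<Longrightarrow> gen_count (int k * I (Suc u) + t) = int k + gen_count t" for k
  proof (induction k)
    case (Suc k)
    have "0 \<le> int k * I (Suc u)" using Ipos by simp
    then have "I (Suc u) \<le> int (Suc k) * I (Suc u) + t" using assms by (simp add: algebra_simps)
    from gen_count_step[OF u this Suc.prems] Suc Ipos show ?case by (simp add: algebra_simps)
  qed simp
  from this[of "nat d"] show ?thesis using assms by simp
qed

end

section \<open>Modules with the maximal number of generators\<close>

context HJ_type
begin

abbreviation \<alpha> :: "nat \<Rightarrow> int" where "\<alpha> u \<equiv> \<alpha>s ! (u - 1)"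

text \<open>
  With levels counted from 0, \<open>t\<close> lies on level \<open>v\<close> if \<open>t < i\<^sub>v\<close>. The number \<open>excess v + 2\<close> turns out to
  bound the number of generators on this level, and \<open>excess 0 + 2\<close> to be the multiplicity. The
  largest element of the lower part \<open>t < i\<^sub>v - i\<^sub>v\<^sub>+\<^sub>1\<close> of level \<open>v\<close> is \<open>low v\<close>; all its digits are
  \<open>\<alpha>\<^sub>u - 2\<close>.
\<close>

definition excess :: "nat \<Rightarrow> int" where
  "excess v = (\<Sum>u\<in>{v..<r}. \<alpha>s ! u - 2)"

definition low :: "nat \<Rightarrow> int" where
  "low v = I v - I (Suc v) - 1"

text \<open>
  A list of pairs \<open>(q, p)\<close> with increasing indices prescribes a modification of a digit expansion:
  the digit of \<open>i\<^sub>q\<close> is lowered by one and that of \<open>i\<^sub>p\<close> is raised by one.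
\<close>

fun alternating :: "nat \<Rightarrow> (nat \<times> nat) list \<Rightarrow> bool" where
  "alternating v [] \<longleftrightarrow> True"
| "alternating v ((q, p) # ps) \<longleftrightarrow> v < q \<and> q < p \<and> p \<le> r \<and> 2 < \<alpha> q \<and> alternating p ps"

definition drop_sum :: "(nat \<times> nat) list \<Rightarrow> int" where
  "drop_sum ps = (\<Sum>(q, p)\<leftarrow>ps. I q - I p)"

lemma drop_sum_simps [simp]:
  "drop_sum [] = 0" "drop_sum ((q, p) # ps) = I q - I p + drop_sum ps"
  by (simp_all add: drop_sum_def)

lemma drop_sum_nonneg: "alternating v ps \<Longrightarrow> 0 \<le> drop_sum ps"
proof (induction v ps rule: alternating.induct)
  case (2 v q p ps)
  then show ?case using I_strict[of q p] by auto
qed auto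

lemma alternating_mono: "alternating v ps \<Longrightarrow> w \<le> v \<Longrightarrow> alternating w ps"
  by (cases ps) auto

lemma alternating_Suc:
  "alternating v ps \<Longrightarrow> alternating (Suc v) ps \<or> (\<exists>p ps'. ps = (Suc v, p) # ps')"
  by (cases ps) auto

lemma low_rec: "low v = (\<alpha>s ! v - 2) * I (Suc v) + low (Suc v)"
  unfolding low_def by (simp add: algebra_simps)

lemma excess_rec: "v < r \<Longrightarrow> excess v = \<alpha>s ! v - 2 + excess (Suc v)"
  unfolding excess_def by (simp add: sum.atLeast_Suc_lessThan)

lemma excess_nonneg: "0 \<le> excess v"
  unfolding excess_def using alpha_ge_2 by (intro sum_nonneg) auto

text \<open>
  Writing \<open>t = d i\<^sub>v\<^sub>+\<^sub>1 + t'\<close> with \<open>t' < i\<^sub>v\<^sub>+\<^sub>1\<close>, the digit \<open>d\<close> is at most \<open>\<alpha>\<^sub>v\<^sub>+\<^sub>1 - 1\<close>, and it attains this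
  bound only if \<open>t'\<close> lies in the lower part of its level. For \<open>t\<close> itself in the lower part, both
  statements hold with the bound decreased by one. So between two digits that exceed \<open>\<alpha>\<^sub>u - 2\<close> there
  must be one that falls short of it.
\<close>

lemma digit_cases:
  assumes v: "v < r" and t: "0 \<le> t" "t < I v"
  obtains d t' where "t = d * I (Suc v) + t'" "0 \<le> d" "0 \<le> t'" "t' < I (Suc v)"
    "gen_count t = d + gen_count t'"
    "d \<le> \<alpha>s ! v - 1" "d = \<alpha>s ! v - 1 \<Longrightarrow> t' < I (Suc v) - I (Suc (Suc v))"
    "t < I v - I (Suc v) \<Longrightarrow> d \<le> \<alpha>s ! v - 2"
    "t < I v - I (Suc v) \<Longrightarrow> d = \<alpha>s ! v - 2 \<Longrightarrow> t' < I (Suc v) - I (Suc (Suc v))"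
proof -
  have ip: "0 < I (Suc v)" using I_pos[of "Suc v"] v by simp
  have ip2: "0 \<le> I (Suc (Suc v))" "I (Suc (Suc v)) < I (Suc v)"
    using I_pos[of "Suc (Suc v)"] I_end I_strict[of "Suc v" "Suc (Suc v)"] v by (cases "Suc v = r"; simp)+
  define d t' where "d = t div I (Suc v)" and "t' = t mod I (Suc v)"
  have e: "t = d * I (Suc v) + t'" by (simp add: d_def t'_def)
  have d0: "0 \<le> d" using t ip by (simp add: d_def pos_imp_zdiv_nonneg_iff)
  have t'0: "0 \<le> t'" "t' < I (Suc v)" using ip by (simp_all add: t'_def)
  have bound: "d * I (Suc v) + t' < \<alpha>s ! v * I (Suc v) - I (Suc (Suc v))" using t e by simp
  have d1: "d \<le> \<alpha>s ! v - 1"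
  proof (rule ccontr)
    assume "\<not> ?thesis"
    then have "\<alpha>s ! v * I (Suc v) \<le> d * I (Suc v)" using ip by (intro mult_right_mono) auto
    then show False using bound ip2 t'0 by linarith
  qed
  have d2: "d \<le> \<alpha>s ! v - 2" if "t < I v - I (Suc v)"
  proof (rule ccontr)
    assume "\<not> ?thesis"
    then have "(\<alpha>s ! v - 1) * I (Suc v) \<le> d * I (Suc v)" using ip by (intro mult_right_mono) auto
    then show False using that e ip2 t'0 by (simp add: algebra_simps)
  qed
  have d3: "t' < I (Suc v) - I (Suc (Suc v))" if d: "d = \<alpha>s ! v - 1"
    using bound unfolding d by (simp add: left_diff_distrib)
  have d4: "t' < I (Suc v) - I (Suc (Suc v))" if "t < I v - I (Suc v)" and d: "d = \<alpha>s ! v - 2"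
    using that(1) unfolding e d by (simp add: left_diff_distrib)
  have "gen_count t = d + gen_count t'" using gen_count_digit[OF v d0 t'0(1)] t e by simp
  then show ?thesis by (rule that[OF e d0 t'0 _ d1]) (fact d2 d3 d4)+
qed

lemma gen_count_bounds:
  assumes "v \<le> r" "0 \<le> t" "t < I v"
  shows "gen_count t \<le> excess v + 2 \<and> (t < I v - I (Suc v) \<longrightarrow> gen_count t \<le> excess v + 1)"
  using assms
proof (induction "r - v" arbitrary: v t)
  case 0
  then have "t = 0" using I_length by simp
  then show ?case using excess_nonneg[of v] by (simp add: gen_count_0)
next
  case (Suc k)
  then have v: "v < r" by simp
  obtain d t' where e: "t = d * I (Suc v) + t'" and d0: "0 \<le> d" and
    d: "0 \<le> t'" "t' < I (Suc v)" "gen_count t = d + gen_count t'"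
    "d \<le> \<alpha>s ! v - 1" "d = \<alpha>s ! v - 1 \<Longrightarrow> t' < I (Suc v) - I (Suc (Suc v))"
    "t < I v - I (Suc v) \<Longrightarrow> d \<le> \<alpha>s ! v - 2"
    "t < I v - I (Suc v) \<Longrightarrow> d = \<alpha>s ! v - 2 \<Longrightarrow> t' < I (Suc v) - I (Suc (Suc v))"
    by (rule digit_cases[OF v Suc.prems(2,3)], rule that) assumption+
  have IH: "gen_count t' \<le> excess (Suc v) + 2" "t' < I (Suc v) - I (Suc (Suc v)) \<Longrightarrow> gen_count t' \<le> excess (Suc v) + 1"
    using Suc.hyps(1)[of "Suc v" t'] Suc.hyps(2) v d by auto
  show ?case
    unfolding excess_rec[OF v]
    using IH d(3-7) by (cases "d = \<alpha>s ! v - 1"; cases "d = \<alpha>s ! v - 2"; auto)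
qed

text \<open>
  Expansions whose digits deviate from \<open>\<alpha>\<^sub>u - 2\<close> by \<open>-1, +1, -1, +1, \<dots>\<close>, respectively by
  \<open>+1, -1, +1, \<dots>, +1\<close>, attain the bounds; both cases are needed together because the first digit
  passes from one to the other.
\<close>

lemma gen_count_of_alternating:
  assumes "v \<le> r"
  shows "(\<forall>ps. alternating v ps \<longrightarrow> 0 \<le> low v - drop_sum ps \<and> gen_count (low v - drop_sum ps) = excess v + 1) \<and>
    (\<forall>p ps. v < p \<and> p \<le> r \<and> alternating p ps \<longrightarrow>
      0 \<le> low v + I p - drop_sum ps \<and> low v + I p - drop_sum ps < I v \<and>
      gen_count (low v + I p - drop_sum ps) = excess v + 2)"
  using assms
proof (induction "r - v" arbitrary: v)
  case 0
  then have v: "v = r" by simp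
  have e: "alternating r ps \<longleftrightarrow> ps = []" for ps by (cases ps) auto
  show ?case unfolding v e using I_length I_end by (auto simp: gen_count_0 low_def excess_def)
next
  case (Suc k)
  then have v: "v < r" by simp
  have IH1: "0 \<le> low (Suc v) - drop_sum ps" "gen_count (low (Suc v) - drop_sum ps) = excess (Suc v) + 1"
    if "alternating (Suc v) ps" for ps using Suc.hyps(1)[of "Suc v"] Suc.hyps(2) v that by auto
  have IH2: "0 \<le> low (Suc v) + I p - drop_sum ps" "low (Suc v) + I p - drop_sum ps < I (Suc v)"
     "gen_count (low (Suc v) + I p - drop_sum ps) = excess (Suc v) + 2"
    if "Suc v < p" "p \<le> r" "alternating p ps" for p ps
    using Suc.hyps(1)[of "Suc v"] Suc.hyps(2) v that by auto
  have ip: "0 < I (Suc v)" using I_pos[of "Suc v"] v by simp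
  have ip2: "0 \<le> I (Suc (Suc v))" "I (Suc (Suc v)) < I (Suc v)"
    using I_pos[of "Suc (Suc v)"] I_end I_strict[of "Suc v" "Suc (Suc v)"] v by (cases "Suc v = r"; simp)+
  have a2: "2 \<le> \<alpha>s ! v" using alpha_ge_2 v by simp
  have lt: "low v < I v" using ip by (simp add: low_def)
  show ?case
  proof (intro conjI allI impI; (elim conjE)?)
    fix ps assume ps: "alternating v ps"
    have "0 \<le> low v - drop_sum ps \<and> gen_count (low v - drop_sum ps) = excess v + 1"
    proof (cases "alternating (Suc v) ps")
      case True
      have "gen_count ((\<alpha>s ! v - 2) * I (Suc v) + (low (Suc v) - drop_sum ps)) = \<alpha>s ! v - 2 + gen_count (low (Suc v) - drop_sum ps)"
        using IH1(1)[OF True] a2 drop_sum_nonneg[OF ps] lt low_rec[of v] by (intro gen_count_digit[OF v]) auto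
      moreover have "0 \<le> (\<alpha>s ! v - 2) * I (Suc v)" using a2 ip by simp
      ultimately show ?thesis using IH1[OF True] unfolding low_rec[of v] excess_rec[OF v] by (simp add: algebra_simps)
    next
      case False
      then obtain p ps' where e: "ps = (Suc v, p) # ps'" using alternating_Suc[OF ps] by auto
      have p: "Suc v < p" "p \<le> r" "alternating p ps'" "3 \<le> \<alpha>s ! v" using ps by (auto simp: e)
      have "0 \<le> (\<alpha>s ! v - 3) * I (Suc v)" using p ip by simp
      moreover have "(\<alpha>s ! v - 3) * I (Suc v) + (low (Suc v) + I p - drop_sum ps') = low v - drop_sum ps"
        unfolding low_rec[of v] e by (simp add: algebra_simps)
      moreover have "gen_count ((\<alpha>s ! v - 3) * I (Suc v) + (low (Suc v) + I p - drop_sum ps')) =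
          \<alpha>s ! v - 3 + gen_count (low (Suc v) + I p - drop_sum ps')"
        using IH2(1)[OF p(1-3)] p calculation(2) lt drop_sum_nonneg[OF ps] by (intro gen_count_digit[OF v]) auto
      ultimately show ?thesis using IH2[OF p(1-3)] unfolding excess_rec[OF v] by simp
    qed
    then show "0 \<le> low v - drop_sum ps" "gen_count (low v - drop_sum ps) = excess v + 1" by auto
  next
    fix p ps assume p: "v < p" "p \<le> r" "alternating p ps"
    have "0 \<le> low v + I p - drop_sum ps \<and> low v + I p - drop_sum ps < I v \<and>
      gen_count (low v + I p - drop_sum ps) = excess v + 2"
    proof (cases "p = Suc v")
      case True
      have ps: "alternating (Suc v) ps" using p True by simp
      have e: "(\<alpha>s ! v - 1) * I (Suc v) + (low (Suc v) - drop_sum ps) = low v + I p - drop_sum ps"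
        unfolding low_rec[of v] True by (simp add: algebra_simps)
      have l: "low v + I p - drop_sum ps < I v"
        using drop_sum_nonneg[OF ps] by (simp add: low_def True)
      have "gen_count ((\<alpha>s ! v - 1) * I (Suc v) + (low (Suc v) - drop_sum ps)) = \<alpha>s ! v - 1 + gen_count (low (Suc v) - drop_sum ps)"
        using IH1(1)[OF ps] a2 l e by (intro gen_count_digit[OF v]) auto
      moreover have "0 \<le> (\<alpha>s ! v - 1) * I (Suc v)" using a2 ip by simp
      ultimately show ?thesis using IH1[OF ps] l e unfolding excess_rec[OF v] by simp
    next
      case False
      then have p': "Suc v < p" "p \<le> r" "alternating p ps" using p by auto
      have e: "(\<alpha>s ! v - 2) * I (Suc v) + (low (Suc v) + I p - drop_sum ps) = low v + I p - drop_sum ps"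
        unfolding low_rec[of v] by (simp add: algebra_simps)
      have "I p < I (Suc v)" using I_strict[of "Suc v" p] p' by auto
      then have l: "low v + I p - drop_sum ps < I v"
        using drop_sum_nonneg[OF p(3)] by (simp add: low_def)
      have "gen_count ((\<alpha>s ! v - 2) * I (Suc v) + (low (Suc v) + I p - drop_sum ps)) =
          \<alpha>s ! v - 2 + gen_count (low (Suc v) + I p - drop_sum ps)"
        using IH2(1)[OF p'] a2 l e by (intro gen_count_digit[OF v]) auto
      moreover have "0 \<le> (\<alpha>s ! v - 2) * I (Suc v)" using a2 ip by simp
      ultimately show ?thesis using IH2[OF p'] l e unfolding excess_rec[OF v] by simp
    qed
    then show "0 \<le> low v + I p - drop_sum ps" "low v + I p - drop_sum ps < I v"
      "gen_count (low v + I p - drop_sum ps) = excess v + 2" by auto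
  qed
qed

text \<open>
  Conversely, equality in the bounds forces equality at every level, and hence deviations of this
  alternating form.
\<close>

lemma alternating_of_gen_count:
  assumes "v \<le> r" "0 \<le> t" "t < I v"
  shows "(gen_count t = excess v + 2 \<longrightarrow> (\<exists>p ps. v < p \<and> p \<le> r \<and> alternating p ps \<and> t = low v + I p - drop_sum ps)) \<and>
    (t < I v - I (Suc v) \<and> gen_count t = excess v + 1 \<longrightarrow> (\<exists>ps. alternating v ps \<and> t = low v - drop_sum ps))"
  using assms
proof (induction "r - v" arbitrary: v t)
  case 0
  then have v: "v = r" by simp
  then have "t = 0" using 0 I_length by simp
  then show ?case using I_length I_end v
    by (auto simp: gen_count_0 excess_def low_def intro: exI[of _ "[]"])
next
  case (Suc k)
  then have v: "v < r" by simp
  have ip: "0 < I (Suc v)" using I_pos[of "Suc v"] v by simp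
  obtain d t' where e: "t = d * I (Suc v) + t'" and d0: "0 \<le> d" and
    d: "0 \<le> t'" "t' < I (Suc v)" "gen_count t = d + gen_count t'"
    "d \<le> \<alpha>s ! v - 1" "d = \<alpha>s ! v - 1 \<Longrightarrow> t' < I (Suc v) - I (Suc (Suc v))"
    "t < I v - I (Suc v) \<Longrightarrow> d \<le> \<alpha>s ! v - 2"
    "t < I v - I (Suc v) \<Longrightarrow> d = \<alpha>s ! v - 2 \<Longrightarrow> t' < I (Suc v) - I (Suc (Suc v))"
    by (rule digit_cases[OF v Suc.prems(2,3)], rule that) assumption+
  have bd: "gen_count t' \<le> excess (Suc v) + 2" "t' < I (Suc v) - I (Suc (Suc v)) \<Longrightarrow> gen_count t' \<le> excess (Suc v) + 1"
    using gen_count_bounds[of "Suc v" t'] v d by auto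
  have IH1: "\<exists>p ps. Suc v < p \<and> p \<le> r \<and> alternating p ps \<and> t' = low (Suc v) + I p - drop_sum ps"
    if "gen_count t' = excess (Suc v) + 2"
    using Suc.hyps(1)[of "Suc v" t'] Suc.hyps(2) v d that by auto
  have IH2: "\<exists>ps. alternating (Suc v) ps \<and> t' = low (Suc v) - drop_sum ps"
    if "t' < I (Suc v) - I (Suc (Suc v))" "gen_count t' = excess (Suc v) + 1"
    using Suc.hyps(1)[of "Suc v" t'] Suc.hyps(2) v d that by auto
  show ?case
  proof (intro conjI impI; (elim conjE)?)
    assume n: "gen_count t = excess v + 2"
    show "\<exists>p ps. v < p \<and> p \<le> r \<and> alternating p ps \<and> t = low v + I p - drop_sum ps"
    proof (cases "d = \<alpha>s ! v - 1")
      case True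
      then have "gen_count t' = excess (Suc v) + 1" using n d(3) unfolding excess_rec[OF v] by simp
      then obtain ps where ps: "alternating (Suc v) ps" "t' = low (Suc v) - drop_sum ps"
        using IH2 d(5) True by blast
      then show ?thesis using v unfolding e True low_rec[of v]
        by (intro exI[of _ "Suc v"] exI[of _ ps]) (simp add: algebra_simps)
    next
      case False
      then have "gen_count t' = excess (Suc v) + 2" "d = \<alpha>s ! v - 2"
        using n d(3,4) bd(1) unfolding excess_rec[OF v] by auto
      then obtain p ps where "Suc v < p" "p \<le> r" "alternating p ps" "t' = low (Suc v) + I p - drop_sum ps"
        using IH1 by blast
      then show ?thesis unfolding e \<open>d = _\<close> low_rec[of v]
        by (intro exI[of _ p] exI[of _ ps]) simp
    qed
  next
    assume l: "t < I v - I (Suc v)" and n: "gen_count t = excess v + 1"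
    show "\<exists>ps. alternating v ps \<and> t = low v - drop_sum ps"
    proof (cases "d = \<alpha>s ! v - 2")
      case True
      then have "gen_count t' = excess (Suc v) + 1" using n d(3) unfolding excess_rec[OF v] by simp
      then obtain ps where ps: "alternating (Suc v) ps" "t' = low (Suc v) - drop_sum ps"
        using IH2 d(7) l True by blast
      then show ?thesis unfolding e True low_rec[of v]
        using alternating_mono[OF ps(1), of v] by (intro exI[of _ ps]) simp
    next
      case False
      then have "gen_count t' = excess (Suc v) + 2" and d3: "d = \<alpha>s ! v - 3"
        using n d(3,6) l bd(1) unfolding excess_rec[OF v] by auto
      then obtain p ps where p: "Suc v < p" "p \<le> r" "alternating p ps" "t' = low (Suc v) + I p - drop_sum ps"
        using IH1 by blast
      have "2 < \<alpha>s ! v" using d0 d3 by simp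
      then show ?thesis unfolding e d3 low_rec[of v] using p
        by (intro exI[of _ "(Suc v, p) # ps"]) (simp add: algebra_simps)
    qed
  qed
qed

lemma gen_count_maximal_iff:
  assumes "0 \<le> t" "t < int n"
  shows "gen_count t = excess 0 + 2 \<longleftrightarrow>
    (\<exists>p ps. 1 \<le> p \<and> p \<le> r \<and> alternating p ps \<and> t = int n - 1 - (int a - I p) - drop_sum ps)"
proof -
  have l: "int n - 1 - (int a - I p) - drop_sum ps = low 0 + I p - drop_sum ps" for p ps
    by (simp add: low_def)
  have 1: "gen_count t = excess 0 + 2 \<longrightarrow> (\<exists>p ps. 0 < p \<and> p \<le> r \<and> alternating p ps \<and> t = low 0 + I p - drop_sum ps)"
    using alternating_of_gen_count[of 0 t] assms by simp
  have 2: "\<And>p ps. 0 < p \<and> p \<le> r \<and> alternating p ps \<Longrightarrow> gen_count (low 0 + I p - drop_sum ps) = excess 0 + 2"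
    using gen_count_of_alternating[of 0] by simp
  show ?thesis unfolding l One_nat_def Suc_le_eq
  proof
    assume "gen_count t = excess 0 + 2"
    then show "\<exists>p ps. 0 < p \<and> p \<le> r \<and> alternating p ps \<and> t = low 0 + I p - drop_sum ps"
      by (rule 1[THEN mp])
  next
    assume "\<exists>p ps. 0 < p \<and> p \<le> r \<and> alternating p ps \<and> t = low 0 + I p - drop_sum ps"
    then show "gen_count t = excess 0 + 2" using 2 by (elim exE) simp
  qed
qed

text \<open>
  The index sequences \<open>k(1) < k(2) < \<dots>\<close>, grouped into consecutive pairs. They differ from alternating
  lists only in that a first pair may start with the index 1 when \<open>\<alpha>\<^sub>1 = 2\<close>.
\<close>

fun admissible_pairs :: "nat \<Rightarrow> (nat \<times> nat) list \<Rightarrow> bool" where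
  "admissible_pairs v [] \<longleftrightarrow> True"
| "admissible_pairs v ((q, p) # ps) \<longleftrightarrow>
    v < q \<and> q < p \<and> p \<le> r \<and> (q = 1 \<or> 2 < \<alpha> q) \<and> admissible_pairs p ps"

lemma admissible_pairs_alternating:
  "1 \<le> v \<Longrightarrow> admissible_pairs v ps \<longleftrightarrow> alternating v ps"
proof (induction v ps rule: alternating.induct)
  case (2 v q p ps)
  then show ?case by (auto simp: intro: 2)
qed auto

text \<open>
  The initial raised index \<open>p\<close> of the extremal expansions is absorbed into a pair \<open>(1, p)\<close>, since
  \<open>n - 1\<close> already has its first digit raised; this is why \<open>i\<^sub>1\<close> is always allowed in odd position.
\<close>

lemma alternating_iff_admissible:
  "(\<exists>p ps. 1 \<le> p \<and> p \<le> r \<and> alternating p ps \<and> t = int n - 1 - (int a - I p) - drop_sum ps) \<longleftrightarrow>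
   (\<exists>ps. admissible_pairs 0 ps \<and> t = int n - 1 - drop_sum ps)" (is "?L \<longleftrightarrow> ?R")
proof
  assume ?L
  then obtain p ps where p: "1 \<le> p" "p \<le> r" "alternating p ps" "t = int n - 1 - (int a - I p) - drop_sum ps"
    by blast
  have adm: "admissible_pairs p ps" using admissible_pairs_alternating[OF p(1)] p(3) by simp
  show ?R
  proof (cases "p = 1")
    case True
    have "admissible_pairs 0 ps" using adm by (cases ps) auto
    then show ?thesis using p True by auto
  next
    case False
    then have "admissible_pairs 0 ((1, p) # ps)" using adm p by simp
    then show ?thesis using p by (intro exI[of _ "(1, p) # ps"]) auto
  qed
next
  assume ?R
  then obtain ps where ps: "admissible_pairs 0 ps" "t = int n - 1 - drop_sum ps" by blast
  show ?L
  proof (cases "\<exists>p ps'. ps = (1, p) # ps'")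
    case True
    then obtain p ps' where e: "ps = (1, p) # ps'" by blast
    then have "1 \<le> p" using ps by simp
    then show ?thesis using ps e admissible_pairs_alternating[of p ps'] by (intro exI[of _ p] exI[of _ ps']) auto
  next
    case False
    then have "admissible_pairs 1 ps" using ps(1) by (cases ps) (auto simp: le_less_Suc_eq Suc_le_eq intro: Suc_lessI)
    then show ?thesis using ps r_pos admissible_pairs_alternating[of 1 ps] by (intro exI[of _ 1] exI[of _ ps]) auto
  qed
qed

lemma admissible_pairs_nth:
  "admissible_pairs v ps \<longleftrightarrow>
    (\<forall>c<length ps. (if c = 0 then v else snd (ps ! (c - 1))) < fst (ps ! c) \<and> fst (ps ! c) < snd (ps ! c) \<and>
       snd (ps ! c) \<le> r \<and> (fst (ps ! c) = 1 \<or> 2 < \<alpha> (fst (ps ! c))))"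
proof (induction v ps rule: admissible_pairs.induct)
  case (2 v q p ps)
  have "(\<forall>c<length ((q, p) # ps). P c) \<longleftrightarrow> P 0 \<and> (\<forall>c<length ps. P (Suc c))" for P
    by (auto simp: less_Suc_eq_0_disj)
  note * = this
  show ?case unfolding * admissible_pairs.simps 2
    by (auto simp: nth_Cons' split: if_splits)
qed simp

lemma mem_I_last:
  assumes "1 \<le> q" "q < r"
  shows "I q \<in> I_last n a \<alpha>s \<longleftrightarrow> q = 1 \<or> 2 < \<alpha> q"
proof -
  have e: "I q = I s \<longleftrightarrow> q = s" if "s \<le> r" for s using I_eq_iff[of s q] that assms by auto
  have e': "I q = I s \<longleftrightarrow> q = s" if "s \<le> r - 1" for s using e[of s] that by simp
  have "I q \<in> I_last n a \<alpha>s \<longleftrightarrow> q = 1 \<or> (\<exists>s. I q = I s \<and> 2 < \<alpha> s \<and> 2 \<le> s \<and> s \<le> r - 1)"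
    using e[of 1] r_pos unfolding I_last_def by auto
  also have "(\<exists>s. I q = I s \<and> 2 < \<alpha> s \<and> 2 \<le> s \<and> s \<le> r - 1) \<longleftrightarrow> (\<exists>s. q = s \<and> 2 < \<alpha> s \<and> 2 \<le> s \<and> s \<le> r - 1)"
    using e' by blast
  also have "q = 1 \<or> (\<exists>s. q = s \<and> 2 < \<alpha> s \<and> 2 \<le> s \<and> s \<le> r - 1) \<longleftrightarrow> q = 1 \<or> 2 < \<alpha> q" using assms by auto
  finally show ?thesis .
qed

lemma t_of_seq_pairs:
  "t_of_seq n a \<alpha>s b k = int n - 1 - drop_sum (map (\<lambda>c. (k (2 * c + 1), k (2 * c + 2))) [0..<b])"
proof -
  have "(\<Sum>c = 1..b. I (k (2 * c - 1)) - I (k (2 * c))) = (\<Sum>c = 0..<b. I (k (2 * c + 1)) - I (k (2 * c + 2)))"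
    by (induction b) simp_all
  then show ?thesis by (simp add: t_of_seq_def drop_sum_def o_def sum_list_distinct_conv_sum_set interv_sum_list_conv_sum_set_nat)
qed

lemma admissible_pairs_map:
  "admissible_pairs 0 (map (\<lambda>c. (f c, g c)) [0..<b]) \<longleftrightarrow>
    (\<forall>c<b. (if c = 0 then 0 else g (c - 1)) < f c \<and> f c < g c \<and> g c \<le> r \<and> (f c = 1 \<or> 2 < \<alpha> (f c)))"
proof -
  have "map (\<lambda>c. (f c, g c)) [0..<b] ! c = (f c, g c)"
    "snd (map (\<lambda>c. (f c, g c)) [0..<b] ! (c - 1)) = g (c - 1)" if "c < b" for c
    using that by auto
  then show ?thesis unfolding admissible_pairs_nth length_map length_upt
    by (intro all_cong1 imp_cong) (simp_all add: less_imp_diff_less)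
qed

lemma admissible_seq_pairs:
  "admissible_seq n a \<alpha>s b k \<longleftrightarrow>
    1 \<le> b \<and> admissible_pairs 0 (map (\<lambda>c. (k (2 * c + 1), k (2 * c + 2))) [0..<b])" (is "?L \<longleftrightarrow> ?R")
proof
  assume ?L
  then have b: "1 \<le> b" and rng: "\<And>l. 1 \<le> l \<Longrightarrow> l \<le> 2 * b \<Longrightarrow> 1 \<le> k l \<and> k l \<le> r"
    and less: "\<And>l. 1 \<le> l \<Longrightarrow> l < 2 * b \<Longrightarrow> I (k (l + 1)) < I (k l)"
    and mem: "\<And>c. 1 \<le> c \<Longrightarrow> c \<le> b \<Longrightarrow> I (k (2 * c - 1)) \<in> I_last n a \<alpha>s"
    by (auto simp: admissible_seq_def)
  have kl: "k l < k (l + 1)" if "1 \<le> l" "l < 2 * b" for l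
    using less[OF that] rng[of l] rng[of "l + 1"] that I_less_iff[of "k l" "k (l + 1)"] by auto
  have "admissible_pairs 0 (map (\<lambda>c. (k (2 * c + 1), k (2 * c + 2))) [0..<b])"
  proof (rule admissible_pairs_map[THEN iffD2], intro allI impI)
    fix c assume c: "c < b"
    show "(if c = 0 then 0 else k (2 * (c - 1) + 2)) < k (2 * c + 1) \<and> k (2 * c + 1) < k (2 * c + 2) \<and>
      k (2 * c + 2) \<le> r \<and> (k (2 * c + 1) = 1 \<or> 2 < \<alpha> (k (2 * c + 1)))"
    proof (intro conjI)
    show "(if c = 0 then 0 else k (2 * (c - 1) + 2)) < k (2 * c + 1)"
      using rng[of 1] kl[of "2 * c"] c by (cases c) auto
    show q: "k (2 * c + 1) < k (2 * c + 2)" using kl[of "2 * c + 1"] c by simp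
    show p: "k (2 * c + 2) \<le> r" using rng[of "2 * c + 2"] c by simp
    show "k (2 * c + 1) = 1 \<or> 2 < \<alpha> (k (2 * c + 1))"
      using mem[of "Suc c"] mem_I_last[of "k (2 * c + 1)"] rng[of "2 * c + 1"] c q p by simp
    qed
  qed
  then show ?R using b by (intro conjI)
next
  assume R: ?R
  have b: "1 \<le> b" using R by (rule conjunct1)
  note R' = admissible_pairs_map[THEN iffD1, OF conjunct2[OF R]]
  have h: "\<And>c. c < b \<Longrightarrow> (if c = 0 then 0 else k (2 * (c - 1) + 2)) < k (2 * c + 1) \<and>
      k (2 * c + 1) < k (2 * c + 2) \<and> k (2 * c + 2) \<le> r \<and> (k (2 * c + 1) = 1 \<or> 2 < \<alpha> (k (2 * c + 1)))"
    by (rule R'[THEN spec, THEN mp])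
  have odd: "\<exists>c<b. l = 2 * c + 1 \<or> l = 2 * c + 2" if "1 \<le> l" "l \<le> 2 * b" for l
    using that by (intro exI[of _ "(l - 1) div 2"]) auto
  have rng: "1 \<le> k l \<and> k l \<le> r" if l: "1 \<le> l" "l \<le> 2 * b" for l
  proof -
    obtain c where c: "c < b" "l = 2 * c + 1 \<or> l = 2 * c + 2" using odd[OF l] by blast
    then show ?thesis using h[OF c(1)] by (auto split: if_splits)
  qed
  have kl: "k l < k (l + 1)" if l: "1 \<le> l" "l < 2 * b" for l
  proof -
    obtain c where c: "c < b" "l = 2 * c + 1 \<or> l = 2 * c + 2" using odd[OF l(1) less_imp_le[OF l(2)]] by blast
    show ?thesis
    proof (cases "l = 2 * c + 1")
      case True
      then show ?thesis using h[OF c(1)] by simp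
    next
      case False
      then have "l = 2 * c + 2" "Suc c < b" using c l by auto
      then show ?thesis using h[of "Suc c"] by simp
    qed
  qed
  have less: "I (k (l + 1)) < I (k l)" if "1 \<le> l" "l < 2 * b" for l
    using kl[OF that] rng[of l] rng[of "l + 1"] that I_less_iff[of "k l" "k (l + 1)"] by auto
  have mem: "I (k (2 * c - 1)) \<in> I_last n a \<alpha>s" if c: "1 \<le> c" "c \<le> b" for c
  proof -
    obtain c' where c': "c = Suc c'" "c' < b" using c by (cases c) auto
    then show ?thesis using h[of c'] rng[of "2 * c' + 1"] mem_I_last[of "k (2 * c' + 1)"] by auto
  qed
  show ?L using b rng less mem by (auto simp: admissible_seq_def)
qed

lemma ex_admissible_seq_iff:
  "(\<exists>b k. admissible_seq n a \<alpha>s b k \<and> t = t_of_seq n a \<alpha>s b k) \<or> t = int n - 1 \<longleftrightarrow>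
   (\<exists>ps. admissible_pairs 0 ps \<and> t = int n - 1 - drop_sum ps)" (is "?L \<longleftrightarrow> ?R")
proof
  assume ?L
  then show ?R
  proof
    assume "t = int n - 1"
    then show ?R by (intro exI[of _ "[]"]) simp
  qed (auto simp: admissible_seq_pairs t_of_seq_pairs)
next
  assume ?R
  then obtain ps where ps: "admissible_pairs 0 ps" "t = int n - 1 - drop_sum ps" by blast
  define k where "k = (\<lambda>l. if odd l then fst (ps ! (l div 2)) else snd (ps ! (l div 2 - 1)))"
  have m: "map (\<lambda>c. (k (2 * c + 1), k (2 * c + 2))) [0..<length ps] = ps"
    by (rule nth_equalityI) (auto simp: k_def)
  show ?L
  proof (cases "ps = []")
    case False
    then have "1 \<le> length ps" by (cases ps) auto
    then have "admissible_seq n a \<alpha>s (length ps) k \<and> t = t_of_seq n a \<alpha>s (length ps) k"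
      unfolding admissible_seq_pairs t_of_seq_pairs m using ps by simp
    then show ?thesis by blast
  qed (use ps in simp)
qed

lemma gen_count_maximal_iff_admissible:
  assumes "0 \<le> t" "t < int n"
  shows "gen_count t = excess 0 + 2 \<longleftrightarrow>
    (\<exists>b k. admissible_seq n a \<alpha>s b k \<and> t = t_of_seq n a \<alpha>s b k) \<or> t = int n - 1"
  unfolding gen_count_maximal_iff[OF assms] alternating_iff_admissible ex_admissible_seq_iff ..

lemma t_of_admissible_range:
  assumes "(\<exists>b k. admissible_seq n a \<alpha>s b k \<and> t = t_of_seq n a \<alpha>s b k) \<or> t = int n - 1"
  shows "0 \<le> t" "t < int n"
proof -
  obtain p ps where "1 \<le> p" "p \<le> r" "alternating p ps" "t = int n - 1 - (int a - I p) - drop_sum ps"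
    using assms unfolding ex_admissible_seq_iff alternating_iff_admissible[symmetric] by blast
  then have "0 \<le> low 0 + I p - drop_sum ps \<and> low 0 + I p - drop_sum ps < I 0" "t = low 0 + I p - drop_sum ps"
    using gen_count_of_alternating[of 0] by (auto simp: low_def Suc_le_eq)
  then show "0 \<le> t" "t < int n" by auto
qed

end

section \<open>Counting exponents along the Newton boundary\<close>

definition triangle :: "nat \<Rightarrow> (nat \<times> nat) set" where
  "triangle l = Sigma {..<l} (\<lambda>A. {..<l - A})"

lemma finite_triangle: "finite (triangle l)"
  by (simp add: triangle_def)

lemma mem_triangle: "(A, B) \<in> triangle l \<longleftrightarrow> A + B < l"
  by (auto simp: triangle_def)

lemma card_triangle: "2 * card (triangle l) = l * (l + 1)"
proof -
  have "2 * (\<Sum>A<l. l - A) = l * (l + 1)"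
  proof (induction l)
    case (Suc l)
    have "(\<Sum>A<Suc l. Suc l - A) = Suc l + (\<Sum>A<l. l - A)"
      by (subst sum.lessThan_Suc_shift) simp
    then show ?case using Suc by simp
  qed simp
  then show ?thesis by (simp add: triangle_def)
qed

lemma le_of_one_le_div: "0 < m \<Longrightarrow> 1 \<le> x div m \<Longrightarrow> m \<le> x" for m x :: int
  using mult_left_mono[of 1 "x div m" m] mult_div_mod_eq[of m x] pos_mod_sign[of m x] by linarith

lemma minus_self_div: "0 < m \<Longrightarrow> (x - m) div m = x div m - 1" for m x :: int
  using div_mult_self2[of m x "-1"] by simp

text \<open>
  A chain of invariant monomials descending from \<open>x\<^sup>n\<close> to \<open>y\<^sup>n\<close> in which neighbours span the lattice of
  invariant Laurent monomials. Such a chain subdivides the quadrant into \<open>e\<close> unimodular cones.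
\<close>

locale lattice_chain = cyclic_type +
  fixes e :: nat and px py :: "nat \<Rightarrow> int"
  assumes chain_start: "px 0 = int n" "py 0 = 0"
    and chain_end: "px e = 0" "py e = int n"
    and chain_mono: "\<And>v. v < e \<Longrightarrow> px (Suc v) < px v" "\<And>v. v < e \<Longrightarrow> py v < py (Suc v)"
    and chain_det: "\<And>v. v < e \<Longrightarrow> px v * py (Suc v) - px (Suc v) * py v = int n"
    and chain_cong: "\<And>v. v \<le> e \<Longrightarrow> int n dvd px v + int a * py v"
begin

lemma e_pos: "0 < e"
  using chain_start chain_end n_gt_1 by (cases e) auto

lemma px_nonneg: "v \<le> e \<Longrightarrow> 0 \<le> px v"
proof (induction "e - v" arbitrary: v)
  case (Suc k)
  then have "0 \<le> px (Suc v)" "v < e" by auto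
  then show ?case using chain_mono(1)[of v] by simp
qed (use chain_end in auto)

lemma py_nonneg: "v \<le> e \<Longrightarrow> 0 \<le> py v"
proof (induction v)
  case (Suc v)
  then show ?case using chain_mono(2)[of v] by simp
qed (use chain_start in auto)

text \<open>
  The determinant of the chain point \<open>v\<close> and the exponent \<open>(i, j)\<close>. Its sign tells on which side of
  the ray through that point the exponent lies, and \<open>D v\<close> and \<open>- D (v + 1)\<close> are \<open>n\<close> times the
  coordinates with respect to the points \<open>v + 1\<close> and \<open>v\<close>.
\<close>

definition D :: "nat \<Rightarrow> nat \<times> nat \<Rightarrow> int" where
  "D v = (\<lambda>(i, j). px v * int j - py v * int i)"

lemma D_diff: "D v (i, j) - D (Suc v) (i, j) = (px v - px (Suc v)) * int j + (py (Suc v) - py v) * int i"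
  by (simp add: D_def algebra_simps)

lemma D_decreasing: "v < e \<Longrightarrow> D (Suc v) z \<le> D v z"
  using D_diff[of v "fst z" "snd z"] chain_mono[of v]
  by (metis add_nonneg_nonneg diff_ge_0_iff_ge less_imp_le mult_nonneg_nonneg of_nat_0_le_iff prod.collapse)

lemma D_antimono: "v \<le> w \<Longrightarrow> w \<le> e \<Longrightarrow> D w z \<le> D v z"
proof (induction w)
  case (Suc w)
  then show ?case using D_decreasing[of w z] by (cases "v = Suc w") auto
qed auto

lemma D_cong:
  assumes "v \<le> e" "(i, j) \<in> expo t"
  shows "[D v (i, j) = - py v * t] (mod int n)"
proof -
  have "int n dvd (px v + int a * py v) * int j - py v * (int i + int j * int a - t)"
    using chain_cong[OF assms(1)] assms(2) by (auto simp: expo_iff cong_iff_dvd_diff)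
  then show ?thesis by (simp add: D_def cong_iff_dvd_diff algebra_simps)
qed

lemma chain_coords:
  assumes "v < e"
  shows "int n * int i = - D (Suc v) (i, j) * px v + D v (i, j) * px (Suc v)"
    "int n * int j = - D (Suc v) (i, j) * py v + D v (i, j) * py (Suc v)"
  unfolding chain_det[OF assms, symmetric] D_def by (simp_all add: algebra_simps)

text \<open>
  On exponents of invariants, \<open>D v - D (v + 1)\<close> is divisible by \<open>n\<close>, and it is a positive
  combination of the coordinates; hence it is at least \<open>n\<close> on every non-constant invariant monomial.
\<close>

lemma power_expo_height:
  assumes v: "v < e" and "z \<in> power_expo t k"
  shows "int n * int k \<le> D v z - D (Suc v) z"
  using assms(2)
proof (induction k arbitrary: z)
  case 0
  then show ?case using D_decreasing[OF v, of z] by simp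
next
  case (Suc k)
  then obtain p q i j where z: "z = (p + i, q + j)" and pq: "(p, q) \<in> expo 0" "(p, q) \<noteq> (0, 0)"
    and ij: "(i, j) \<in> power_expo t k" by auto
  have m: "0 < px v - px (Suc v)" "0 < py (Suc v) - py v" using chain_mono[OF v] by auto
  have "[D v (p, q) - D (Suc v) (p, q) = - py v * 0 - (- py (Suc v) * 0)] (mod int n)"
    using v by (intro cong_diff D_cong pq) auto
  then have "int n dvd D v (p, q) - D (Suc v) (p, q)" by (simp add: cong_iff_dvd_diff)
  moreover have "0 < D v (p, q) - D (Suc v) (p, q)"
  proof (cases "p = 0")
    case True
    then have "0 < q" using pq by simp
    then show ?thesis using m unfolding D_diff by (intro add_pos_nonneg mult_pos_pos mult_nonneg_nonneg) auto
  next
    case False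
    then show ?thesis using m unfolding D_diff by (intro add_nonneg_pos mult_pos_pos mult_nonneg_nonneg) auto
  qed
  ultimately have "int n \<le> D v (p, q) - D (Suc v) (p, q)" by (rule zdvd_imp_le)
  moreover have "int n * int k \<le> D v (i, j) - D (Suc v) (i, j)" using Suc.IH[OF ij] .
  moreover have "D w z = D w (p, q) + D w (i, j)" for w by (simp add: z D_def algebra_simps)
  ultimately show ?case by (simp add: algebra_simps)
qed

text \<open>
  Inside the cone of the points \<open>v\<close> and \<open>v + 1\<close>, as long as one of the coordinates is at least 1, the
  corresponding chain point can be split off without leaving the quadrant.
\<close>

lemma power_expo_cone:
  assumes v: "v < e"
  shows "(i, j) \<in> expo t \<Longrightarrow> 0 \<le> D v (i, j) \<Longrightarrow> D (Suc v) (i, j) \<le> 0 \<Longrightarrow>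
    int k \<le> D v (i, j) div int n + (- D (Suc v) (i, j)) div int n \<Longrightarrow> (i, j) \<in> power_expo t k"
proof (induction k arbitrary: i j)
  case (Suc k)
  have n0: "0 < int n" using n_gt_1 by simp
  have pxy: "0 \<le> px v" "0 \<le> px (Suc v)" "0 \<le> py v" "0 \<le> py (Suc v)"
    using px_nonneg[of v] px_nonneg[of "Suc v"] py_nonneg[of v] py_nonneg[of "Suc v"] v by auto
  have step: ?case if w: "w = v \<or> w = Suc v" and le: "px w \<le> int i" "py w \<le> int j"
    and new: "\<And>i' j'. int i' = int i - px w \<Longrightarrow> int j' = int j - py w \<Longrightarrow>
      0 \<le> D v (i', j') \<and> D (Suc v) (i', j') \<le> 0 \<and>
      int k \<le> D v (i', j') div int n + (- D (Suc v) (i', j')) div int n" for w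
  proof -
    have w0: "0 \<le> px w" "0 \<le> py w" using w pxy by auto
    define p q where "p = nat (px w)" and "q = nat (py w)"
    have pq: "int p = px w" "int q = py w" using w0 by (auto simp: p_def q_def)
    have "w \<le> e" using w v by auto
    have pe: "(p, q) \<in> expo 0" using chain_cong[OF \<open>w \<le> e\<close>] pq
      by (simp add: expo_iff cong_iff_dvd_diff mult.commute)
    have "(p, q) \<noteq> (0, 0)"
    proof
      assume "(p, q) = (0, 0)"
      then have "px w = 0" "py w = 0" using pq by auto
      then show False using w chain_det[OF v] n0 by auto
    qed
    have le': "p \<le> i" "q \<le> j" using le pq by auto
    have "(i - p, j - q) \<in> expo t" using expo_diff[OF Suc.prems(1) pe le'] by simp
    moreover have "int (i - p) = int i - px w" "int (j - q) = int j - py w" using le' pq by auto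
    ultimately have "(i - p, j - q) \<in> power_expo t k" using Suc.IH new by blast
    then have "(p + (i - p), q + (j - q)) \<in> power_expo t (Suc k)"
      unfolding power_expo.simps using pe \<open>(p, q) \<noteq> (0, 0)\<close> by blast
    then show ?thesis using le' by simp
  qed
  have "1 \<le> D v (i, j) div int n \<or> 1 \<le> (- D (Suc v) (i, j)) div int n" using Suc.prems(4) by linarith
  then show ?case
  proof
    assume "1 \<le> D v (i, j) div int n"
    then have ge: "int n \<le> D v (i, j)" using le_of_one_le_div n0 by blast
    have nX: "int n * px (Suc v) \<le> int n * int i"
      unfolding chain_coords(1)[OF v, of i j] using mult_nonpos_nonneg[OF Suc.prems(3) pxy(1)] mult_right_mono[OF ge pxy(2)] by linarith
    have nY: "int n * py (Suc v) \<le> int n * int j"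
      unfolding chain_coords(2)[OF v, of j i] using mult_nonpos_nonneg[OF Suc.prems(3) pxy(3)] mult_right_mono[OF ge pxy(4)] by linarith
    show ?case
    proof (rule step[of "Suc v"])
      show "px (Suc v) \<le> int i" "py (Suc v) \<le> int j" using nX nY n0 by auto
      fix i' j' assume ij': "int i' = int i - px (Suc v)" "int j' = int j - py (Suc v)"
      have "D v (i', j') = D v (i, j) - int n" "D (Suc v) (i', j') = D (Suc v) (i, j)"
        using chain_det[OF v] unfolding D_def by (simp_all add: ij' algebra_simps)
      moreover have "(D v (i, j) - int n) div int n = D v (i, j) div int n - 1"
        using n0 by (rule minus_self_div)
      ultimately show "0 \<le> D v (i', j') \<and> D (Suc v) (i', j') \<le> 0 \<and>
        int k \<le> D v (i', j') div int n + (- D (Suc v) (i', j')) div int n"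
        using Suc.prems ge by simp
    qed simp
  next
    assume "1 \<le> (- D (Suc v) (i, j)) div int n"
    then have ge: "int n \<le> - D (Suc v) (i, j)" using le_of_one_le_div n0 by blast
    have nX: "int n * px v \<le> int n * int i"
      unfolding chain_coords(1)[OF v, of i j] using mult_nonneg_nonneg[OF Suc.prems(2) pxy(2)] mult_right_mono[OF ge pxy(1)] by linarith
    have nY: "int n * py v \<le> int n * int j"
      unfolding chain_coords(2)[OF v, of j i] using mult_nonneg_nonneg[OF Suc.prems(2) pxy(4)] mult_right_mono[OF ge pxy(3)] by linarith
    show ?case
    proof (rule step[of v])
      show "px v \<le> int i" "py v \<le> int j" using nX nY n0 by auto
      fix i' j' assume ij': "int i' = int i - px v" "int j' = int j - py v"
      have "D v (i', j') = D v (i, j)" "- D (Suc v) (i', j') = - D (Suc v) (i, j) - int n"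
        using chain_det[OF v] unfolding D_def by (simp_all add: ij' algebra_simps)
      moreover have "(- D (Suc v) (i, j) - int n) div int n = (- D (Suc v) (i, j)) div int n - 1"
        using n0 by (rule minus_self_div)
      ultimately show "0 \<le> D v (i', j') \<and> D (Suc v) (i', j') \<le> 0 \<and>
        int k \<le> D v (i', j') div int n + (- D (Suc v) (i', j')) div int n"
        using Suc.prems ge by simp
    qed simp
  qed
qed simp

lemma cone_exists: "\<exists>v<e. 0 \<le> D v z \<and> D (Suc v) z \<le> 0"
proof -
  obtain i j where z: "z = (i, j)" by force
  have De: "D e z \<le> 0" using chain_end by (simp add: z D_def)
  have D0: "0 \<le> D 0 z" using chain_start by (simp add: z D_def)
  define w where "w = (LEAST w. D w z \<le> 0)"
  have w: "D w z \<le> 0" "w \<le> e" unfolding w_def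
    using LeastI[of "\<lambda>w. D w z \<le> 0", OF De] Least_le[of "\<lambda>w. D w z \<le> 0", OF De] by auto
  show ?thesis
  proof (cases w)
    case 0
    then show ?thesis using w D0 e_pos D_decreasing[of 0 z] by (intro exI[of _ 0]) auto
  next
    case (Suc v)
    then have "\<not> D v z \<le> 0" using not_less_Least[of v "\<lambda>w. D w z \<le> 0"] by (simp add: w_def)
    then show ?thesis using w Suc by (intro exI[of _ v]) auto
  qed
qed

lemma D_inj:
  assumes v: "v < e" and z: "z \<in> expo t" "z' \<in> expo t"
    and eq: "D v z div int n = D v z' div int n" "(- D (Suc v) z) div int n = (- D (Suc v) z') div int n"
  shows "z = z'"
proof -
  obtain i j i' j' where ij: "z = (i, j)" "z' = (i', j')" by force
  have n0: "int n \<noteq> 0" using n_gt_1 by simp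
  have m: "D w z mod int n = D w z' mod int n" if "w \<le> e" for w
    using D_cong[OF that z(1)[unfolded ij]] D_cong[OF that z(2)[unfolded ij]] ij by (simp add: cong_def)
  have e1: "D v z = D v z'" using m[of v] v eq(1) by (metis less_imp_le mult_div_mod_eq)
  have "(- D (Suc v) z) mod int n = (- D (Suc v) z') mod int n"
    using m[of "Suc v"] v by (metis Suc_leI mod_minus_cong)
  then have e2: "- D (Suc v) z = - D (Suc v) z'" using eq(2) by (metis mult_div_mod_eq)
  have "int n * int i = int n * int i'" "int n * int j = int n * int j'"
    unfolding chain_coords(1)[OF v, of i j] chain_coords(1)[OF v, of i' j']
      chain_coords(2)[OF v, of j i] chain_coords(2)[OF v, of j' i'] using e1 e2 ij by simp_all
  then show ?thesis using n0 ij by simp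
qed

text \<open>
  An exponent of a given class is determined by its cone and the integral parts of its two
  coordinates there, since the fractional parts are prescribed by the class. By \<open>power_expo_cone\<close>
  the integral parts of an exponent outside \<open>\<mm>\<^sup>lM\<^sub>t\<close> have sum less than \<open>l\<close>.
\<close>

lemma expo_diff_upper: "finite (expo t - power_expo t l) \<and> card (expo t - power_expo t l) \<le> e * card (triangle l)"
proof -
  define V where "V = (\<lambda>z. SOME v. v < e \<and> 0 \<le> D v z \<and> D (Suc v) z \<le> 0)"
  have V: "V z < e \<and> 0 \<le> D (V z) z \<and> D (Suc (V z)) z \<le> 0" for z
    unfolding V_def by (rule someI_ex[OF cone_exists[of z]])
  have n0: "0 < int n" using n_gt_1 by simp
  define f where "f = (\<lambda>z. (V z, nat ((- D (Suc (V z)) z) div int n), nat (D (V z) z div int n)))"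
  have nn: "0 \<le> D (V z) z div int n" "0 \<le> (- D (Suc (V z)) z) div int n" for z
    using V[of z] n0 by (simp_all only: pos_imp_zdiv_nonneg_iff) simp
  have inj: "inj_on f (expo t - power_expo t l)"
  proof (rule inj_onI)
    fix z z' assume z: "z \<in> expo t - power_expo t l" "z' \<in> expo t - power_expo t l" "f z = f z'"
    then have v: "V z = V z'" by (simp add: f_def)
    have "D (V z) z div int n = D (V z) z' div int n" "(- D (Suc (V z)) z) div int n = (- D (Suc (V z)) z') div int n"
      using z(3) nn[of z] nn[of z'] v by (simp_all add: f_def eq_nat_nat_iff)
    then show "z = z'" using D_inj[of "V z" z t z'] V z by auto
  qed
  have sub: "f ` (expo t - power_expo t l) \<subseteq> {..<e} \<times> triangle l"
  proof (rule image_subsetI, unfold split_paired_all)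
    fix i j assume "(i, j) \<in> expo t - power_expo t l"
    then have z: "(i, j) \<in> expo t" "(i, j) \<notin> power_expo t l" by auto
    let ?A = "(- D (Suc (V (i, j))) (i, j)) div int n" and ?B = "D (V (i, j)) (i, j) div int n"
    have "\<not> int l \<le> ?B + ?A" using power_expo_cone[of "V (i, j)" i j t l] z V[of "(i, j)"] by blast
    then have "nat ?A + nat ?B < l" using nn[of "(i, j)"] by linarith
    then show "f (i, j) \<in> {..<e} \<times> triangle l" using V[of "(i, j)"] by (simp add: f_def mem_triangle)
  qed
  have fin: "finite ({..<e} \<times> triangle l)" by (simp add: finite_triangle)
  show ?thesis using inj sub fin card_inj_on_le[OF inj sub fin] inj_on_finite[OF inj sub fin] by (simp add: card_cartesian_product)
qed

text \<open>
  Conversely, all integral parts occur. Both are shifted by one here in order to stay in the interior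
  of the cone, so that different cones yield different exponents.
\<close>

lemma cone_point:
  assumes v: "v < e"
  obtains i j A' B' where "(i, j) \<in> expo t" "D v (i, j) = int n * (int B + 1) + B'"
    "- D (Suc v) (i, j) = int n * (int A + 1) + A'" "0 \<le> A'" "A' < int n" "0 \<le> B'" "B' < int n"
proof -
  have n0: "0 < int n" using n_gt_1 by simp
  have pxy: "0 \<le> px v" "0 \<le> px (Suc v)" "0 \<le> py v" "0 \<le> py (Suc v)"
    using px_nonneg[of v] px_nonneg[of "Suc v"] py_nonneg[of v] py_nonneg[of "Suc v"] v by auto
  define A' B' where "A' = (py (Suc v) * t) mod int n" and "B' = (- py v * t) mod int n"
  define P Q where "P = int n * (int A + 1) + A'" and "Q = int n * (int B + 1) + B'"
  have r: "0 \<le> A'" "A' < int n" "0 \<le> B'" "B' < int n" using n0 by (simp_all add: A'_def B'_def)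
  have PQ0: "0 \<le> P" "0 \<le> Q" using r n0 by (simp_all add: P_def Q_def)
  have Pc: "[P = py (Suc v) * t] (mod int n)" by (simp add: P_def A'_def cong_def)
  have Qc: "[Q = - py v * t] (mod int n)" by (simp add: Q_def B'_def cong_def)
  have det: "px v * py (Suc v) - px (Suc v) * py v = int n" by (rule chain_det[OF v])
  have "[P * px v + Q * px (Suc v) = (py (Suc v) * t) * px v + (- py v * t) * px (Suc v)] (mod int n)"
    by (intro cong_add cong_scalar_right Pc Qc)
  also have "(py (Suc v) * t) * px v + (- py v * t) * px (Suc v) = t * int n"
    unfolding det[symmetric] by (simp add: algebra_simps)
  finally have "int n dvd P * px v + Q * px (Suc v)" by (simp add: cong_iff_dvd_diff dvd_diff_left_iff)
  then obtain i0 where i0: "P * px v + Q * px (Suc v) = int n * i0" by blast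
  have "[P * py v + Q * py (Suc v) = (py (Suc v) * t) * py v + (- py v * t) * py (Suc v)] (mod int n)"
    by (intro cong_add cong_scalar_right Pc Qc)
  also have "(py (Suc v) * t) * py v + (- py v * t) * py (Suc v) = 0" by simp
  finally have "int n dvd P * py v + Q * py (Suc v)" by (simp add: cong_iff_dvd_diff)
  then obtain j0 where j0: "P * py v + Q * py (Suc v) = int n * j0" by blast
  have "0 \<le> int n * i0" "0 \<le> int n * j0" unfolding i0[symmetric] j0[symmetric] using PQ0 pxy by simp_all
  then have ij0: "0 \<le> i0" "0 \<le> j0" using n0 by (simp_all add: zero_le_mult_iff)
  define i j where "i = nat i0" and "j = nat j0"
  have ij: "int i = i0" "int j = j0" using ij0 by (simp_all add: i_def j_def)
  have "int n * D v (i, j) = px v * (int n * j0) - py v * (int n * i0)" by (simp add: D_def ij algebra_simps)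
  also have "\<dots> = Q * (px v * py (Suc v) - px (Suc v) * py v)"
    unfolding i0[symmetric] j0[symmetric] by (simp add: algebra_simps)
  finally have D1: "D v (i, j) = Q" using n0 det by simp
  have "int n * D (Suc v) (i, j) = px (Suc v) * (int n * j0) - py (Suc v) * (int n * i0)"
    by (simp add: D_def ij algebra_simps)
  also have "\<dots> = - P * (px v * py (Suc v) - px (Suc v) * py v)"
    unfolding i0[symmetric] j0[symmetric] by (simp add: algebra_simps)
  finally have "int n * D (Suc v) (i, j) = int n * (- P)" using det by simp
  then have D2: "- D (Suc v) (i, j) = P" using n0 by (metis add.inverse_inverse less_irrefl mult_left_cancel)
  obtain k where k: "px v + int a * py v = int n * k" using chain_cong[of v] v by (auto simp: dvd_def)
  obtain k' where k': "px (Suc v) + int a * py (Suc v) = int n * k'" using chain_cong[of "Suc v"] v by (auto simp: dvd_def)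
  have "int n * (py (Suc v) * k - py v * k') = py (Suc v) * (px v + int a * py v) - py v * (px (Suc v) + int a * py (Suc v))"
    unfolding k k' by (simp add: algebra_simps)
  also have "\<dots> = int n * 1" using det by (simp add: algebra_simps)
  finally have one: "py (Suc v) * k - py v * k' = 1" using n0 by (metis less_irrefl mult_left_cancel)
  have "int n * (i0 + j0 * int a) = P * (px v + int a * py v) + Q * (px (Suc v) + int a * py (Suc v))"
  proof -
    have "int n * (i0 + j0 * int a) = int n * i0 + (int n * j0) * int a" by (simp add: algebra_simps)
    then show ?thesis unfolding i0[symmetric] j0[symmetric] by (simp add: algebra_simps)
  qed
  also have "\<dots> = int n * (P * k + Q * k')" unfolding k k' by (simp add: algebra_simps)
  finally have "i0 + j0 * int a = P * k + Q * k'" using n0 by (metis less_irrefl mult_left_cancel)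
  moreover have "[P * k + Q * k' = (py (Suc v) * t) * k + (- py v * t) * k'] (mod int n)"
    by (intro cong_add cong_scalar_right Pc Qc)
  moreover have "(py (Suc v) * t) * k + (- py v * t) * k' = t * (py (Suc v) * k - py v * k')" by (simp add: algebra_simps)
  ultimately have "(i, j) \<in> expo t" using one by (simp add: expo_iff ij)
  from that[OF this D1[unfolded Q_def] D2[unfolded P_def] r] show ?thesis .
qed

text \<open>
  The shift by 3 pays for the two shifts by one and for the two fractional parts: the height
  \<open>D v - D (v + 1)\<close> of the constructed points stays below \<open>n (l + 3)\<close>.
\<close>

lemma expo_diff_lower: "e * card (triangle l) \<le> card (expo t - power_expo t (l + 3))"
proof -
  have n0: "0 < int n" using n_gt_1 by simp
  define V where "V = (\<lambda>z. LEAST v. D (Suc v) z < 0)"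
  define g where "g = (\<lambda>z. (V z, nat ((- D (Suc (V z)) z) div int n - 1), nat (D (V z) z div int n - 1)))"
  have "{..<e} \<times> triangle l \<subseteq> g ` (expo t - power_expo t (l + 3))"
  proof clarify
    fix v A B assume v: "v < e" and AB: "(A, B) \<in> triangle l"
    obtain i j A' B' where ij: "(i, j) \<in> expo t" and B': "D v (i, j) = int n * (int B + 1) + B'" "0 \<le> B'" "B' < int n"
      and A': "- D (Suc v) (i, j) = int n * (int A + 1) + A'" "0 \<le> A'" "A' < int n"
      by (rule cone_point[OF v])
    have dq: "(int n * (int C + 1) + C') div int n = int C + 1" if "0 \<le> C'" "C' < int n" for C C'
      using that n0 by (simp add: div_mult_self_is_m add.commute)
    have pos: "0 < int n * (int C + 1)" for C using n0 by simp
    have "V (i, j) = v" unfolding V_def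
    proof (rule Least_equality)
      show "D (Suc v) (i, j) < 0" using A' pos[of A] by linarith
      fix w assume "D (Suc w) (i, j) < 0"
      show "v \<le> w"
      proof (rule ccontr)
        assume "\<not> v \<le> w"
        then have "D v (i, j) \<le> D (Suc w) (i, j)" using v by (intro D_antimono) auto
        then show False using \<open>D (Suc w) (i, j) < 0\<close> B' pos[of B] by linarith
      qed
    qed
    then have g: "g (i, j) = (v, A, B)"
      using B' A' by (simp add: g_def dq)
    have "(i, j) \<notin> power_expo t (l + 3)"
    proof
      assume "(i, j) \<in> power_expo t (l + 3)"
      then have "int n * int (l + 3) \<le> D v (i, j) - D (Suc v) (i, j)" by (rule power_expo_height[OF v])
      also have "\<dots> < int n * (int A + int B + 4)" using A' B' by (simp add: algebra_simps)
      also have "\<dots> \<le> int n * int (l + 3)" using AB n0 by (intro mult_left_mono) (auto simp: mem_triangle)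
      finally show False by simp
    qed
    then have "(i, j) \<in> expo t - power_expo t (l + 3)" using ij by simp
    then show "(v, A, B) \<in> g ` (expo t - power_expo t (l + 3))" using g by (metis imageI)
  qed
  from surj_card_le[OF _ this] expo_diff_upper show ?thesis by (simp add: card_cartesian_product)
qed

lemma colength_limit:
  "(\<lambda>l. 2 * real (card (expo t - power_expo t (Suc l))) / real l ^ 2) \<longlonglongrightarrow> real e"
proof (rule tendsto_sandwich)
  let ?c = "\<lambda>l. real (card (expo t - power_expo t (Suc l)))"
  have inv: "(\<lambda>l. c / real l) \<longlonglongrightarrow> 0" for c by (rule lim_const_over_n)
  have "(\<lambda>l. real e * ((1 - 2 / real l) * (1 - 1 / real l))) \<longlonglongrightarrow> real e * ((1 - 0) * (1 - 0))"
    by (intro tendsto_intros inv)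
  then show "(\<lambda>l. real e * ((1 - 2 / real l) * (1 - 1 / real l))) \<longlonglongrightarrow> real e" by simp
  have "(\<lambda>l. real e * ((1 + 1 / real l) * (1 + 2 / real l))) \<longlonglongrightarrow> real e * ((1 + 0) * (1 + 0))"
    by (intro tendsto_intros inv)
  then show "(\<lambda>l. real e * ((1 + 1 / real l) * (1 + 2 / real l))) \<longlonglongrightarrow> real e" by simp
  show "\<forall>\<^sub>F l in sequentially. 2 * ?c l / real l ^ 2 \<le> real e * ((1 + 1 / real l) * (1 + 2 / real l))"
  proof (rule eventually_sequentiallyI[of 1])
    fix l :: nat assume l: "1 \<le> l"
    have "2 * card (expo t - power_expo t (Suc l)) \<le> e * (2 * card (triangle (Suc l)))"
      using expo_diff_upper[of t "Suc l"] by (simp del: power_expo.simps)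
    then have "2 * card (expo t - power_expo t (Suc l)) \<le> e * ((l + 1) * (l + 2))"
      unfolding card_triangle by simp
    then have "real (2 * card (expo t - power_expo t (Suc l))) \<le> real (e * ((l + 1) * (l + 2)))"
      by (simp only: of_nat_le_iff)
    then have "2 * ?c l \<le> real e * ((real l + 1) * (real l + 2))" by (simp add: algebra_simps)
    then have "2 * ?c l / real l ^ 2 \<le> real e * ((real l + 1) * (real l + 2)) / real l ^ 2"
      by (intro divide_right_mono) auto
    also have "\<dots> = real e * ((1 + 1 / real l) * (1 + 2 / real l))"
      using l by (simp add: field_simps power2_eq_square)
    finally show "2 * ?c l / real l ^ 2 \<le> real e * ((1 + 1 / real l) * (1 + 2 / real l))" .
  qed
  show "\<forall>\<^sub>F l in sequentially. real e * ((1 - 2 / real l) * (1 - 1 / real l)) \<le> 2 * ?c l / real l ^ 2"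
  proof (rule eventually_sequentiallyI[of 2])
    fix l :: nat assume l: "2 \<le> l"
    define k where "k = l - 2"
    have lk: "l = k + 2" using l by (simp add: k_def)
    have "e * (2 * card (triangle k)) \<le> 2 * card (expo t - power_expo t (k + 3))"
      using expo_diff_lower[of k t] by (simp del: power_expo.simps)
    then have "e * (k * (k + 1)) \<le> 2 * card (expo t - power_expo t (Suc l))"
      unfolding card_triangle lk by (simp add: numeral_3_eq_3 del: power_expo.simps)
    then have "real (e * (k * (k + 1))) \<le> real (2 * card (expo t - power_expo t (Suc l)))"
      by (simp only: of_nat_le_iff)
    then have "real e * ((real l - 2) * (real l - 1)) \<le> 2 * ?c l" by (simp add: lk algebra_simps)
    then have "real e * ((real l - 2) * (real l - 1)) / real l ^ 2 \<le> 2 * ?c l / real l ^ 2"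
      by (intro divide_right_mono) auto
    moreover have "real e * ((real l - 2) * (real l - 1)) / real l ^ 2 = real e * ((1 - 2 / real l) * (1 - 1 / real l))"
      using l by (simp add: field_simps power2_eq_square)
    ultimately show "real e * ((1 - 2 / real l) * (1 - 1 / real l)) \<le> 2 * ?c l / real l ^ 2" by simp
  qed
qed

end

context HJ_type
begin

text \<open>
  Chains as above, but ending at an arbitrary point \<open>(x, y)\<close>. The condition \<open>x j\<^sub>u + y i\<^sub>u = n\<close> below says
  that the next step \<open>(-i\<^sub>u, j\<^sub>u)\<close> keeps determinant \<open>n\<close>; it persists along that direction.
\<close>

definition reached :: "nat \<Rightarrow> int \<Rightarrow> int \<Rightarrow> bool" where
  "reached m x y \<longleftrightarrow> (\<exists>px py. px 0 = int n \<and> py 0 = 0 \<and> px m = x \<and> py m = y \<and>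
    (\<forall>v<m. px (Suc v) < px v \<and> py v < py (Suc v) \<and> px v * py (Suc v) - px (Suc v) * py v = int n) \<and>
    (\<forall>v\<le>m. int n dvd px v + int a * py v))"

lemma reached_step:
  assumes r: "reached m x y" and u: "1 \<le> u" "u \<le> r" and on: "x * J u + y * I u = int n"
  shows "reached (Suc m) (x - I u) (y + J u)"
proof -
  obtain px py where pxy: "px 0 = int n" "py 0 = 0" "px m = x" "py m = y"
    "\<And>v. v < m \<Longrightarrow> px (Suc v) < px v \<and> py v < py (Suc v) \<and> px v * py (Suc v) - px (Suc v) * py v = int n"
    "\<And>v. v \<le> m \<Longrightarrow> int n dvd px v + int a * py v" using r by (auto simp: reached_def)
  have IJ: "0 < I u" "0 < J u" using I_pos[of u] J_pos[of u] u by auto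
  have "int n dvd int a * J u - I u" using I_cong_J[of u] by (simp add: cong_iff_dvd_diff dvd_diff_commute)
  with pxy(6)[OF order_refl, unfolded pxy(3,4)] have "int n dvd (x + int a * y) + (int a * J u - I u)" by (rule dvd_add)
  then have new: "int n dvd (x - I u) + int a * (y + J u)" by (simp add: algebra_simps)
  have det: "x * (y + J u) - (x - I u) * y = int n" using on by (simp add: algebra_simps)
  show ?thesis unfolding reached_def
    by (rule exI[of _ "px(Suc m := x - I u)"], rule exI[of _ "py(Suc m := y + J u)"])
       (use pxy new det IJ in \<open>auto simp: less_Suc_eq le_Suc_eq\<close>)
qed

lemma reached_steps:
  assumes r: "reached m x y" and u: "1 \<le> u" "u \<le> r" and on: "x * J u + y * I u = int n"
  shows "reached (m + k) (x - int k * I u) (y + int k * J u)"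
proof (induction k)
  case (Suc k)
  have "(x - int k * I u) * J u + (y + int k * J u) * I u = int n" using on by (simp add: algebra_simps)
  from reached_step[OF Suc u this] show ?case by (simp add: algebra_simps)
qed (use r in simp)

lemma reached_start: "reached 0 (int n) 0"
  unfolding reached_def by (intro exI[of _ "\<lambda>_. int n"] exI[of _ "\<lambda>_. 0"]) simp

text \<open>
  The corners \<open>(i\<^sub>v - i\<^sub>v\<^sub>+\<^sub>1, j\<^sub>v\<^sub>+\<^sub>1 - j\<^sub>v)\<close> satisfy the condition for \<open>u = v\<close> and for \<open>u = v + 1\<close>, and two
  consecutive ones are \<open>\<alpha>\<^sub>v\<^sub>+\<^sub>1 - 2\<close> steps apart. With one more step at each end the chain has
  \<open>\<Sum> (\<alpha>\<^sub>u - 2) + 2\<close> steps in total.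
\<close>

lemma reached_corner:
  "v \<le> r \<Longrightarrow> reached (nat (1 + (\<Sum>u<v. \<alpha>s ! u - 2))) (I v - I (Suc v)) (J (Suc v) - J v)"
proof (induction v)
  case 0
  from reached_step[OF reached_start, of 1] r_pos show ?case by simp
next
  case (Suc v)
  have IH: "reached (nat (1 + (\<Sum>u<v. \<alpha>s ! u - 2))) (I v - I (Suc v)) (J (Suc v) - J v)" using Suc by simp
  have nn: "0 \<le> (\<Sum>u<v. \<alpha>s ! u - 2)" using alpha_ge_2 Suc.prems by (intro sum_nonneg) auto
  have a2: "2 \<le> \<alpha>s ! v" using alpha_ge_2 Suc.prems by simp
  have on: "(I v - I (Suc v)) * J (Suc v) + (J (Suc v) - J v) * I (Suc v) = int n"
    using IJ_det[of v] by (simp add: algebra_simps)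
  have "nat (1 + (\<Sum>u<Suc v. \<alpha>s ! u - 2)) = nat (1 + (\<Sum>u<v. \<alpha>s ! u - 2)) + nat (\<alpha>s ! v - 2)"
    using nn a2 by simp
  then show ?case using reached_steps[OF IH _ _ on, of "nat (\<alpha>s ! v - 2)"] Suc.prems a2
    by (simp add: algebra_simps)
qed

lemma lattice_chain_exists: "\<exists>px py. lattice_chain n a (nat (excess 0 + 2)) px py"
proof -
  have "reached (nat (1 + (\<Sum>u<r. \<alpha>s ! u - 2))) 1 (int n - J r)"
    using reached_corner[of r] I_length I_end J_last by simp
  then have "reached (Suc (nat (1 + (\<Sum>u<r. \<alpha>s ! u - 2)))) (1 - I r) (int n - J r + J r)"
    by (rule reached_step) (use r_pos I_length in auto)
  moreover have "Suc (nat (1 + (\<Sum>u<r. \<alpha>s ! u - 2))) = nat (excess 0 + 2)"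
    using excess_nonneg[of 0] by (simp add: excess_def atLeast0LessThan)
  ultimately have "reached (nat (excess 0 + 2)) 0 (int n)" using I_length by simp
  then obtain px py where "px 0 = int n" "py 0 = 0" "px (nat (excess 0 + 2)) = 0" "py (nat (excess 0 + 2)) = int n"
    "\<forall>v<nat (excess 0 + 2). px (Suc v) < px v \<and> py v < py (Suc v) \<and> px v * py (Suc v) - px (Suc v) * py v = int n"
    "\<forall>v\<le>nat (excess 0 + 2). int n dvd px v + int a * py v" unfolding reached_def by blast
  then have "lattice_chain n a (nat (excess 0 + 2)) px py"
    by unfold_locales auto
  then show ?thesis by blast
qed

end

section \<open>Power series and their supports\<close>

definition cf :: "'k::field fps fps \<Rightarrow> nat \<Rightarrow> nat \<Rightarrow> 'k" where
  "cf f i j = fps_nth (fps_nth f j) i"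

lemma cf_eqI: "(\<And>i j. cf f i j = cf g i j) \<Longrightarrow> f = g"
  by (simp add: cf_def fps_eq_iff)

lemma cf_simps [simp]:
  "cf 0 i j = 0" "cf (f + g) i j = cf f i j + cf g i j" "cf (f - g) i j = cf f i j - cf g i j"
  "cf (- f) i j = - cf f i j" "cf (Abs_fps (\<lambda>j. Abs_fps (\<lambda>i. c i j))) i j = c i j"
  by (simp_all add: cf_def)

lemma cf_one: "cf 1 i j = (if i = 0 \<and> j = 0 then 1 else 0)"
  by (simp add: cf_def fps_one_def)

lemma cf_sum: "cf (\<Sum>x\<in>A. h x) i j = (\<Sum>x\<in>A. cf (h x) i j)"
  by (induction A rule: infinite_finite_induct) auto

lemma cf_mult: "cf (f * g) i j = (\<Sum>q\<le>j. \<Sum>p\<le>i. cf f p q * cf g (i - p) (j - q))"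
  by (simp add: cf_def fps_mult_nth fps_sum_nth atLeast0AtMost)

lemma cf_const_mult: "cf (const_xy c * f) i j = c * cf f i j"
  by (simp add: cf_def const_xy_def)

lemma cf_monom_mult:
  "cf (var_x ^ i * var_y ^ j * f) p q = (if i \<le> p \<and> j \<le> q then cf f (p - i) (q - j) else 0)"
proof -
  have "var_x ^ i * var_y ^ j * f = fps_const (fps_X ^ i) * (fps_X ^ j * f)"
    by (simp add: var_x_def var_y_def fps_const_power mult.assoc)
  from arg_cong[OF this, of "\<lambda>g. cf g p q"] show ?thesis by (simp add: cf_def fps_X_power_mult_nth)
qed

lemma cf_monom: "cf (var_x ^ i * var_y ^ j) p q = (if p = i \<and> q = j then 1 else 0)"
  using cf_monom_mult[of i j 1 p q] by (auto simp: cf_one)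

definition supported :: "(nat \<times> nat) set \<Rightarrow> 'k::field fps fps set" where
  "supported E = {f. \<forall>i j. cf f i j \<noteq> 0 \<longrightarrow> (i, j) \<in> E}"

lemma supportedD: "f \<in> supported E \<Longrightarrow> (i, j) \<notin> E \<Longrightarrow> cf f i j = 0"
  by (auto simp: supported_def)

lemma supportedI: "(\<And>i j. (i, j) \<notin> E \<Longrightarrow> cf f i j = 0) \<Longrightarrow> f \<in> supported E"
  by (auto simp: supported_def)

lemma supported_zero: "0 \<in> supported E"
  by (simp add: supported_def)

lemma supported_add: "f \<in> supported E \<Longrightarrow> g \<in> supported E \<Longrightarrow> f + g \<in> supported E"
  by (rule supportedI) (simp add: supportedD)

lemma supported_minus: "f \<in> supported E \<Longrightarrow> - f \<in> supported E"
  by (rule supportedI) (simp add: supportedD)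

lemma supported_diff: "f \<in> supported E \<Longrightarrow> g \<in> supported E \<Longrightarrow> f - g \<in> supported E"
  by (rule supportedI) (simp add: supportedD)

lemma supported_mono: "E \<subseteq> F \<Longrightarrow> supported E \<subseteq> supported F"
  by (auto simp: supported_def)

lemma supported_monom: "(i, j) \<in> E \<Longrightarrow> var_x ^ i * var_y ^ j \<in> supported E"
  by (auto simp: supported_def cf_monom split: if_splits)

lemma supported_mult:
  assumes "f \<in> supported E" "g \<in> supported F"
    and "\<And>p q i j. (p, q) \<in> E \<Longrightarrow> (i, j) \<in> F \<Longrightarrow> (p + i, q + j) \<in> G"
  shows "f * g \<in> supported G"
proof (rule supportedI)
  fix i j assume ij: "(i, j) \<notin> G"
  have "cf f p q * cf g (i - p) (j - q) = 0" if "p \<le> i" "q \<le> j" for p q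
  proof (rule ccontr)
    assume "\<not> ?thesis"
    then have "(p, q) \<in> E" "(i - p, j - q) \<in> F" using assms(1,2) by (auto simp: supported_def)
    from assms(3)[OF this] show False using ij that by simp
  qed
  then show "cf (f * g) i j = 0" unfolding cf_mult by (intro sum.neutral ballI) auto
qed

section \<open>The invariant ring and its submodules\<close>

locale cyclic_sing = cyclic_type +
  fixes \<zeta> :: "'k::field"
  assumes root: "primitive_root_of_unity n \<zeta>"
begin

text \<open>
  The semi-invariants of weight \<open>t\<close> form the set \<open>V t\<close>; it is shown below to be the carrier of \<open>M\<^sub>t\<close>,
  and \<open>Inv = V 0\<close> to be that of \<open>R\<close>.
\<close>

abbreviation Inv :: "'k fps fps set" where "Inv \<equiv> supported (expo 0)"
abbreviation V :: "int \<Rightarrow> 'k fps fps set" where "V t \<equiv> supported (expo t)"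
abbreviation R where "R \<equiv> invariant_ring \<zeta> a"

lemma root_power_eq_1: "\<zeta> ^ m = 1 \<longleftrightarrow> n dvd m"
proof -
  have "\<zeta> ^ m = \<zeta> ^ (n * (m div n) + m mod n)" by simp
  also have "\<dots> = \<zeta> ^ (m mod n)" using root
    by (simp only: power_add power_mult) (simp add: primitive_root_of_unity_def)
  finally have "\<zeta> ^ m = \<zeta> ^ (m mod n)" .
  moreover have "\<zeta> ^ (m mod n) = 1 \<longleftrightarrow> m mod n = 0"
    using root n_gt_1 by (cases "m mod n = 0") (auto simp: primitive_root_of_unity_def)
  ultimately show ?thesis by (simp add: dvd_eq_mod_eq_0)
qed

lemma root_nonzero: "\<zeta> \<noteq> 0"
  using root by (auto simp: primitive_root_of_unity_def power_0_left split: if_splits)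

abbreviation act :: "'k fps fps \<Rightarrow> 'k fps fps" where "act \<equiv> diag_act \<zeta> (\<zeta> ^ a)"

lemma act_fixed_iff: "act f = f \<longleftrightarrow> f \<in> Inv"
proof -
  have c: "cf (act f) i j = \<zeta> ^ (i + a * j) * cf f i j" for i j
    by (simp add: cf_def diag_act_def power_add power_mult)
  have "(i, j) \<in> expo 0 \<longleftrightarrow> n dvd i + a * j" for i j
    unfolding expo_iff cong_0_iff by (metis mult.commute of_nat_add of_nat_dvd_iff of_nat_mult)
  then have "(i, j) \<in> expo 0 \<longleftrightarrow> \<zeta> ^ (i + a * j) = 1" for i j by (simp add: root_power_eq_1)
  moreover have "act f = f \<longleftrightarrow> (\<forall>i j. cf (act f) i j = cf f i j)" using cf_eqI by metis
  ultimately show ?thesis unfolding c by (auto simp: supported_def)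
qed

lemma act_Bij: "act \<in> Bij UNIV"
proof -
  have inv: "diag_act (inverse \<alpha>) (inverse \<beta>) (diag_act \<alpha> \<beta> f) = f" if "\<alpha> \<noteq> 0" "\<beta> \<noteq> 0" for \<alpha> \<beta> :: 'k and f
    using that by (simp add: diag_act_def fps_eq_iff power_inverse field_simps)
  have "diag_act \<alpha> \<beta> (diag_act (inverse \<alpha>) (inverse \<beta>) f) = f" if "\<alpha> \<noteq> 0" "\<beta> \<noteq> 0" for \<alpha> \<beta> :: 'k and f
    using inv[of "inverse \<alpha>" "inverse \<beta>" f] that by simp
  then have "bij act" using inv root_nonzero
    by (intro o_bij[of "diag_act (inverse \<zeta>) (inverse (\<zeta> ^ a))"]) (auto simp: fun_eq_iff)
  then show ?thesis by (simp add: Bij_def)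
qed

lemma cyclic_grp_fixes_iff: "(\<forall>g\<in>cyclic_grp \<zeta> a. g f = f) \<longleftrightarrow> f \<in> Inv"
proof
  assume "\<forall>g\<in>cyclic_grp \<zeta> a. g f = f"
  moreover have "act \<in> cyclic_grp \<zeta> a" unfolding cyclic_grp_def by (rule generate.incl) simp
  ultimately show "f \<in> Inv" unfolding act_fixed_iff[symmetric] by (rule bspec)
next
  assume "f \<in> Inv"
  then have f: "act f = f" by (simp add: act_fixed_iff)
  have g: "group (BijGroup (UNIV :: 'k fps fps set))" by (rule group_BijGroup)
  have sub: "{act} \<subseteq> carrier (BijGroup UNIV)" using act_Bij by (simp add: BijGroup_def)
  have "g f = f" if "g \<in> generate (BijGroup UNIV) {act}" for g
    using that
  proof (induction rule: generate.induct)
    case one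
    then show ?case by (simp add: BijGroup_def)
  next
    case (incl h)
    then show ?case using f by simp
  next
    case (inv h)
    have "inj act" using act_Bij by (simp add: Bij_def bij_def)
    then have "inv_into UNIV act f = f" using inv_f_f[OF \<open>inj act\<close>, of f] f by simp
    moreover have "h = act" using inv by simp
    ultimately show ?case by (simp add: inv_BijGroup[OF act_Bij])
  next
    case (eng h1 h2)
    have c: "carrier (BijGroup UNIV) = Bij (UNIV :: 'k fps fps set)" by (simp add: BijGroup_def)
    have "h1 \<in> Bij UNIV" "h2 \<in> Bij UNIV"
      using group.generate_in_carrier[OF g sub eng.hyps(1)] group.generate_in_carrier[OF g sub eng.hyps(2)]
      unfolding c by auto
    then have "h1 \<otimes>\<^bsub>BijGroup UNIV\<^esub> h2 = compose UNIV h1 h2" by (simp add: BijGroup_def)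
    moreover have "h1 f = f" "h2 f = f" using eng.IH by auto
    ultimately show ?case by (simp add: compose_def)
  qed
  then show "\<forall>g\<in>cyclic_grp \<zeta> a. g f = f" by (simp add: cyclic_grp_def)
qed

lemma R_simps [simp]:
  "carrier R = Inv" "monoid.mult R = (*)" "one R = 1" "zero R = 0" "add R = (+)"
  by (simp_all add: invariant_ring_def cyclic_grp_fixes_iff ring_of_type_algebra_def)

lemma expo_add0: "(p, q) \<in> expo 0 \<Longrightarrow> (i, j) \<in> expo t \<Longrightarrow> (p + i, q + j) \<in> expo t"
  using expo_add[of p q 0 i j t] by simp

lemma V_mult: "f \<in> V s \<Longrightarrow> g \<in> V t \<Longrightarrow> f * g \<in> V (s + t)"
  by (rule supported_mult) (auto intro: expo_add)

lemma Inv_V_mult: "f \<in> Inv \<Longrightarrow> g \<in> V t \<Longrightarrow> f * g \<in> V t"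
  using V_mult[of f 0 g t] by simp

lemma const_Inv: "const_xy c \<in> Inv"
proof -
  have "cf (const_xy c) i j = (if i = 0 \<and> j = 0 then c else 0)" for i j
    using cf_const_mult[of c 1 i j] by (simp add: cf_one)
  then show ?thesis by (auto simp: supported_def expo_iff split: if_splits)
qed

lemma one_Inv: "1 \<in> Inv"
  using const_Inv[of 1] by (simp add: const_xy_def fps_const_1_eq_1)

lemma Inv_mult: "f \<in> Inv \<Longrightarrow> g \<in> Inv \<Longrightarrow> f * g \<in> Inv"
  by (rule Inv_V_mult)

lemma Inv_power: "f \<in> Inv \<Longrightarrow> f ^ m \<in> Inv"
  by (induction m) (auto intro: one_Inv Inv_mult)

lemma cring_R: "cring R"
proof (rule cringI)
  show "abelian_group R"
  proof (rule abelian_groupI)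
    fix x assume "x \<in> carrier R"
    then show "\<exists>y\<in>carrier R. y \<oplus>\<^bsub>R\<^esub> x = \<zero>\<^bsub>R\<^esub>"
      by (intro bexI[of _ "- x"]) (auto intro: supported_minus)
  qed (auto intro: supported_add supported_zero)
  show "Group.comm_monoid R"
    by (rule Group.comm_monoidI) (auto intro: one_Inv Inv_mult simp: mult.commute mult.left_commute)
qed (simp add: distrib_right)

text \<open>
  Additive subgroups closed under multiplication by invariants, that is, the \<open>R\<close>-submodules of
  \<open>k[[x, y]]\<close>; negatives come from multiplication by the invariant \<open>-1\<close>.
\<close>

definition stable :: "'k fps fps set \<Rightarrow> bool" where
  "stable N \<longleftrightarrow> 0 \<in> N \<and> (\<forall>f\<in>N. \<forall>g\<in>N. f + g \<in> N) \<and> (\<forall>f\<in>Inv. \<forall>g\<in>N. f * g \<in> N)"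

lemma stableD:
  assumes "stable N"
  shows "0 \<in> N" "f \<in> N \<Longrightarrow> g \<in> N \<Longrightarrow> f + g \<in> N" "h \<in> Inv \<Longrightarrow> g \<in> N \<Longrightarrow> h * g \<in> N"
    "g \<in> N \<Longrightarrow> - g \<in> N" "f \<in> N \<Longrightarrow> g \<in> N \<Longrightarrow> f - g \<in> N"
proof -
  show 1: "0 \<in> N" "f \<in> N \<Longrightarrow> g \<in> N \<Longrightarrow> f + g \<in> N" "h \<in> Inv \<Longrightarrow> g \<in> N \<Longrightarrow> h * g \<in> N" for f g h
    using assms by (auto simp: stable_def)
  have "-1 \<in> Inv" using supported_minus[OF one_Inv] by simp
  then show 2: "g \<in> N \<Longrightarrow> - g \<in> N" for g using 1(3)[of "-1" g] by simp
  show "f \<in> N \<Longrightarrow> g \<in> N \<Longrightarrow> f - g \<in> N" using 1(2)[of f "- g"] 2[of g] by simp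
qed

lemma stable_sum: "stable N \<Longrightarrow> (\<And>x. x \<in> A \<Longrightarrow> h x \<in> N) \<Longrightarrow> (\<Sum>x\<in>A. h x) \<in> N"
  by (induction A rule: infinite_finite_induct) (auto intro: stableD)

lemma stable_const: "stable N \<Longrightarrow> f \<in> N \<Longrightarrow> const_xy c * f \<in> N"
  by (rule stableD(3)[OF _ const_Inv])

lemma stable_UNIV: "stable UNIV"
  by (simp add: stable_def)

lemma stable_zero: "stable {0}"
  by (simp add: stable_def)

lemma stable_supported:
  assumes "\<And>p q i j. (p, q) \<in> expo 0 \<Longrightarrow> (i, j) \<in> E \<Longrightarrow> (p + i, q + j) \<in> E"
  shows "stable (supported E)"
  unfolding stable_def by (auto intro: supported_zero supported_add supported_mult[OF _ _ assms])

lemma stable_V: "stable (V t)"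
  by (rule stable_supported) (rule expo_add0)

lemma stable_image:
  assumes "stable N"
  shows "stable ((*) f ` N)"
proof -
  have "\<exists>z\<in>N. f * x + f * y = f * z" if "x \<in> N" "y \<in> N" for x y
    using stableD(2)[OF assms that] by (intro bexI[of _ "x + y"]) (auto simp: distrib_left)
  moreover have "\<exists>z\<in>N. r * (f * x) = f * z" if "r \<in> Inv" "x \<in> N" for r x
    using stableD(3)[OF assms that] by (intro bexI[of _ "r * x"]) (auto simp: ac_simps)
  moreover have "\<exists>z\<in>N. 0 = f * z" using stableD(1)[OF assms] by (intro bexI[of _ 0]) auto
  ultimately show ?thesis unfolding stable_def by (auto simp: image_iff)
qed

definition plus_set :: "'k fps fps set \<Rightarrow> 'k fps fps set \<Rightarrow> 'k fps fps set" where
  "plus_set M N = {f + g | f g. f \<in> M \<and> g \<in> N}"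

lemma stable_plus_set:
  assumes "stable M" "stable N"
  shows "stable (plus_set M N)"
  unfolding stable_def
proof (intro conjI ballI)
  show "0 \<in> plus_set M N" using stableD(1)[OF assms(1)] stableD(1)[OF assms(2)]
    by (auto simp: plus_set_def intro!: exI[of _ 0])
next
  fix f g assume "f \<in> plus_set M N" "g \<in> plus_set M N"
  then obtain a b c d where "f = a + b" "g = c + d" "a \<in> M" "b \<in> N" "c \<in> M" "d \<in> N" by (auto simp: plus_set_def)
  then have "f + g = (a + c) + (b + d)" "a + c \<in> M" "b + d \<in> N" using assms stableD(2) by (auto simp: ac_simps)
  then show "f + g \<in> plus_set M N" by (auto simp: plus_set_def)
next
  fix f g assume "f \<in> Inv" "g \<in> plus_set M N"
  then obtain a b where "g = a + b" "a \<in> M" "b \<in> N" by (auto simp: plus_set_def)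
  then have "f * g = f * a + f * b" "f * a \<in> M" "f * b \<in> N" using assms stableD(3) \<open>f \<in> Inv\<close> by (auto simp: distrib_left)
  then show "f * g \<in> plus_set M N" by (auto simp: plus_set_def)
qed

lemma series_module_simps [simp]:
  "carrier (series_module N) = N" "zero (series_module N) = 0" "add (series_module N) = (+)"
  "module.smult (series_module N) = (*)"
  by (simp_all add: series_module_def)

lemma module_series: assumes "stable N" shows "Module.module R (series_module N)"
proof (rule Module.moduleI[OF cring_R])
  show "abelian_group (series_module N)"
  proof (rule abelian_groupI)
    fix x assume "x \<in> carrier (series_module N)"
    then show "\<exists>y\<in>carrier (series_module N). y \<oplus>\<^bsub>series_module N\<^esub> x = \<zero>\<^bsub>series_module N\<^esub>"
      using stableD(4)[OF assms] by (intro bexI[of _ "- x"]) auto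
  qed (use stableD[OF assms] in auto)
qed (use stableD[OF assms] in \<open>auto simp: algebra_simps\<close>)

lemma a_inv_series: assumes "stable N" "x \<in> N" shows "a_inv (series_module N) x = - x"
proof -
  interpret Module.module R "series_module N" by (rule module_series[OF assms(1)])
  show ?thesis using M.minus_equality[of "- x" x] assms stableD(4)[OF assms] by auto
qed

lemma submodule_iff:
  assumes "stable V'"
  shows "Module.submodule N R (series_module V') \<longleftrightarrow> N \<subseteq> V' \<and> stable N"
proof
  interpret Module.module R "series_module V'" by (rule module_series[OF assms])
  assume s: "Module.submodule N R (series_module V')"
  then interpret Module.submodule N R "series_module V'" .
  show "N \<subseteq> V' \<and> stable N" unfolding stable_def
    using submoduleE[OF s] one_closed by auto
next
  assume N: "N \<subseteq> V' \<and> stable N"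
  interpret Module.module R "series_module V'" by (rule module_series[OF assms])
  show "Module.submodule N R (series_module V')"
  proof (rule submoduleI)
    fix x assume "x \<in> N"
    then show "\<ominus>\<^bsub>series_module V'\<^esub> x \<in> N" using N assms a_inv_series[of V' x] stableD(4) by auto
  qed (use N stableD in auto)
qed

lemma submodule_gen_least:
  assumes "stable V'" "A \<subseteq> N" "N \<subseteq> V'" "stable N"
  shows "submodule_gen R (series_module V') A \<subseteq> N"
  using assms by (auto simp: submodule_gen_def submodule_iff)

lemma submodule_gen_closed:
  assumes "stable V'" "A \<subseteq> V'"
  shows "stable (submodule_gen R (series_module V') A)" "A \<subseteq> submodule_gen R (series_module V') A"
    "submodule_gen R (series_module V') A \<subseteq> V'"
  using assms by (auto simp: submodule_gen_def submodule_iff stable_def)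

text \<open>
  Sorting the terms of a series by the residues of both exponents modulo \<open>n\<close> exhibits the
  semi-invariants as a module generated by finitely many monomials.
\<close>

definition small_expo :: "int \<Rightarrow> (nat \<times> nat) set" where
  "small_expo t = {(i, j). i < n \<and> j < n \<and> (i, j) \<in> expo t}"

lemma finite_small_expo: "finite (small_expo t)"
  by (rule finite_subset[of _ "{..<n} \<times> {..<n}"]) (auto simp: small_expo_def)

lemma residue_decomposition:
  assumes "f \<in> V t"
  shows "\<exists>h. (\<forall>i j. h i j \<in> Inv) \<and> f = (\<Sum>(i, j)\<in>small_expo t. h i j * (var_x ^ i * var_y ^ j))"
proof -
  define h where "h = (\<lambda>i j. Abs_fps (\<lambda>q. Abs_fps (\<lambda>p. if n dvd p \<and> n dvd q then cf f (p + i) (q + j) else 0)))"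
  have ch: "cf (h i j) p q = (if n dvd p \<and> n dvd q then cf f (p + i) (q + j) else 0)" for i j p q
    by (simp add: h_def)
  have "h i j \<in> Inv" for i j
  proof (rule supportedI)
    fix p q assume "(p, q) \<notin> expo 0"
    then have "\<not> (n dvd p \<and> n dvd q)"
      by (auto simp: expo_iff cong_0_iff)
    then show "cf (h i j) p q = 0" by (auto simp: ch)
  qed
  moreover have "f = (\<Sum>(i, j)\<in>small_expo t. h i j * (var_x ^ i * var_y ^ j))"
  proof (rule cf_eqI)
    fix p q
    have coeff: "cf (h i j * (var_x ^ i * var_y ^ j)) p q = (if (i, j) = (p mod n, q mod n) then cf f p q else 0)"
      if "(i, j) \<in> small_expo t" for i j
    proof -
      have "i \<le> p \<and> n dvd p - i \<longleftrightarrow> i = p mod n" if "i < n" for i p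
        using that by (metis mod_eq_dvd_iff_nat mod_less mod_less_eq_dividend)
      then have "i \<le> p \<and> n dvd p - i \<longleftrightarrow> i = p mod n" "j \<le> q \<and> n dvd q - j \<longleftrightarrow> j = q mod n"
        using that by (auto simp: small_expo_def)
      then show ?thesis by (subst mult.commute) (auto simp: cf_monom_mult ch)
    qed
    have "cf (\<Sum>(i, j)\<in>small_expo t. h i j * (var_x ^ i * var_y ^ j)) p q
        = (\<Sum>z\<in>small_expo t. if z = (p mod n, q mod n) then cf f p q else 0)"
      unfolding cf_sum using coeff by (intro sum.cong) (auto split: if_splits)
    also have "\<dots> = (if (p mod n, q mod n) \<in> small_expo t then cf f p q else 0)"
      by (simp add: sum.delta finite_small_expo)
    also have "\<dots> = cf f p q"
    proof (cases "(p, q) \<in> expo t")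
      case True
      have "[int (p mod n) + int (q mod n) * int a = int p + int q * int a] (mod int n)"
        by (intro cong_add cong_mult) (auto simp: cong_def zmod_int)
      then have "(p mod n, q mod n) \<in> expo t" using True by (auto simp: expo_iff intro: cong_trans)
      then show ?thesis using n_gt_1 by (simp add: small_expo_def)
    next
      case False
      then show ?thesis using assms by (simp add: supportedD)
    qed
    finally show "cf f p q = cf (\<Sum>(i, j)\<in>small_expo t. h i j * (var_x ^ i * var_y ^ j)) p q" by simp
  qed
  ultimately show ?thesis by blast
qed

lemma V_least:
  assumes "stable N" "\<And>i j. (i, j) \<in> small_expo t \<Longrightarrow> var_x ^ i * var_y ^ j \<in> N"
  shows "V t \<subseteq> N"
proof
  fix f assume "f \<in> V t"
  then obtain h where h: "\<And>i j. h i j \<in> Inv"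
    and f: "f = (\<Sum>(i, j)\<in>small_expo t. h i j * (var_x ^ i * var_y ^ j))"
    using residue_decomposition by blast
  have "(case z of (i, j) \<Rightarrow> h i j * (var_x ^ i * var_y ^ j)) \<in> N" if "z \<in> small_expo t" for z
    using that stableD(3)[OF assms(1) h assms(2)] by (cases z) simp
  then show "f \<in> N" unfolding f by (rule stable_sum[OF assms(1)])
qed

lemma M_mod_eq: "M_mod n a \<zeta> t = series_module (V t)"
proof -
  let ?G = "{var_x ^ i * var_y ^ j | i j. [int i + int j * int a = t] (mod int n)}"
  have "submodule_gen R (series_module UNIV) ?G = V t"
  proof
    show "submodule_gen R (series_module UNIV) ?G \<subseteq> V t"
      by (rule submodule_gen_least) (auto intro: stable_UNIV stable_V supported_monom simp: expo_iff)
    show "V t \<subseteq> submodule_gen R (series_module UNIV) ?G"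
      by (rule V_least) (use submodule_gen_closed[OF stable_UNIV, of ?G] in \<open>auto simp: small_expo_def expo_iff\<close>)
  qed
  then show ?thesis by (simp add: M_mod_def)
qed

lemma finitely_generated_V: "finitely_generated R (series_module (V t))"
proof -
  let ?A = "(\<lambda>(i, j). var_x ^ i * var_y ^ j) ` small_expo t :: 'k fps fps set"
  have A: "?A \<subseteq> V t" by (auto simp: small_expo_def intro: supported_monom)
  have "V t \<subseteq> submodule_gen R (series_module (V t)) ?A"
    by (rule V_least) (use submodule_gen_closed[OF stable_V A] in auto)
  then have "submodule_gen R (series_module (V t)) ?A = V t"
    using submodule_gen_closed[OF stable_V A] by blast
  then show ?thesis unfolding finitely_generated_def using A finite_small_expo
    by (intro exI[of _ ?A]) simp
qed

section \<open>Quotients\<close>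

definition coset :: "'k fps fps set \<Rightarrow> 'k fps fps \<Rightarrow> 'k fps fps set" where
  "coset N z = (\<lambda>h. h + z) ` N"

lemma coset_eq_iff: "stable N \<Longrightarrow> coset N y = coset N z \<longleftrightarrow> y - z \<in> N"
proof
  assume N: "stable N" and "coset N y = coset N z"
  moreover have "y \<in> coset N y" using stableD(1)[OF N] by (force simp: coset_def)
  ultimately obtain h where "h \<in> N" "y = h + z" by (auto simp: coset_def)
  then show "y - z \<in> N" by simp
next
  assume N: "stable N" and d: "y - z \<in> N"
  have "h + y \<in> coset N z" if "h \<in> N" for h
    using stableD(2)[OF N that d] by (auto simp: coset_def algebra_simps intro!: image_eqI[of _ _ "h + (y - z)"])
  moreover have "h + z \<in> coset N y" if "h \<in> N" for h
    using stableD(5)[OF N that d] by (auto simp: coset_def algebra_simps intro!: image_eqI[of _ _ "h - (y - z)"])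
  ultimately show "coset N y = coset N z" by (auto simp: coset_def)
qed

lemma coset_zero: "coset N 0 = N"
  by (simp add: coset_def)

lemma coset_eq_self_iff: "stable N \<Longrightarrow> coset N z = N \<longleftrightarrow> z \<in> N"
  using coset_eq_iff[of N z 0] by (simp add: coset_zero)

lemma mem_coset: "stable N \<Longrightarrow> y \<in> coset N z \<longleftrightarrow> y - z \<in> N"
  by (auto simp: coset_def image_iff algebra_simps intro!: bexI[of _ "y - z"])

lemma quot_simps:
  "carrier (quot_module (series_module V') N) = coset N ` V'"
  "zero (quot_module (series_module V') N) = N"
  by (auto simp: quot_module_def A_RCOSETS_def' a_r_coset_def' coset_def)

lemma quot_add:
  assumes "stable N"
  shows "add (quot_module (series_module V') N) (coset N y) (coset N z) = coset N (y + z)"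
proof -
  have "add (quot_module (series_module V') N) (coset N y) (coset N z) = {u + v | u v. u \<in> coset N y \<and> v \<in> coset N z}"
    by (auto simp: quot_module_def set_add_def')
  also have "\<dots> = coset N (y + z)"
  proof (intro equalityI subsetI)
    fix x assume "x \<in> {u + v | u v. u \<in> coset N y \<and> v \<in> coset N z}"
    then obtain u v where "x = u + v" "u - y \<in> N" "v - z \<in> N" by (auto simp: mem_coset[OF assms])
    then show "x \<in> coset N (y + z)" using stableD(2)[OF assms, of "u - y" "v - z"]
      by (simp add: mem_coset[OF assms] algebra_simps)
  next
    fix x assume "x \<in> coset N (y + z)"
    then have "(x - z) - y \<in> N" "z - z \<in> N" using stableD(1)[OF assms]
      by (simp_all add: mem_coset[OF assms] algebra_simps)
    then show "x \<in> {u + v | u v. u \<in> coset N y \<and> v \<in> coset N z}"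
      by (intro CollectI exI[of _ "x - z"] exI[of _ z]) (simp add: mem_coset[OF assms])
  qed
  finally show ?thesis .
qed

lemma quot_smult:
  assumes N: "stable N" and r: "r \<in> Inv"
  shows "module.smult (quot_module (series_module V') N) r (coset N z) = coset N (r * z)"
proof -
  have z: "z \<in> coset N z" using stableD(1)[OF N] by (simp add: mem_coset[OF N])
  have "module.smult (quot_module (series_module V') N) r (coset N z) = (\<Union>x\<in>coset N z. coset N (r * x))"
    by (auto simp: quot_module_def a_r_coset_def' coset_def)
  also have "\<dots> = (\<Union>x\<in>coset N z. coset N (r * z))"
  proof (intro SUP_cong refl)
    fix x assume "x \<in> coset N z"
    then have "r * (x - z) \<in> N" using stableD(3)[OF N r] by (simp add: mem_coset[OF N])
    then show "coset N (r * x) = coset N (r * z)" by (simp add: coset_eq_iff[OF N] algebra_simps)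
  qed
  also have "\<dots> = coset N (r * z)" using z by auto
  finally show ?thesis .
qed

lemma quot_module_module:
  assumes V': "stable V'" and N: "stable N" "N \<subseteq> V'"
  shows "Module.module R (quot_module (series_module V') N)"
proof (rule Module.moduleI[OF cring_R])
  show "abelian_group (quot_module (series_module V') N)"
  proof (rule abelian_groupI)
    fix x assume "x \<in> carrier (quot_module (series_module V') N)"
    then obtain z where z: "x = coset N z" "z \<in> V'" by (auto simp: quot_simps)
    have "coset N (- z) \<oplus>\<^bsub>quot_module (series_module V') N\<^esub> x = \<zero>\<^bsub>quot_module (series_module V') N\<^esub>"
      unfolding z quot_add[OF N(1)] by (simp add: coset_zero quot_simps)
    then show "\<exists>y\<in>carrier (quot_module (series_module V') N). y \<oplus>\<^bsub>quot_module (series_module V') N\<^esub> x = \<zero>\<^bsub>quot_module (series_module V') N\<^esub>"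
      using stableD(4)[OF V' z(2)] by (auto simp: quot_simps)
  next
    show "\<zero>\<^bsub>quot_module (series_module V') N\<^esub> \<in> carrier (quot_module (series_module V') N)"
      using stableD(1)[OF V'] coset_zero[of N] by (auto simp: quot_simps intro!: image_eqI[of _ _ 0])
    fix x assume "x \<in> carrier (quot_module (series_module V') N)"
    then obtain z where z: "x = coset N z" "z \<in> V'" by (auto simp: quot_simps)
    have "add (quot_module (series_module V') N) (coset N 0) (coset N z) = coset N z"
      by (simp add: quot_add[OF N(1)])
    then show "\<zero>\<^bsub>quot_module (series_module V') N\<^esub> \<oplus>\<^bsub>quot_module (series_module V') N\<^esub> x = x"
      by (simp add: z coset_zero quot_simps)
  qed (auto simp: quot_simps quot_add[OF N(1)] ac_simps stableD[OF V'])
qed (auto simp: quot_simps quot_smult[OF N(1)] quot_add[OF N(1)] algebra_simps supported_add Inv_mult one_Inv stableD[OF V'])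

end

section \<open>Linear dependence over an integral domain\<close>

text \<open>
  Gaussian elimination without divisions: one vector with a nonzero coordinate \<open>b\<close> is used to clear
  this coordinate in all the others.
\<close>

lemma linear_dependence:
  fixes w :: "'i \<Rightarrow> 'j \<Rightarrow> 'c::idom"
  assumes "finite L" "finite A" "card L < card A"
  shows "\<exists>c. (\<exists>i\<in>A. c i \<noteq> 0) \<and> (\<forall>b\<in>L. (\<Sum>i\<in>A. c i * w i b) = 0)"
  using assms
proof (induction L arbitrary: A w rule: finite_induct)
  case empty
  then have "A \<noteq> {}" by auto
  then show ?case by (intro exI[of _ "\<lambda>_. 1"]) auto
next
  case (insert b L)
  show ?case
  proof (cases "\<forall>i\<in>A. w i b = 0")
    case True
    obtain c where "\<exists>i\<in>A. c i \<noteq> 0" "\<forall>b\<in>L. (\<Sum>i\<in>A. c i * w i b) = 0"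
      using insert.IH[of A w] insert.prems insert.hyps by auto
    then show ?thesis using True by (intro exI[of _ c]) auto
  next
    case False
    then obtain i0 where i0: "i0 \<in> A" "w i0 b \<noteq> 0" by auto
    define A' where "A' = A - {i0}"
    have A': "finite A'" "A = insert i0 A'" "i0 \<notin> A'" using insert.prems i0 by (auto simp: A'_def)
    have "card L < card A'" using insert A' by simp
    from insert.IH[OF A'(1) this, of "\<lambda>i b'. w i0 b * w i b' - w i b * w i0 b'"]
    obtain c where c: "\<exists>i\<in>A'. c i \<noteq> 0"
      "\<And>b'. b' \<in> L \<Longrightarrow> (\<Sum>i\<in>A'. c i * (w i0 b * w i b' - w i b * w i0 b')) = 0" by auto
    define d where "d = (\<lambda>i. if i = i0 then - (\<Sum>i\<in>A'. c i * w i b) else w i0 b * c i)"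
    have s: "(\<Sum>i\<in>A. d i * w i b') = (\<Sum>i\<in>A'. c i * (w i0 b * w i b' - w i b * w i0 b'))" for b'
    proof -
      have "(\<Sum>i\<in>A'. d i * w i b') = (\<Sum>i\<in>A'. w i0 b * c i * w i b')"
        using A'(3) by (intro sum.cong) (auto simp: d_def)
      then have "(\<Sum>i\<in>A. d i * w i b') = (\<Sum>i\<in>A'. w i0 b * c i * w i b') - (\<Sum>i\<in>A'. c i * w i b) * w i0 b'"
        using A' by (simp add: d_def)
      moreover have "(\<Sum>i\<in>A'. c i * (w i0 b * w i b' - w i b * w i0 b')) =
          (\<Sum>i\<in>A'. w i0 b * c i * w i b') - (\<Sum>i\<in>A'. c i * w i b) * w i0 b'"
        by (simp add: sum_distrib_left sum_distrib_right right_diff_distrib sum_subtractf ac_simps)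
      ultimately show ?thesis by simp
    qed
    have "\<forall>b'\<in>insert b L. (\<Sum>i\<in>A. d i * w i b') = 0"
      using c(2) by (auto simp: s algebra_simps)
    moreover obtain i where "i \<in> A'" "c i \<noteq> 0" using c(1) by auto
    then have "\<exists>i\<in>A. d i \<noteq> 0" using A' i0 by (intro bexI[of _ i]) (auto simp: d_def)
    ultimately show ?thesis by blast
  qed
qed

section \<open>Components of a given weight\<close>

context cyclic_type
begin

text \<open>
  The component of weight \<open>s\<close>. Multiplication by a semi-invariant only shifts weights, so relations
  between series may be decomposed into their components.
\<close>

definition project :: "int \<Rightarrow> 'k::field fps fps \<Rightarrow> 'k fps fps" where
  "project s f = Abs_fps (\<lambda>j. Abs_fps (\<lambda>i. if (i, j) \<in> expo s then cf f i j else 0))"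

lemma cf_project: "cf (project s f) i j = (if (i, j) \<in> expo s then cf f i j else 0)"
  by (simp add: project_def)

lemma project_supported: "project s f \<in> supported (expo s)"
  by (simp add: supported_def cf_project)

lemma project_id: "f \<in> supported (expo s) \<Longrightarrow> project s f = f"
  by (rule cf_eqI) (auto simp: cf_project supported_def)

lemma project_sum: "project s (\<Sum>x\<in>A. h x) = (\<Sum>x\<in>A. project s (h x))"
  by (rule cf_eqI) (simp add: cf_project cf_sum)

lemma project_mult:
  assumes "f \<in> supported (expo t)"
  shows "project (t + s) (f * g) = f * project s g"
proof (rule cf_eqI)
  fix i j
  have "cf f p q * cf (project s g) (i - p) (j - q) =
      (if (i, j) \<in> expo (t + s) then cf f p q * cf g (i - p) (j - q) else 0)" if "p \<le> i" "q \<le> j" for p q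
  proof (cases "cf f p q = 0")
    case False
    then have pq: "(p, q) \<in> expo t" using assms by (auto simp: supported_def)
    have "(i - p, j - q) \<in> expo s \<longleftrightarrow> (i, j) \<in> expo (t + s)"
      using expo_add[OF pq, of "i - p" "j - q" s] expo_diff[OF _ pq, of i j "t + s"] that by auto
    then show ?thesis by (simp add: cf_project)
  qed simp
  then show "cf (project (t + s) (f * g)) i j = cf (f * project s g) i j"
    unfolding cf_project[of "t + s"] cf_mult by (auto intro!: sum.cong sum.neutral)
qed

end

section \<open>The maximal ideal and its powers\<close>

context cyclic_sing
begin

definition m_ideal :: "'k fps fps set" where "m_ideal = supported (expo 0 - {(0, 0)})"

lemma m_ideal_iff: "f \<in> m_ideal \<longleftrightarrow> f \<in> Inv \<and> cf f 0 0 = 0"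
  unfolding m_ideal_def supported_def mem_Collect_eq Diff_iff singleton_iff prod.inject by metis

text \<open>
  An inverse exists in \<open>k[[x, y]]\<close>, and its component of weight 0 is still an inverse.
\<close>

lemma unit_inverse:
  assumes f: "f \<in> Inv" "cf f 0 0 \<noteq> 0"
  shows "\<exists>g\<in>Inv. f * g = 1"
proof -
  have "fps_nth f 0 * inverse (fps_nth f 0) = 1"
    using f(2) by (intro inverse_mult_eq_1') (simp add: cf_def)
  then have "f * fps_right_inverse f (inverse (fps_nth f 0)) = 1" by (rule fps_right_inverse)
  then have "project 0 (f * fps_right_inverse f (inverse (fps_nth f 0))) = project 0 1" by simp
  then have "f * project 0 (fps_right_inverse f (inverse (fps_nth f 0))) = 1"
    using project_mult[OF f(1), of 0] project_id[OF one_Inv] by simp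
  then show ?thesis using project_supported by blast
qed

lemma ideal_iff: "ideal J R \<longleftrightarrow> J \<subseteq> Inv \<and> stable J"
proof
  assume id: "ideal J R"
  note J = ideal.axioms(1)[OF id]
  show "J \<subseteq> Inv \<and> stable J" unfolding stable_def
    using additive_subgroup.a_subset[OF J] additive_subgroup.zero_closed[OF J]
      additive_subgroup.a_closed[OF J] ideal.I_l_closed[OF id] by auto
next
  assume J: "J \<subseteq> Inv \<and> stable J"
  interpret cring R by (rule cring_R)
  have neg: "\<ominus>\<^bsub>R\<^esub> x = - x" if "x \<in> Inv" for x
    using minus_equality[of "- x" x] that supported_minus by auto
  show "ideal J R"
  proof (rule idealI)
    show "subgroup J (add_monoid R)"
    proof (rule subgroup.intro)
      fix x assume "x \<in> J"
      then have "\<ominus>\<^bsub>R\<^esub> x \<in> J" using J neg stableD(4) by auto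
      then show "inv\<^bsub>add_monoid R\<^esub> x \<in> J" unfolding a_inv_def .
    qed (use J stableD in auto)
  next
    fix x y assume "x \<in> J" "y \<in> carrier R"
    then show "y \<otimes>\<^bsub>R\<^esub> x \<in> J" "x \<otimes>\<^bsub>R\<^esub> y \<in> J" using J stableD(3)[of J y x] by (auto simp: mult.commute)
  qed (rule ring_axioms)
qed

lemma stable_m_ideal: "stable m_ideal"
  unfolding m_ideal_def by (rule stable_supported) (auto intro: expo_add0)

lemma ideal_with_unit:
  assumes "ideal J R" "f \<in> J" "f \<notin> m_ideal"
  shows "J = Inv"
proof -
  have J: "J \<subseteq> Inv" "stable J" using assms(1) by (auto simp: ideal_iff)
  obtain g where "g \<in> Inv" "f * g = 1" using unit_inverse[of f] assms(2,3) J(1) by (auto simp: m_ideal_iff)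
  then have "1 \<in> J" using stableD(3)[OF J(2), of g f] assms(2) by (simp add: mult.commute)
  then show ?thesis using J stableD(3)[OF J(2), of _ 1] by auto
qed

lemma one_notin_m_ideal: "1 \<notin> m_ideal"
  by (simp add: m_ideal_iff cf_one)

lemma max_ideal_eq: "max_ideal R = m_ideal"
  unfolding max_ideal_def
proof (rule the_equality)
  have id: "ideal m_ideal R" using stable_m_ideal by (auto simp: ideal_iff m_ideal_iff)
  show "maximalideal m_ideal R"
  proof (rule maximalideal.intro[OF id], unfold_locales)
    show "carrier R \<noteq> m_ideal" using one_Inv one_notin_m_ideal by auto
    fix J assume "ideal J R" "m_ideal \<subseteq> J" "J \<subseteq> carrier R"
    then show "J = m_ideal \<or> J = carrier R" using ideal_with_unit[of J] by auto
  qed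
  fix J assume "maximalideal J R"
  then interpret J: maximalideal J R .
  have "J \<subseteq> m_ideal" using ideal_with_unit[OF J.is_ideal] J.I_notcarr by auto
  then show "J = m_ideal" using J.I_maximal[OF id] one_Inv one_notin_m_ideal m_ideal_iff by auto
qed

declare power_expo.simps(2) [simp del]

lemma power_expo_SucI:
  "(p, q) \<in> expo 0 - {(0, 0)} \<Longrightarrow> (i, j) \<in> power_expo t k \<Longrightarrow> (p + i, q + j) \<in> power_expo t (Suc k)"
  unfolding power_expo.simps by blast

lemma power_expo_SucE:
  assumes "(i, j) \<in> power_expo t (Suc k)"
  obtains p q i' j' where "i = p + i'" "j = q + j'" "(p, q) \<in> expo 0 - {(0, 0)}" "(i', j') \<in> power_expo t k"
  using assms unfolding power_expo.simps by blast

lemma power_expo_add0: "(p, q) \<in> expo 0 \<Longrightarrow> (i, j) \<in> power_expo t k \<Longrightarrow> (p + i, q + j) \<in> power_expo t k"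
proof (induction k arbitrary: i j)
  case 0
  then show ?case using expo_add0 by simp
next
  case (Suc k)
  from Suc.prems(2) obtain p' q' i' j' where e: "i = p' + i'" "j = q' + j'" "(p', q') \<in> expo 0 - {(0, 0)}" "(i', j') \<in> power_expo t k"
    by (rule power_expo_SucE)
  have "(p' + (p + i'), q' + (q + j')) \<in> power_expo t (Suc k)"
    using Suc.IH[OF Suc.prems(1) e(4)] by (rule power_expo_SucI[OF e(3)])
  then show ?case by (simp add: e(1,2) ac_simps)
qed

lemma power_expo_combine:
  "(p, q) \<in> power_expo 0 k \<Longrightarrow> (i, j) \<in> expo t \<Longrightarrow> (p + i, q + j) \<in> power_expo t k"
proof (induction k arbitrary: p q)
  case 0
  then show ?case using expo_add0 by simp
next
  case (Suc k)
  from Suc.prems(1) obtain p' q' i' j' where e: "p = p' + i'" "q = q' + j'" "(p', q') \<in> expo 0 - {(0, 0)}" "(i', j') \<in> power_expo 0 k"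
    by (rule power_expo_SucE)
  have "(p' + (i' + i), q' + (j' + j)) \<in> power_expo t (Suc k)"
    using Suc.IH[OF e(4) Suc.prems(2)] by (rule power_expo_SucI[OF e(3)])
  then show ?case using e by (simp add: add.assoc)
qed

lemma stable_power_expo: "stable (supported (power_expo t k))"
  by (rule stable_supported) (rule power_expo_add0)

lemma monom_mult: "(var_x ^ i * var_y ^ j) * (var_x ^ p * var_y ^ q) = (var_x ^ (i + p) * var_y ^ (j + q) :: 'k fps fps)"
  by (simp add: power_add ac_simps)

lemma ideal_power_supported: "ideal_power R m_ideal k \<subseteq> supported (power_expo 0 k)"
proof (induction k)
  case (Suc k)
  have "f \<in> supported (power_expo 0 (Suc k))" if "f \<in> ideal_prod R m_ideal (ideal_power R m_ideal k)" for f
    using that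
  proof (induction rule: ideal_prod.induct)
    case (prod f g)
    then show ?case using Suc unfolding m_ideal_def
      by (simp, intro supported_mult[of f "expo 0 - {(0, 0)}" g "power_expo 0 k"] power_expo_SucI) auto
  next
    case (sum f g)
    then show ?case by (simp add: supported_add)
  qed
  then show ?case by auto
qed simp

lemma power_expo_split:
  "(i, j) \<in> power_expo t k \<Longrightarrow> \<exists>p q i' j'. var_x ^ p * var_y ^ q \<in> ideal_power R m_ideal k \<and> (i', j') \<in> expo t \<and>
    i = p + i' \<and> j = q + j'"
proof (induction k arbitrary: i j)
  case 0
  then show ?case using one_Inv by (intro exI[of _ 0] exI[of _ i] exI[of _ j] exI[of _ "0::nat"]) auto
next
  case (Suc k)
  from Suc.prems obtain p' q' i1 j1 where e: "i = p' + i1" "j = q' + j1" "(p', q') \<in> expo 0 - {(0, 0)}" "(i1, j1) \<in> power_expo t k"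
    by (rule power_expo_SucE)
  obtain p q i' j' where IH: "var_x ^ p * var_y ^ q \<in> ideal_power R m_ideal k" "(i', j') \<in> expo t" "i1 = p + i'" "j1 = q + j'"
    using Suc.IH[OF e(4)] by blast
  have "var_x ^ p' * var_y ^ q' \<in> m_ideal" unfolding m_ideal_def by (rule supported_monom[OF e(3)])
  from ideal_prod.prod[OF this IH(1), of R]
  have "var_x ^ (p' + p) * var_y ^ (q' + q) \<in> ideal_power R m_ideal (Suc k)" by (simp add: monom_mult)
  then show ?case using IH e by (intro exI[of _ "p' + p"] exI[of _ "q' + q"] exI[of _ i'] exI[of _ j']) auto
qed

lemma expo_axes: "(n, 0) \<in> expo 0 - {(0, 0)}" "(0, n) \<in> expo 0 - {(0, 0)}"
  using n_gt_1 by (auto simp: expo_iff cong_0_iff)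

lemma axes_in_ideal_power: "var_x ^ (n * k) \<in> ideal_power R m_ideal k" "var_y ^ (n * k) \<in> ideal_power R m_ideal k"
proof (induction k)
  case (Suc k)
  { case 1
    have "var_x ^ n * var_y ^ 0 \<in> m_ideal" unfolding m_ideal_def by (rule supported_monom[OF expo_axes(1)])
    from ideal_prod.prod[OF this Suc(1), of R] show ?case by (simp add: power_add) }
  { case 2
    have "var_x ^ 0 * var_y ^ n \<in> m_ideal" unfolding m_ideal_def by (rule supported_monom[OF expo_axes(2)])
    from ideal_prod.prod[OF this Suc(2), of R] show ?case by (simp add: power_add) }
qed (use one_Inv in auto)

text \<open>
  A series is a polynomial plus a tail divisible by a high power of \<open>x\<close> plus a tail divisible by a
  high power of \<open>y\<close>; this avoids all questions of convergence.
\<close>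

lemma split_tails:
  assumes f: "f \<in> V t"
  shows "\<exists>g\<in>V t. \<exists>h\<in>V t. f = (\<Sum>(i, j)\<in>{..<n * k} \<times> {..<n * k}. const_xy (cf f i j) * (var_x ^ i * var_y ^ j))
    + var_x ^ (n * k) * g + var_y ^ (n * k) * h"
proof -
  define K where "K = n * k"
  define g where "g = Abs_fps (\<lambda>j. Abs_fps (\<lambda>i. cf f (i + K) j))"
  define h where "h = Abs_fps (\<lambda>j. Abs_fps (\<lambda>i. if i < K then cf f i (j + K) else 0))"
  have cg: "cf g i j = cf f (i + K) j" and ch: "cf h i j = (if i < K then cf f i (j + K) else 0)" for i j
    by (simp_all add: g_def h_def)
  have "[int (i + K) + int j * int a = int i + int j * int a] (mod int n)"
    "[int i + int (j + K) * int a = int i + int j * int a] (mod int n)" for i j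
    by (simp_all add: K_def cong_iff_dvd_diff algebra_simps)
  then have ex: "(i + K, j) \<in> expo t \<longleftrightarrow> (i, j) \<in> expo t" "(i, j + K) \<in> expo t \<longleftrightarrow> (i, j) \<in> expo t" for i j
    unfolding expo_iff by (meson cong_sym cong_trans)+
  have "g \<in> V t" "h \<in> V t" using f by (auto intro!: supportedI simp: cg ch ex supportedD)
  moreover have "f = (\<Sum>(i, j)\<in>{..<K} \<times> {..<K}. const_xy (cf f i j) * (var_x ^ i * var_y ^ j))
    + var_x ^ K * g + var_y ^ K * h"
  proof (rule cf_eqI)
    fix p q
    have "cf (\<Sum>(i, j)\<in>{..<K} \<times> {..<K}. const_xy (cf f i j) * (var_x ^ i * var_y ^ j)) p q
        = (\<Sum>z\<in>{..<K} \<times> {..<K}. if z = (p, q) then cf f p q else 0)"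
      unfolding cf_sum by (intro sum.cong refl) (auto simp: cf_const_mult cf_monom split: if_splits)
    also have "\<dots> = (if p < K \<and> q < K then cf f p q else 0)" by (simp add: sum.delta)
    finally have s: "cf (\<Sum>(i, j)\<in>{..<K} \<times> {..<K}. const_xy (cf f i j) * (var_x ^ i * var_y ^ j)) p q =
      (if p < K \<and> q < K then cf f p q else 0)" .
    show "cf f p q = cf ((\<Sum>(i, j)\<in>{..<K} \<times> {..<K}. const_xy (cf f i j) * (var_x ^ i * var_y ^ j))
      + var_x ^ K * g + var_y ^ K * h) p q"
      using cf_monom_mult[of K 0 g p q] cf_monom_mult[of 0 K h p q]
      by (auto simp: s cg ch not_less)
  qed
  ultimately show ?thesis unfolding K_def by blast
qed

text \<open>
  All but finitely many terms of a series are covered by the multiples of \<open>x\<^sup>n\<^sup>k\<close> and \<open>y\<^sup>n\<^sup>k\<close>, so that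
  monomials suffice to determine the submodule.
\<close>

lemma ideal_smult_eq:
  assumes mult: "\<And>f g. f \<in> J \<Longrightarrow> g \<in> V t \<Longrightarrow> f * g \<in> supported (power_expo t k)"
    and monoms: "\<And>i j. (i, j) \<in> power_expo t k \<Longrightarrow> \<exists>p q i' j'. var_x ^ p * var_y ^ q \<in> J \<and> (i', j') \<in> expo t \<and>
      i = p + i' \<and> j = q + j'"
    and axes: "var_x ^ (n * k) \<in> J" "var_y ^ (n * k) \<in> J"
  shows "ideal_smult R J (series_module (V t)) = supported (power_expo t k)"
proof -
  let ?A = "{c * x | c x. c \<in> J \<and> x \<in> V t}"
  have A: "?A \<subseteq> V t" using mult supported_mono[OF power_expo_subset] by fastforce
  have eq: "ideal_smult R J (series_module (V t)) = submodule_gen R (series_module (V t)) ?A"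
    by (simp add: ideal_smult_def)
  define N where "N = submodule_gen R (series_module (V t)) ?A"
  have N: "stable N" "?A \<subseteq> N" unfolding N_def using submodule_gen_closed[OF stable_V A] by auto
  have "N \<subseteq> supported (power_expo t k)" unfolding N_def
  proof (rule submodule_gen_least[OF stable_V])
    show "?A \<subseteq> supported (power_expo t k)" using mult by auto
  qed (rule supported_mono[OF power_expo_subset] stable_power_expo)+
  moreover have "supported (power_expo t k) \<subseteq> N"
  proof
    fix f :: "'k fps fps" assume f: "f \<in> supported (power_expo t k)"
    then have "f \<in> V t" using supported_mono[OF power_expo_subset] by auto
    from split_tails[OF this, of k] obtain g h where gh: "g \<in> V t" "h \<in> V t"
      and fe: "f = (\<Sum>(i, j)\<in>{..<n * k} \<times> {..<n * k}. const_xy (cf f i j) * (var_x ^ i * var_y ^ j))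
        + var_x ^ (n * k) * g + var_y ^ (n * k) * h" by blast
    have "const_xy (cf f i j) * (var_x ^ i * var_y ^ j) \<in> N" for i j
    proof (cases "(i, j) \<in> power_expo t k")
      case True
      then obtain p q i' j' where m: "var_x ^ p * var_y ^ q \<in> J" "(i', j') \<in> expo t" "i = p + i'" "j = q + j'"
        using monoms by blast
      have "(var_x ^ p * var_y ^ q) * (var_x ^ i' * var_y ^ j') \<in> N"
        using N(2) m(1) supported_monom[OF m(2)] by blast
      then show ?thesis unfolding monom_mult m(3,4) by (rule stable_const[OF N(1)])
    next
      case False
      then have "const_xy (cf f i j) = 0" using f by (simp add: supportedD const_xy_def)
      then show ?thesis using stableD(1)[OF N(1)] by simp
    qed
    then have "(\<Sum>(i, j)\<in>{..<n * k} \<times> {..<n * k}. const_xy (cf f i j) * (var_x ^ i * var_y ^ j)) \<in> N"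
      by (intro stable_sum[OF N(1)]) auto
    moreover have "var_x ^ (n * k) * g \<in> N" "var_y ^ (n * k) * h \<in> N" using N(2) axes gh by blast+
    ultimately show "f \<in> N" by (subst fe) (intro stableD(2)[OF N(1)])
  qed
  ultimately show ?thesis unfolding eq N_def by blast
qed

lemma ideal_power_smult: "ideal_smult R (ideal_power R m_ideal k) (series_module (V t)) = supported (power_expo t k)"
proof (rule ideal_smult_eq)
  fix f g assume "f \<in> ideal_power R m_ideal k" "g \<in> V t"
  then show "f * g \<in> supported (power_expo t k)"
    using ideal_power_supported by (intro supported_mult[of f "power_expo 0 k" g "expo t"] power_expo_combine) auto
qed (use power_expo_split axes_in_ideal_power in auto)

lemma m_ideal_smult: "ideal_smult R m_ideal (series_module (V t)) = supported (power_expo t 1)"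
proof (rule ideal_smult_eq)
  fix f g assume "f \<in> m_ideal" "g \<in> V t"
  then show "f * g \<in> supported (power_expo t 1)" unfolding m_ideal_def One_nat_def
    by (intro supported_mult[of f "expo 0 - {(0, 0)}" g "expo t"] power_expo_SucI) auto
next
  fix i j assume "(i, j) \<in> power_expo t 1"
  then obtain p q i' j' where "i = p + i'" "j = q + j'" "(p, q) \<in> expo 0 - {(0, 0)}" "(i', j') \<in> expo t"
    unfolding One_nat_def power_expo.simps by blast
  then show "\<exists>p q i' j'. var_x ^ p * var_y ^ q \<in> m_ideal \<and> (i', j') \<in> expo t \<and> i = p + i' \<and> j = q + j'"
    using supported_monom[of p q "expo 0 - {(0, 0)}"] unfolding m_ideal_def by blast
next
  show "var_x ^ (n * 1) \<in> m_ideal" "var_y ^ (n * 1) \<in> m_ideal"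
    using supported_monom[OF expo_axes(1)] supported_monom[OF expo_axes(2)] by (auto simp: m_ideal_def)
qed

section \<open>Length and number of generators\<close>

lemma quot_submodule_iff:
  assumes F: "stable F" "F \<subseteq> V t"
  shows "Module.submodule S R (quot_module (series_module (V t)) F) \<longleftrightarrow>
    (\<exists>N. stable N \<and> F \<subseteq> N \<and> N \<subseteq> V t \<and> S = coset F ` N)"
proof -
  interpret Q: Module.module R "quot_module (series_module (V t)) F"
    by (rule quot_module_module[OF stable_V F])
  have neg: "\<ominus>\<^bsub>quot_module (series_module (V t)) F\<^esub> coset F z = coset F (- z)" if "z \<in> V t" for z
  proof (rule Q.M.minus_equality)
    show "coset F (- z) \<oplus>\<^bsub>quot_module (series_module (V t)) F\<^esub> coset F z = \<zero>\<^bsub>quot_module (series_module (V t)) F\<^esub>"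
      unfolding quot_add[OF F(1)] by (simp add: quot_simps coset_zero)
  qed (use that supported_minus in \<open>auto simp: quot_simps\<close>)
  show ?thesis
  proof
    assume s: "Module.submodule S R (quot_module (series_module (V t)) F)"
    have S: "S \<subseteq> coset F ` V t" "F \<in> S"
      "\<And>y z. coset F y \<in> S \<Longrightarrow> coset F z \<in> S \<Longrightarrow> coset F (y + z) \<in> S"
      "\<And>r z. r \<in> Inv \<Longrightarrow> coset F z \<in> S \<Longrightarrow> coset F (r * z) \<in> S"
    proof -
      show "S \<subseteq> coset F ` V t" using Q.submoduleE(1)[OF s] by (simp add: quot_simps)
      show "F \<in> S" using subgroup.one_closed[OF Module.submodule.axioms(1)[OF s]] by (simp add: quot_simps)
      show "coset F (y + z) \<in> S" if "coset F y \<in> S" "coset F z \<in> S" for y z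
        using Q.submoduleE(5)[OF s that] by (simp add: quot_add[OF F(1)])
      show "coset F (r * z) \<in> S" if "r \<in> Inv" "coset F z \<in> S" for r z
        using Q.submoduleE(4)[OF s _ that(2), of r] that(1) by (simp add: quot_smult[OF F(1)])
    qed
    define N where "N = {z \<in> V t. coset F z \<in> S}"
    have "stable N" unfolding stable_def
    proof (intro conjI ballI)
      show "0 \<in> N" using S(2) by (simp add: N_def coset_zero supported_zero)
    next
      fix y z assume "y \<in> N" "z \<in> N"
      then show "y + z \<in> N" using S(3) by (simp add: N_def supported_add)
    next
      fix r z assume "r \<in> Inv" "z \<in> N"
      then show "r * z \<in> N" using S(4) by (simp add: N_def Inv_V_mult)
    qed
    moreover have "F \<subseteq> N" using F(2) S(2) coset_eq_self_iff[OF F(1)] by (fastforce simp: N_def)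
    moreover have "S = coset F ` N" using S(1) by (auto simp: N_def)
    moreover have "N \<subseteq> V t" by (auto simp: N_def)
    ultimately show "\<exists>N. stable N \<and> F \<subseteq> N \<and> N \<subseteq> V t \<and> S = coset F ` N" by blast
  next
    assume "\<exists>N. stable N \<and> F \<subseteq> N \<and> N \<subseteq> V t \<and> S = coset F ` N"
    then obtain N where N: "stable N" "F \<subseteq> N" "N \<subseteq> V t" and S: "S = coset F ` N" by blast
    show "Module.submodule S R (quot_module (series_module (V t)) F)"
    proof (rule Q.submoduleI)
      show "\<zero>\<^bsub>quot_module (series_module (V t)) F\<^esub> \<in> S"
        using stableD(1)[OF N(1)] coset_zero[of F] by (auto simp: S quot_simps intro!: image_eqI[of _ _ 0])
      show "S \<subseteq> carrier (quot_module (series_module (V t)) F)" using N(3) by (auto simp: S quot_simps)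
    next
      fix x assume "x \<in> S"
      then obtain z where z: "x = coset F z" "z \<in> N" by (auto simp: S)
      then show "\<ominus>\<^bsub>quot_module (series_module (V t)) F\<^esub> x \<in> S"
        using neg[of z] N(3) stableD(4)[OF N(1)] by (auto simp: S)
      fix r assume "r \<in> carrier R"
      then show "r \<odot>\<^bsub>quot_module (series_module (V t)) F\<^esub> x \<in> S"
        using z quot_smult[OF F(1), of r "V t" z] stableD(3)[OF N(1)] by (auto simp: S)
    next
      fix x y assume "x \<in> S" "y \<in> S"
      then obtain z w where "x = coset F z" "z \<in> N" "y = coset F w" "w \<in> N" by (auto simp: S)
      then show "x \<oplus>\<^bsub>quot_module (series_module (V t)) F\<^esub> y \<in> S"
        using quot_add[OF F(1), of "V t" z w] stableD(2)[OF N(1)] by (auto simp: S)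
    qed
  qed
qed

lemma coset_image_subset_iff:
  assumes "stable F" "stable N" "F \<subseteq> N"
  shows "coset F ` M \<subseteq> coset F ` N \<longleftrightarrow> M \<subseteq> N"
proof
  assume h: "coset F ` M \<subseteq> coset F ` N"
  show "M \<subseteq> N"
  proof
    fix y assume "y \<in> M"
    then obtain z where "z \<in> N" "coset F y = coset F z" using h by blast
    then have "y - z \<in> N" "z \<in> N" using assms by (auto simp: coset_eq_iff)
    then show "y \<in> N" using stableD(2)[OF assms(2)] by fastforce
  qed
qed auto

definition upward :: "(nat \<times> nat) set \<Rightarrow> bool" where
  "upward E \<longleftrightarrow> (\<forall>p q i j. (p, q) \<in> expo 0 \<longrightarrow> (i, j) \<in> E \<longrightarrow> (p + i, q + j) \<in> E)"

lemma stable_upward: "upward E \<Longrightarrow> stable (supported E)"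
  by (rule stable_supported) (auto simp: upward_def)

text \<open>
  Adding a missing monomial of maximal degree keeps the set closed under multiplication by
  invariants, since all its proper multiples are already present.
\<close>

lemma upward_chain:
  assumes "upward E" "E \<subseteq> expo t" "finite (expo t - E)"
  shows "\<exists>C. C 0 = E \<and> (\<forall>i\<le>card (expo t - E). upward (C i) \<and> E \<subseteq> C i \<and> C i \<subseteq> expo t) \<and>
    (\<forall>i<card (expo t - E). C i \<subset> C (Suc i))"
  using assms
proof (induction "card (expo t - E)" arbitrary: E)
  case 0
  then show ?case by (intro exI[of _ "\<lambda>_. E"]) auto
next
  case (Suc c)
  let ?L = "expo t - E"
  have ne: "?L \<noteq> {}" using Suc(2) by (metis card.empty nat.distinct(1))
  define s where "s = (\<lambda>(i :: nat, j :: nat). i + j)"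
  have "Max (s ` ?L) \<in> s ` ?L" using ne Suc.prems(3) by (intro Max_in) auto
  then obtain z where z: "z \<in> ?L" "Max (s ` ?L) = s z" by (metis imageE)
  have zmax: "s w \<le> s z" if "w \<in> ?L" for w unfolding z(2)[symmetric] using Suc.prems(3) that by (intro Max_ge) auto
  define E' where "E' = insert z E"
  have up: "upward E'" unfolding upward_def
  proof (intro allI impI)
    fix p q i j assume h: "(p, q) \<in> expo 0" "(i, j) \<in> E'"
    show "(p + i, q + j) \<in> E'"
    proof (cases "(i, j) \<in> E \<or> (p, q) = (0, 0)")
      case True
      then show ?thesis using h Suc.prems(1) by (auto simp: E'_def upward_def)
    next
      case False
      then have e: "z = (i, j)" "p + q > 0" using h by (auto simp: E'_def)
      then have "s z < s (p + i, q + j)" by (simp add: s_def)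
      then have "(p + i, q + j) \<notin> ?L" using zmax[of "(p + i, q + j)"] by auto
      moreover have "(p + i, q + j) \<in> expo t" using expo_add0[OF h(1), of i j t] z e by auto
      ultimately show ?thesis by (simp add: E'_def)
    qed
  qed
  have L': "expo t - E' = ?L - {z}" by (auto simp: E'_def)
  then have c: "c = card (expo t - E')" using Suc(2) z Suc.prems(3) by (simp add: card_Diff_singleton)
  have "E' \<subseteq> expo t" "finite (expo t - E')" using Suc.prems z L' by (auto simp: E'_def)
  from Suc(1)[OF c up this] obtain C where C: "C 0 = E'"
    "\<And>i. i \<le> c \<Longrightarrow> upward (C i) \<and> E' \<subseteq> C i \<and> C i \<subseteq> expo t" "\<And>i. i < c \<Longrightarrow> C i \<subset> C (Suc i)"
    unfolding c by blast
  define C' where "C' = (\<lambda>i. case i of 0 \<Rightarrow> E | Suc i \<Rightarrow> C i)"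
  have "upward (C' i) \<and> E \<subseteq> C' i \<and> C' i \<subseteq> expo t" if "i \<le> Suc c" for i
    using that C(2) Suc.prems by (cases i) (auto simp: C'_def E'_def)
  moreover have "C' i \<subset> C' (Suc i)" if "i < Suc c" for i
    using that C(1,3) z by (cases i) (auto simp: C'_def E'_def)
  ultimately show ?case unfolding Suc(2)[symmetric] by (intro exI[of _ C']) (simp add: C'_def)
qed

text \<open>
  The length of a monomial quotient is the number of missing monomials: adding them one by one, by
  decreasing degree, gives a chain of submodules of that length, and a longer chain would produce
  more linearly independent vectors than there are coordinates.
\<close>

lemma length_monomial_quotient:
  assumes E: "upward E" "E \<subseteq> expo t" "finite (expo t - E)"
  shows "module_length R (quot_module (series_module (V t)) (supported E)) = enat (card (expo t - E))"
proof -
  let ?L = "expo t - E" and ?F = "supported E :: 'k fps fps set"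
  let ?Q = "quot_module (series_module (V t)) ?F"
  have F: "stable ?F" "?F \<subseteq> V t" using stable_upward[OF E(1)] supported_mono[OF E(2)] by auto
  have lower: "\<exists>S. (\<forall>i\<le>card ?L. Module.submodule (S i) R ?Q) \<and> (\<forall>i<card ?L. S i \<subset> S (Suc i))"
  proof -
    obtain C where C: "\<And>i. i \<le> card ?L \<Longrightarrow> upward (C i) \<and> E \<subseteq> C i \<and> C i \<subseteq> expo t"
      "\<And>i. i < card ?L \<Longrightarrow> C i \<subset> C (Suc i)" using upward_chain[OF E] by blast
    have "Module.submodule (coset ?F ` supported (C i)) R ?Q" if "i \<le> card ?L" for i
      unfolding quot_submodule_iff[OF F] using C(1)[OF that]
      by (intro exI[of _ "supported (C i)"] conjI refl stable_upward supported_mono) auto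
    moreover have "coset ?F ` supported (C i) \<subset> coset ?F ` supported (C (Suc i))" if i: "i < card ?L" for i
    proof -
      have c: "stable (supported (C i) :: 'k fps fps set)" "?F \<subseteq> supported (C i)"
        using C(1)[of i] i by (auto intro: stable_upward supported_mono[THEN subsetD])
      obtain p q where z: "(p, q) \<in> C (Suc i)" "(p, q) \<notin> C i" using C(2)[OF i] by auto
      have "var_x ^ p * var_y ^ q \<in> (supported (C (Suc i)) :: 'k fps fps set)" by (rule supported_monom[OF z(1)])
      moreover have "var_x ^ p * var_y ^ q \<notin> (supported (C i) :: 'k fps fps set)"
        using z(2) by (auto simp: supported_def cf_monom)
      ultimately have "\<not> coset ?F ` supported (C (Suc i)) \<subseteq> coset ?F ` supported (C i)"
        unfolding coset_image_subset_iff[OF F(1) c] by blast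
      moreover have "coset ?F ` supported (C i) \<subseteq> coset ?F ` supported (C (Suc i))"
        using C(2)[OF i] by (intro image_mono supported_mono) auto
      ultimately show ?thesis by blast
    qed
    ultimately show ?thesis by (intro exI[of _ "\<lambda>i. coset ?F ` supported (C i)"]) simp
  qed
  have upper: "k \<le> card ?L" if S: "\<forall>i\<le>k. Module.submodule (S i) R ?Q" "\<forall>i<k. S i \<subset> S (Suc i)" for k S
  proof (rule ccontr)
    assume k: "\<not> k \<le> card ?L"
    define N where "N = (\<lambda>i. SOME N. stable N \<and> ?F \<subseteq> N \<and> N \<subseteq> V t \<and> S i = coset ?F ` N)"
    have N: "stable (N i) \<and> ?F \<subseteq> N i \<and> N i \<subseteq> V t \<and> S i = coset ?F ` N i" if "i \<le> k" for i
    proof -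
      have "Module.submodule (S i) R ?Q" using S(1) that by simp
      then show ?thesis unfolding quot_submodule_iff[OF F] N_def by (rule someI_ex)
    qed
    have Nlt: "N i \<subseteq> N (Suc i) \<and> \<not> N (Suc i) \<subseteq> N i" if "i < k" for i
    proof -
      have "stable (N i)" "?F \<subseteq> N i" "S i = coset ?F ` N i" using N[of i] that by auto
      moreover have "stable (N (Suc i))" "?F \<subseteq> N (Suc i)" "S (Suc i) = coset ?F ` N (Suc i)"
        using N[of "Suc i"] that by auto
      moreover have "S i \<subseteq> S (Suc i)" "\<not> S (Suc i) \<subseteq> S i" using S(2) that by auto
      ultimately show ?thesis by (simp add: coset_image_subset_iff[OF F(1)])
    qed
    have Nmono: "N i \<subseteq> N j" if "i \<le> j" "j \<le> k" for i j
      using that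
    proof (induction j)
      case (Suc j)
      then show ?case using Nlt[of j] by (cases "i = Suc j") auto
    qed auto
    have "\<forall>i. \<exists>d. i < k \<longrightarrow> d \<in> N (Suc i) \<and> d \<notin> N i" using Nlt by blast
    then obtain d where d: "\<And>i. i < k \<Longrightarrow> d i \<in> N (Suc i) \<and> d i \<notin> N i" by metis
    obtain c where c: "\<exists>i\<in>{..<k}. c i \<noteq> 0" "\<And>z. z \<in> ?L \<Longrightarrow> (\<Sum>i<k. c i * cf (d i) (fst z) (snd z)) = 0"
      using linear_dependence[OF E(3), of "{..<k}" "\<lambda>i z. cf (d i) (fst z) (snd z)"] k by auto
    define y where "y = (\<Sum>i<k. const_xy (c i) * d i)"
    have dV: "d i \<in> V t" if "i < k" for i using d[OF that] N[of "Suc i"] that by auto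
    have "y \<in> V t" unfolding y_def using dV by (intro stable_sum[OF stable_V] stable_const[OF stable_V]) auto
    moreover have "cf y i j = 0" if "(i, j) \<in> ?L" for i j
      using c(2)[OF that] by (simp add: y_def cf_sum cf_const_mult)
    ultimately have yF: "y \<in> ?F" by (auto simp: supported_def)
    \<comment> \<open>the last vector with a nonzero coefficient would lie in the preceding submodule\<close>
    define i where "i = Max {i. i < k \<and> c i \<noteq> 0}"
    have fin: "finite {i. i < k \<and> c i \<noteq> 0}" "{i. i < k \<and> c i \<noteq> 0} \<noteq> {}" using c(1) by auto
    have i: "i < k" "c i \<noteq> 0" using Max_in[OF fin] by (auto simp: i_def)
    have top: "c j = 0" if "i < j" "j < k" for j using Max_ge[OF fin(1), of j] that by (auto simp: i_def[symmetric])
    have Ni: "stable (N i)" "?F \<subseteq> N i" using N[of i] i by auto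
    have "y = (\<Sum>j\<le>i. const_xy (c j) * d j)" unfolding y_def
      using i top by (intro sum.mono_neutral_right) (auto simp: const_xy_def)
    also have "\<dots> = (\<Sum>j<i. const_xy (c j) * d j) + const_xy (c i) * d i"
      by (simp add: lessThan_Suc_atMost[symmetric])
    finally have "const_xy (c i) * d i = y - (\<Sum>j<i. const_xy (c j) * d j)" by simp
    moreover have "(\<Sum>j<i. const_xy (c j) * d j) \<in> N i"
    proof (intro stable_sum[OF Ni(1)] stable_const[OF Ni(1)])
      fix j assume "j \<in> {..<i}"
      then show "d j \<in> N i" using d[of j] Nmono[of "Suc j" i] i by auto
    qed
    ultimately have "const_xy (c i) * d i \<in> N i" using stableD(5)[OF Ni(1), of y] yF Ni(2) by auto
    then have "const_xy (inverse (c i)) * (const_xy (c i) * d i) \<in> N i" by (rule stable_const[OF Ni(1)])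
    moreover have "const_xy (inverse (c i)) * (const_xy (c i) * d i) = d i"
      using i(2) by (intro cf_eqI) (simp add: cf_const_mult)
    ultimately show False using d[OF i(1)] by simp
  qed
  show ?thesis unfolding module_length_def
  proof (rule antisym)
    show "Sup {enat k | k. \<exists>C. (\<forall>i\<le>k. Module.submodule (C i) R ?Q) \<and> (\<forall>i<k. C i \<subset> C (Suc i))} \<le> enat (card ?L)"
      using upper by (intro Sup_least) auto
    show "enat (card ?L) \<le> Sup {enat k | k. \<exists>C. (\<forall>i\<le>k. Module.submodule (C i) R ?Q) \<and> (\<forall>i<k. C i \<subset> C (Suc i))}"
      using lower by (intro Sup_upper) blast
  qed
qed

text \<open>
  The cosets of the minimal monomials form a basis of \<open>M\<^sub>t/\<mm>M\<^sub>t\<close>: membership in \<open>\<mm>M\<^sub>t\<close> means that the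
  coefficients at these monomials vanish.
\<close>

lemma num_gens_eq:
  assumes fin: "finite (gens t)"
  shows "num_gens const_xy R (series_module (V t)) = card (gens t)"
proof -
  define F :: "'k fps fps set" where "F = supported (power_expo t 1)"
  have F: "stable F" "F \<subseteq> V t" unfolding F_def by (rule stable_power_expo supported_mono[OF power_expo_subset])+
  have FI: "f \<in> F" if "f \<in> V t" "\<And>i j. (i, j) \<in> gens t \<Longrightarrow> cf f i j = 0" for f
    using that unfolding F_def gens_def supported_def by blast
  have FD: "cf f i j = 0" if "f \<in> F" "(i, j) \<in> gens t" for f i j
    using that unfolding F_def gens_def supported_def by blast
  let ?K = "ring_of_type_algebra :: 'k ring"
  let ?M = "quot_module (series_module (V t)) F"
  let ?Q = "restrict_scalars const_xy ?M"
  have K: "carrier ?K = UNIV" "zero ?K = 0" "one ?K = 1" "add ?K = (+)" "monoid.mult ?K = (*)"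
    by (simp_all add: ring_of_type_algebra_def)
  interpret M: Module.module R ?M by (rule quot_module_module[OF stable_V F])
  have Qs: "carrier ?Q = coset F ` V t" "zero ?Q = F" "add ?Q = add ?M"
    "module.smult ?Q c (coset F z) = coset F (const_xy c * z)" for c z
    by (simp_all add: restrict_scalars_def quot_simps quot_smult[OF F(1) const_Inv])
  have Qadd: "add ?Q (coset F y) (coset F z) = coset F (y + z)" for y z
    by (simp add: Qs quot_add[OF F(1)])
  have field: "Ring.field ?K" by (rule field_from_type_algebra)
  then have cr: "cring ?K" by (simp add: Ring.field.axioms domain.axioms)
  have const: "const_xy (c + d) = (const_xy c + const_xy d :: 'k fps fps)" "const_xy (c * d) = (const_xy c * const_xy d :: 'k fps fps)"
    "const_xy 1 = (1 :: 'k fps fps)" for c d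
    by (simp_all add: const_xy_def)
  have "Module.module ?K ?Q"
  proof (rule Module.moduleI[OF cr])
    show "abelian_group ?Q"
    proof (rule abelian_groupI)
      fix x assume "x \<in> carrier ?Q"
      then obtain z where z: "x = coset F z" "z \<in> V t" by (auto simp: Qs)
      have "add ?Q (coset F 0) x = coset F z" unfolding z Qadd by simp
      then show "\<zero>\<^bsub>?Q\<^esub> \<oplus>\<^bsub>?Q\<^esub> x = x" by (simp add: z coset_zero Qs(2))
      have "add ?Q (coset F (- z)) x = \<zero>\<^bsub>?Q\<^esub>" unfolding z Qadd by (simp add: coset_zero Qs(2))
      then show "\<exists>y\<in>carrier ?Q. y \<oplus>\<^bsub>?Q\<^esub> x = \<zero>\<^bsub>?Q\<^esub>" using supported_minus[OF z(2)] by (auto simp: Qs(1))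
    next
      show "\<zero>\<^bsub>?Q\<^esub> \<in> carrier ?Q" using coset_zero[of F] supported_zero by (auto simp: Qs intro!: image_eqI[of _ _ 0])
    qed (auto simp: Qs(1) Qadd ac_simps supported_add)
  qed (auto simp: Qs(1,4) Qadd K const distrib_left distrib_right mult.assoc intro!: imageI stable_const[OF stable_V])
  then interpret Q: vectorspace ?K ?Q using field by (intro vectorspace.intro)
  define b where "b = (\<lambda>(i, j). coset F (var_x ^ i * var_y ^ j))"
  have genV: "var_x ^ i * var_y ^ j \<in> V t" if "(i, j) \<in> gens t" for i j
    using that by (intro supported_monom) (simp add: gens_def)
  define poly where "poly = (\<lambda>h. \<Sum>(i, j)\<in>gens t. const_xy (h (i, j)) * (var_x ^ i * var_y ^ j) :: 'k fps fps)"
  have cf_poly: "cf (poly h) p q = (if (p, q) \<in> gens t then h (p, q) else 0)" for h p q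
  proof -
    have "cf (poly h) p q = (\<Sum>z\<in>gens t. if z = (p, q) then h (p, q) else 0)"
      unfolding poly_def cf_sum by (intro sum.cong refl) (auto simp: cf_const_mult cf_monom split: if_splits)
    then show ?thesis using fin by (simp add: sum.delta)
  qed
  have inj: "inj_on b (gens t)"
  proof (rule inj_onI, unfold split_paired_all)
    fix i j p q assume h: "(i, j) \<in> gens t" "(p, q) \<in> gens t" "b (i, j) = b (p, q)"
    then have "var_x ^ i * var_y ^ j - var_x ^ p * var_y ^ q \<in> F"
      by (simp add: b_def coset_eq_iff[OF F(1)])
    then have "cf (var_x ^ i * var_y ^ j - var_x ^ p * var_y ^ q :: 'k fps fps) i j = 0" by (rule FD[OF _ h(1)])
    then show "(i, j) = (p, q)" by (simp add: cf_monom split: if_splits)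
  qed
  have comb: "Q.lincomb g (b ` gens t) = coset F (poly (\<lambda>z. g (b z)))" for g
  proof -
    have "Q.lincomb g (b ` A) = coset F (\<Sum>(i, j)\<in>A. const_xy (g (b (i, j))) * (var_x ^ i * var_y ^ j))"
      if "finite A" "A \<subseteq> gens t" for A
      using that
    proof (induction A rule: finite_induct)
      case empty
      show ?case by (simp add: Q.lincomb_def coset_zero Qs(2))
    next
      case (insert z A)
      obtain i j where z: "z = (i, j)" by force
      have bc: "b w \<in> carrier ?Q" if "w \<in> gens t" for w using genV that by (cases w) (auto simp: b_def Qs(1))
      have nin: "b z \<notin> b ` A" using insert inj by (auto simp: inj_on_def)
      have "Q.lincomb g (b ` insert z A) = add ?Q (g (b z) \<odot>\<^bsub>?Q\<^esub> b z) (Q.lincomb g (b ` A))"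
        unfolding Q.lincomb_def image_insert
        using insert nin bc by (subst Q.M.finsum_insert) (auto simp: K intro!: Q.smult_closed)
      also have "\<dots> = add ?Q (coset F (const_xy (g (b z)) * (var_x ^ i * var_y ^ j)))
          (coset F (\<Sum>(i, j)\<in>A. const_xy (g (b (i, j))) * (var_x ^ i * var_y ^ j)))"
        using insert by (simp add: z b_def Qs(4))
      finally show ?case unfolding Qadd using insert by (simp add: z)
    qed
    from this[OF fin order_refl] show ?thesis by (simp add: poly_def)
  qed
  have sub: "b ` gens t \<subseteq> carrier ?Q" using genV by (auto simp: b_def Qs(1))
  have li: "Q.lin_indpt (b ` gens t)"
  proof
    assume "Q.lin_dep (b ` gens t)"
    then obtain g v where g: "Q.lincomb g (b ` gens t) = \<zero>\<^bsub>?Q\<^esub>" "v \<in> b ` gens t" "g v \<noteq> 0"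
      using Q.finite_lin_dep[of "b ` gens t"] fin sub by (auto simp: K)
    then obtain i j where ij: "(i, j) \<in> gens t" "v = b (i, j)" by auto
    have "poly (\<lambda>z. g (b z)) \<in> F" using g(1) unfolding comb Qs(2) by (simp only: coset_eq_self_iff[OF F(1)])
    then have "cf (poly (\<lambda>z. g (b z))) i j = 0" by (rule FD[OF _ ij(1)])
    then show False using ij g(3) by (simp add: cf_poly)
  qed
  have gen: "Q.gen_set (b ` gens t)"
  proof
    show "Q.span (b ` gens t) \<subseteq> carrier ?Q" by (rule Q.span_is_subset2[OF sub])
    show "carrier ?Q \<subseteq> Q.span (b ` gens t)"
    proof
      fix x assume "x \<in> carrier ?Q"
      then obtain f where f: "x = coset F f" "f \<in> V t" by (auto simp: Qs(1))
      define g where "g = (\<lambda>v. case inv_into (gens t) b v of (i, j) \<Rightarrow> cf f i j)"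
      have gb: "g (b (i, j)) = cf f i j" if "(i, j) \<in> gens t" for i j
        using inv_into_f_f[OF inj that] by (simp add: g_def)
      have "poly (\<lambda>z. g (b z)) \<in> V t" unfolding poly_def
        using genV by (intro stable_sum[OF stable_V]) (auto intro!: stable_const[OF stable_V])
      then have "f - poly (\<lambda>z. g (b z)) \<in> F"
        using gb by (intro FI supported_diff f) (auto simp: cf_poly)
      then have "x = Q.lincomb g (b ` gens t)" unfolding comb f(1) by (simp only: coset_eq_iff[OF F(1)])
      then show "x \<in> Q.span (b ` gens t)" unfolding Q.finite_span[OF finite_imageI[OF fin] sub] by (auto simp: K)
    qed
  qed
  have "Q.dim = card (b ` gens t)" using li gen sub fin by (intro Q.dim_basis) (auto simp: Q.basis_def)
  then show ?thesis unfolding num_gens_def max_ideal_eq m_ideal_smult F_def[symmetric] by (simp add: card_image[OF inj])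
qed

end

section \<open>Setting x to zero\<close>

definition setx :: "'k::field fps fps \<Rightarrow> 'k fps" where
  "setx f = Abs_fps (\<lambda>j. cf f 0 j)"

lemma setx_simps [simp]:
  "setx (f + g) = setx f + setx g" "setx (f - g) = setx f - setx g" "setx 0 = 0"
  by (simp_all add: setx_def fps_eq_iff)

lemma setx_mult [simp]: "setx (f * g) = setx f * setx g"
  by (simp add: setx_def fps_eq_iff cf_mult fps_mult_nth atLeast0AtMost)

lemma setx_one [simp]: "setx 1 = 1"
  by (auto simp: setx_def fps_eq_iff cf_one)

lemma setx_power [simp]: "setx (f ^ m) = setx f ^ m"
  by (induction m) simp_all

lemma setx_var_x [simp]: "setx var_x = 0"
  by (simp add: setx_def fps_eq_iff cf_def var_x_def)

lemma setx_var_y [simp]: "setx var_y = fps_X"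
  by (simp add: setx_def fps_eq_iff cf_def var_y_def)

lemma var_x_nonzero [simp]: "var_x \<noteq> (0 :: 'k::field fps fps)"
  by (simp add: var_x_def)

lemma var_y_nonzero [simp]: "var_y \<noteq> (0 :: 'k::field fps fps)"
  by (simp add: var_y_def)

lemma setx_eq_0_obtain:
  assumes "setx f = 0"
  obtains g where "f = var_x * g" "\<And>i j. cf g i j = cf f (Suc i) j"
proof -
  define g where "g = Abs_fps (\<lambda>j. Abs_fps (\<lambda>i. cf f (Suc i) j))"
  have cg: "cf g i j = cf f (Suc i) j" for i j by (simp add: g_def)
  have "cf f 0 j = 0" for j using assms by (simp add: setx_def fps_eq_iff)
  then have "f = var_x * g" using cf_monom_mult[of 1 0 g]
    by (intro cf_eqI) (auto simp: cg not_le split: if_splits)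
  then show ?thesis using that cg by blast
qed

text \<open>
  Setting \<open>x\<close> to 0 is a homomorphism to a domain whose kernel is generated by \<open>x\<close>. So \<open>x\<close> is prime, and
  its powers can be split off one factor at a time.
\<close>

lemma var_x_power_cancel:
  assumes "setx w \<noteq> 0" "w * z = var_x ^ k * z'"
  shows "\<exists>z''. z = var_x ^ k * z''"
  using assms(2)
proof (induction k arbitrary: z)
  case (Suc k)
  have "setx (w * z) = 0" unfolding Suc.prems by simp
  then have "setx z = 0" using assms(1) by simp
  then obtain y where y: "z = var_x * y" by (rule setx_eq_0_obtain)
  have "var_x * (w * y) = var_x * (var_x ^ k * z')" using Suc.prems by (simp add: y ac_simps)
  then have "w * y = var_x ^ k * z'" by simp
  then obtain z'' where "y = var_x ^ k * z''" using Suc.IH by blast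
  then show ?case using y by (auto simp: ac_simps)
qed simp

section \<open>Depth\<close>

context cyclic_sing
begin

lemma V_cong: "[s = t] (mod int n) \<Longrightarrow> V s = V t"
  by (simp add: expo_cong)

lemma var_x_power_V: "var_x ^ i \<in> V (int i)"
  using supported_monom[of i 0 "expo (int i)"] by (simp add: expo_iff)

lemma var_y_power_V: "var_y ^ j \<in> V (int j * int a)"
  using supported_monom[of 0 j "expo (int j * int a)"] by (simp add: expo_iff)

lemma axes_m_ideal: "var_x ^ n \<in> m_ideal" "var_y ^ n \<in> m_ideal"
  using supported_monom[OF expo_axes(1)] supported_monom[OF expo_axes(2)] by (auto simp: m_ideal_def)

lemma m_ideal_subset: "m_ideal \<subseteq> Inv"
  by (auto simp: m_ideal_iff)

lemma axes_Inv: "var_x ^ n \<in> Inv" "var_y ^ n \<in> Inv"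
  using axes_m_ideal m_ideal_subset by auto

lemma V_cancel_var_x:
  assumes "var_x * g \<in> V t"
  shows "g \<in> V (t - 1)"
proof (rule supportedI)
  fix i j assume n: "(i, j) \<notin> expo (t - 1)"
  have "[int i + int j * int a = t - 1] (mod int n) \<longleftrightarrow> [int (Suc i) + int j * int a = t] (mod int n)"
    by (simp add: cong_iff_dvd_diff algebra_simps)
  then have "(Suc i, j) \<notin> expo t" using n by (simp add: expo_iff)
  then have "cf (var_x * g) (Suc i) j = 0" using assms by (simp add: supportedD)
  then show "cf g i j = 0" using cf_monom_mult[of 1 0 g "Suc i" j] by simp
qed

lemma V_cancel_var_x_power: "var_x ^ k * g \<in> V t \<Longrightarrow> g \<in> V (t - int k)"
proof (induction k arbitrary: t)
  case (Suc k)
  have "var_x ^ k * g \<in> V (t - 1)" using Suc.prems by (intro V_cancel_var_x) (simp add: mult.assoc)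
  from Suc.IH[OF this] show ?case by (simp add: algebra_simps)
qed simp

lemma V_subtract_n: "V (t - int n) = V t"
  by (rule V_cong) (simp add: cong_iff_dvd_diff)

context
  fixes t :: int
begin

abbreviation "multiples f \<equiv> (*) f ` V t"

definition nonzerodivisor_mod :: "'k fps fps set \<Rightarrow> 'k fps fps \<Rightarrow> bool" where
  "nonzerodivisor_mod N g \<longleftrightarrow> (\<forall>z\<in>V t. g * z \<in> N \<longrightarrow> z \<in> N)"

text \<open>
  A nonzero element of \<open>M\<^sub>t/N\<close> annihilated by \<open>\<mm>\<close>. No element of \<open>\<mm>\<close> is then a nonzerodivisor on
  \<open>M\<^sub>t/N\<close>.
\<close>

definition has_socle :: "'k fps fps set \<Rightarrow> bool" where
  "has_socle N \<longleftrightarrow> (\<exists>z\<in>V t. z \<notin> N \<and> (\<forall>r\<in>m_ideal. r * z \<in> N))"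

lemma stable_multiples: "stable (multiples f)"
  by (rule stable_image[OF stable_V])

lemma plus_set_commute: "plus_set M N = plus_set N M"
  unfolding plus_set_def by (auto; metis add.commute)

lemma mem_plus_multiples: "z \<in> plus_set N (multiples g) \<longleftrightarrow> (\<exists>w\<in>V t. z - g * w \<in> N)"
proof
  assume "z \<in> plus_set N (multiples g)"
  then obtain y w where "z = y + g * w" "y \<in> N" "w \<in> V t" by (auto simp: plus_set_def)
  then show "\<exists>w\<in>V t. z - g * w \<in> N" by (intro bexI[of _ w]) auto
next
  assume "\<exists>w\<in>V t. z - g * w \<in> N"
  then obtain w where "w \<in> V t" "z - g * w \<in> N" by blast
  moreover have "z = (z - g * w) + g * w" by simp
  ultimately show "z \<in> plus_set N (multiples g)" unfolding plus_set_def by blast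
qed

text \<open>
  Whether the quotient by a regular sequence has a socle does not depend on the last element of the
  sequence: multiplication by \<open>g'\<close> followed by division by \<open>g\<close> carries one socle to the other.
\<close>

lemma socle_exchange:
  assumes N: "stable N" and g: "nonzerodivisor_mod N g" "g \<in> Inv"
    and g': "nonzerodivisor_mod N g'" "g' \<in> m_ideal"
    and soc: "has_socle (plus_set N (multiples g))"
  shows "has_socle (plus_set N (multiples g'))"
proof -
  have g'I: "g' \<in> Inv" using g'(2) m_ideal_subset by auto
  obtain z where z: "z \<in> V t" "z \<notin> plus_set N (multiples g)"
    "\<And>r. r \<in> m_ideal \<Longrightarrow> r * z \<in> plus_set N (multiples g)" using soc by (auto simp: has_socle_def)
  obtain z' where z': "z' \<in> V t" "g' * z - g * z' \<in> N" using z(3)[OF g'(2)] by (auto simp: mem_plus_multiples)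
  have "z' \<notin> plus_set N (multiples g')"
  proof
    assume "z' \<in> plus_set N (multiples g')"
    then obtain w where w: "w \<in> V t" "z' - g' * w \<in> N" by (auto simp: mem_plus_multiples)
    have "(g' * z - g * z') + g * (z' - g' * w) \<in> N"
      using stableD(2)[OF N z'(2) stableD(3)[OF N g(2) w(2)]] .
    then have "g' * (z - g * w) \<in> N" by (simp add: algebra_simps)
    moreover have "z - g * w \<in> V t" using z w g by (intro supported_diff Inv_V_mult)
    ultimately have "z - g * w \<in> N" using g'(1) by (simp add: nonzerodivisor_mod_def)
    then show False using z(2) w by (auto simp: mem_plus_multiples)
  qed
  moreover have "r * z' \<in> plus_set N (multiples g')" if r: "r \<in> m_ideal" for r
  proof -
    have rI: "r \<in> Inv" using r m_ideal_subset by auto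
    obtain w where w: "w \<in> V t" "r * z - g * w \<in> N" using z(3)[OF r] by (auto simp: mem_plus_multiples)
    have "g' * (r * z - g * w) - r * (g' * z - g * z') \<in> N"
      using stableD(5)[OF N stableD(3)[OF N g'I w(2)] stableD(3)[OF N rI z'(2)]] .
    then have "g * (r * z' - g' * w) \<in> N" by (simp add: algebra_simps)
    moreover have "r * z' - g' * w \<in> V t" using z' w rI g'I by (intro supported_diff Inv_V_mult)
    ultimately have "r * z' - g' * w \<in> N" using g(1) by (simp add: nonzerodivisor_mod_def)
    then show ?thesis using w by (auto simp: mem_plus_multiples)
  qed
  ultimately show ?thesis using z' by (auto simp: has_socle_def)
qed

text \<open>
  Regular sequences of length two may be permuted.
\<close>

lemma nonzerodivisor_swap:
  assumes "nonzerodivisor_mod (multiples f) g" "f \<noteq> 0"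
  shows "nonzerodivisor_mod (multiples g) f"
  unfolding nonzerodivisor_mod_def
proof (intro ballI impI)
  fix z assume z: "z \<in> V t" "f * z \<in> multiples g"
  then obtain z' where z': "z' \<in> V t" "f * z = g * z'" by auto
  then have "g * z' \<in> multiples f" using z by (metis imageI)
  then obtain z'' where z'': "z'' \<in> V t" "z' = f * z''" using assms(1) z'(1) by (auto simp: nonzerodivisor_mod_def)
  then have "f * z = f * (g * z'')" using z' by (simp add: ac_simps)
  then have "z = g * z''" using assms(2) by simp
  then show "z \<in> multiples g" using z'' by blast
qed

lemma nonzerodivisor_mod_var_x:
  assumes "setx w \<noteq> 0"
  shows "nonzerodivisor_mod (multiples (var_x ^ n)) w"
  unfolding nonzerodivisor_mod_def
proof (intro ballI impI)
  fix z assume z: "z \<in> V t" "w * z \<in> multiples (var_x ^ n)"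
  then obtain z' where "w * z = var_x ^ n * z'" by auto
  from var_x_power_cancel[OF assms this] obtain z'' where z'': "z = var_x ^ n * z''" by blast
  then have "z'' \<in> V t" using V_cancel_var_x_power[of n z'' t] z(1) V_subtract_n by simp
  then show "z \<in> multiples (var_x ^ n)" using z'' by blast
qed

lemma ex_var_y_power: "\<exists>k. var_y ^ k \<in> V s"
proof -
  have "coprime (int a) (int n)" using coprime_an by (simp add: coprime_iff_gcd_eq_1)
  then obtain b where b: "[int a * b = 1] (mod int n)" using cong_solve_coprime_int by blast
  define k where "k = nat ((b * s) mod int n)"
  have "int k = (b * s) mod int n" using n_gt_1 by (simp add: k_def)
  then have "[int k = b * s] (mod int n)" by (simp add: cong_def)
  then have "[int k * int a = (b * s) * int a] (mod int n)" by (rule cong_scalar_right)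
  also have "(b * s) * int a = (int a * b) * s" by simp
  also have "[(int a * b) * s = 1 * s] (mod int n)" by (rule cong_scalar_right[OF b])
  finally have "V (int k * int a) = V s" by (intro V_cong) simp
  then show ?thesis using var_y_power_V[of k] by auto
qed

lemma V_nonzero: "\<exists>z\<in>V t. z \<noteq> 0"
  using ex_var_y_power[of t] by (auto intro: bexI[of _ "var_y ^ _"])

text \<open>
  If \<open>f = x f\<^sub>1\<close> and \<open>g = x g\<^sub>1\<close>, then \<open>g f\<^sub>1 = f g\<^sub>1\<close>. A power of \<open>y\<close> corrects the weights of \<open>f\<^sub>1\<close> and
  \<open>g\<^sub>1\<close> and turns this into a relation in \<open>M\<^sub>t\<close>.
\<close>

lemma regular_pair_not_both_divisible:
  assumes f: "f \<in> Inv" "f \<noteq> 0" and g: "g \<in> Inv" and reg: "nonzerodivisor_mod (multiples f) g"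
  shows "setx f \<noteq> 0 \<or> setx g \<noteq> 0"
proof (rule ccontr)
  assume "\<not> ?thesis"
  then have "setx f = 0" "setx g = 0" by auto
  then obtain f1 g1 where fg1: "f = var_x * f1" "g = var_x * g1" by (metis setx_eq_0_obtain)
  have V1: "f1 \<in> V (- 1)" "g1 \<in> V (- 1)" using V_cancel_var_x[of f1 0] V_cancel_var_x[of g1 0] f g fg1 by auto
  obtain k where k: "var_y ^ k \<in> V (t + 1)" using ex_var_y_power by blast
  have z: "f1 * var_y ^ k \<in> V t" "g1 * var_y ^ k \<in> V t" using V_mult[OF V1(1) k] V_mult[OF V1(2) k] by auto
  have "g * (f1 * var_y ^ k) = f * (g1 * var_y ^ k)" by (simp add: fg1 ac_simps)
  then have "g * (f1 * var_y ^ k) \<in> multiples f" using z(2) by blast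
  then have "f1 * var_y ^ k \<in> multiples f" using reg z(1) by (simp add: nonzerodivisor_mod_def)
  then obtain h where "f1 * var_y ^ k = f * h" by blast
  then have "f1 * var_y ^ k = f1 * (var_x * h)" unfolding fg1(1) by (simp only: ac_simps)
  then have "var_y ^ k = var_x * h" using f fg1 by auto
  then have "setx (var_y ^ k) = setx (var_x * h)" by (rule arg_cong)
  then show False by simp
qed

text \<open>
  Modulo \<open>x\<^sup>n\<close> and \<open>y\<^sup>n\<close> finitely many monomials remain, and one of maximal degree spans part of the
  socle.
\<close>

lemma socle_axes: "has_socle (plus_set (multiples (var_x ^ n)) (multiples (var_y ^ n)))"
proof -
  define s where "s = (\<lambda>(i :: nat, j :: nat). i + j)"
  have "(nat (t mod int n), 0) \<in> small_expo t"
    using n_gt_1 by (auto simp: small_expo_def expo_iff nat_less_iff)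
  then have ne: "s ` small_expo t \<noteq> {}" by auto
  have fin: "finite (s ` small_expo t)" using finite_small_expo by auto
  have "Max (s ` small_expo t) \<in> s ` small_expo t" using fin ne by (rule Max_in)
  then obtain i j where ij: "(i, j) \<in> small_expo t" "Max (s ` small_expo t) = i + j" by (auto simp: s_def)
  have maximal: "p + q \<le> i + j" if "(p, q) \<in> small_expo t" for p q
    using Max_ge[OF fin, of "p + q"] that ij(2) by (force simp: s_def)
  have z: "var_x ^ i * var_y ^ j \<in> V t" using ij by (intro supported_monom) (simp add: small_expo_def)
  have vanish: "cf h i j = 0" if hP: "h \<in> plus_set (multiples (var_x ^ n)) (multiples (var_y ^ n))" for h
  proof -
    obtain u v where "h = var_x ^ n * u + var_y ^ n * v" using hP unfolding plus_set_def by blast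
    then show ?thesis using ij cf_monom_mult[of n 0 u i j] cf_monom_mult[of 0 n v i j]
      by (simp add: small_expo_def)
  qed
  have notin: "var_x ^ i * var_y ^ j \<notin> plus_set (multiples (var_x ^ n)) (multiples (var_y ^ n))"
  proof
    assume "var_x ^ i * var_y ^ j \<in> plus_set (multiples (var_x ^ n)) (multiples (var_y ^ n))"
    then have "cf (var_x ^ i * var_y ^ j :: 'k fps fps) i j = 0" by (rule vanish)
    then show False by (simp add: cf_monom)
  qed
  have "r * (var_x ^ i * var_y ^ j) \<in> plus_set (multiples (var_x ^ n)) (multiples (var_y ^ n))"
    if r: "r \<in> m_ideal" for r
  proof -
    define h where "h = var_x ^ i * var_y ^ j * r"
    have hV: "h \<in> V t" unfolding h_def using Inv_V_mult[of r _ t] r m_ideal_subset z by (subst mult.commute) auto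
    have small: "cf h p q = 0" if "p < n" "q < n" for p q
    proof (rule ccontr)
      assume h0: "cf h p q \<noteq> 0"
      then have "(p, q) \<in> expo t" using hV by (auto simp: supported_def)
      then have "p + q \<le> i + j" using that by (intro maximal) (simp add: small_expo_def)
      moreover have "i \<le> p" "j \<le> q" "cf r (p - i) (q - j) \<noteq> 0"
        using h0 unfolding h_def cf_monom_mult by (auto split: if_splits)
      ultimately have "cf r 0 0 \<noteq> 0" by simp
      then show False using r by (simp add: m_ideal_iff)
    qed
    obtain u v where uv: "u \<in> V t" "v \<in> V t" and he: "h = (\<Sum>(p, q)\<in>{..<n * 1} \<times> {..<n * 1}. const_xy (cf h p q) * (var_x ^ p * var_y ^ q))
        + var_x ^ (n * 1) * u + var_y ^ (n * 1) * v" using split_tails[OF hV, of 1] by blast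
    have "(\<Sum>(p, q)\<in>{..<n * 1} \<times> {..<n * 1}. const_xy (cf h p q) * (var_x ^ p * var_y ^ q)) = 0"
      using small by (intro sum.neutral) (auto simp: const_xy_def)
    then have "h = var_x ^ n * u + var_y ^ n * v" using he by simp
    then have "h \<in> plus_set (multiples (var_x ^ n)) (multiples (var_y ^ n))" using uv by (auto simp: plus_set_def)
    then show ?thesis by (simp add: h_def mult.commute)
  qed
  then show ?thesis using z notin by (auto simp: has_socle_def)
qed

text \<open>
  Every regular sequence of length two can be reached from \<open>(x\<^sup>n, y\<^sup>n)\<close> by exchanging one element at a
  time, through an element \<open>w\<close> that is regular modulo both \<open>f\<close> and \<open>x\<^sup>n\<close>.
\<close>

lemma regular_pair_socle:
  assumes f: "f \<in> m_ideal" "f \<noteq> 0" and g: "g \<in> m_ideal" and reg: "nonzerodivisor_mod (multiples f) g"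
  shows "has_socle (plus_set (multiples f) (multiples g))"
proof -
  have fgI: "f \<in> Inv" "g \<in> Inv" using f g m_ideal_subset by auto
  \<comment> \<open>as \<open>x\<close> does not divide both \<open>f\<close> and \<open>g\<close>, it does not divide \<open>g\<close> or it does not divide \<open>f + g\<close>\<close>
  have "\<exists>w\<in>m_ideal. setx w \<noteq> 0 \<and> nonzerodivisor_mod (multiples f) w"
  proof (cases "setx g = 0")
    case True
    then have "setx f \<noteq> 0" using regular_pair_not_both_divisible[OF fgI(1) f(2) fgI(2) reg] by simp
    moreover have "nonzerodivisor_mod (multiples f) (f + g)" unfolding nonzerodivisor_mod_def
    proof (intro ballI impI)
      fix z assume z: "z \<in> V t" "(f + g) * z \<in> multiples f"
      have "f * z \<in> multiples f" using z by blast
      from stableD(5)[OF stable_multiples z(2) this] have "g * z \<in> multiples f" by (simp add: algebra_simps)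
      then show "z \<in> multiples f" using reg z by (simp add: nonzerodivisor_mod_def)
    qed
    ultimately show ?thesis using True stableD(2)[OF stable_m_ideal f(1) g] by (intro bexI[of _ "f + g"]) auto
  qed (use g reg in auto)
  then obtain w where w: "w \<in> m_ideal" "setx w \<noteq> 0" "nonzerodivisor_mod (multiples f) w" by blast
  have wI: "w \<in> Inv" using w m_ideal_subset by auto
  have x0: "var_x ^ n \<noteq> (0 :: 'k fps fps)" by simp
  have "has_socle (plus_set (multiples (var_x ^ n)) (multiples w))"
    by (rule socle_exchange[OF stable_multiples nonzerodivisor_mod_var_x axes_Inv(2)
          nonzerodivisor_mod_var_x[OF w(2)] w(1) socle_axes]) simp
  then have "has_socle (plus_set (multiples w) (multiples (var_x ^ n)))" by (simp only: plus_set_commute)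
  then have "has_socle (plus_set (multiples w) (multiples f))"
    by (rule socle_exchange[OF stable_multiples
          nonzerodivisor_swap[OF nonzerodivisor_mod_var_x[OF w(2)] x0] axes_Inv(1)
          nonzerodivisor_swap[OF w(3) f(2)] f(1)])
  then have "has_socle (plus_set (multiples f) (multiples w))" by (simp only: plus_set_commute)
  then show ?thesis by (rule socle_exchange[OF stable_multiples w(3) wI reg g])
qed

definition sequence_span :: "'k fps fps set \<Rightarrow> 'k fps fps set" where
  "sequence_span A = ideal_smult R (genideal R A) (series_module (V t))"

lemma sequence_span_props:
  assumes A: "A \<subseteq> Inv"
  shows "stable (sequence_span A)" "sequence_span A \<subseteq> V t"
    "\<And>f z. f \<in> A \<Longrightarrow> z \<in> V t \<Longrightarrow> f * z \<in> sequence_span A"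
    "\<And>N. stable N \<Longrightarrow> N \<subseteq> V t \<Longrightarrow> (\<And>f. f \<in> A \<Longrightarrow> multiples f \<subseteq> N) \<Longrightarrow> sequence_span A \<subseteq> N"
proof -
  interpret cring R by (rule cring_R)
  have id: "ideal (genideal R A) R" using A by (intro genideal_ideal) simp
  have AG: "A \<subseteq> genideal R A" using A by (intro genideal_self) simp
  have GI: "genideal R A \<subseteq> Inv" using id by (simp add: ideal_iff)
  let ?G = "{c * x | c x. c \<in> genideal R A \<and> x \<in> V t}"
  have eq: "sequence_span A = submodule_gen R (series_module (V t)) ?G"
    by (simp add: sequence_span_def ideal_smult_def)
  have G: "?G \<subseteq> V t" using GI Inv_V_mult by blast
  note p = submodule_gen_closed[OF stable_V G]
  show "stable (sequence_span A)" "sequence_span A \<subseteq> V t" unfolding eq using p by auto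
  show "f * z \<in> sequence_span A" if "f \<in> A" "z \<in> V t" for f z
    unfolding eq using p(2) that AG by blast
  show "sequence_span A \<subseteq> N" if N: "stable N" "N \<subseteq> V t" "\<And>f. f \<in> A \<Longrightarrow> multiples f \<subseteq> N" for N
  proof -
    define J where "J = {c \<in> Inv. \<forall>z\<in>V t. c * z \<in> N}"
    have "stable J" unfolding stable_def J_def
      using stableD[OF N(1)] by (auto simp: distrib_right mult.assoc supported_zero supported_add Inv_mult)
    then have "ideal J R" by (auto simp: ideal_iff J_def)
    moreover have "A \<subseteq> J" using A N(3) by (auto simp: J_def)
    ultimately have "genideal R A \<subseteq> J" by (rule genideal_minimal)
    then have "?G \<subseteq> N" by (auto simp: J_def)
    then show ?thesis unfolding eq by (rule submodule_gen_least[OF stable_V _ N(2,1)])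
  qed
qed

lemma sequence_span_empty: "sequence_span {} = {0}"
  using sequence_span_props(4)[of "{}" "{0}"] stableD(1)[OF sequence_span_props(1)[of "{}"]]
  by (auto simp: stable_zero supported_zero)

lemma multiples_subset: "f \<in> Inv \<Longrightarrow> multiples f \<subseteq> V t"
  using Inv_V_mult by auto

lemma sequence_span_single:
  assumes "f \<in> Inv"
  shows "sequence_span {f} = multiples f"
proof
  show "sequence_span {f} \<subseteq> multiples f"
    using assms multiples_subset by (intro sequence_span_props(4) stable_multiples) auto
  show "multiples f \<subseteq> sequence_span {f}" using sequence_span_props(3)[of "{f}"] assms by auto
qed

lemma sequence_span_pair:
  assumes "f \<in> Inv" "g \<in> Inv"
  shows "sequence_span {f, g} = plus_set (multiples f) (multiples g)"
proof
  have "0 \<in> multiples f" "0 \<in> multiples g" using stableD(1)[OF stable_multiples] by auto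
  then have sub: "multiples f \<subseteq> plus_set (multiples f) (multiples g)" "multiples g \<subseteq> plus_set (multiples f) (multiples g)"
    unfolding plus_set_def by (force, force)
  have "plus_set (multiples f) (multiples g) \<subseteq> V t"
    using multiples_subset[OF assms(1)] multiples_subset[OF assms(2)] supported_add unfolding plus_set_def by blast
  then show "sequence_span {f, g} \<subseteq> plus_set (multiples f) (multiples g)"
    using assms sub by (intro sequence_span_props(4) stable_plus_set stable_multiples) auto
  show "plus_set (multiples f) (multiples g) \<subseteq> sequence_span {f, g}"
    using sequence_span_props(3)[of "{f, g}"] stableD(2)[OF sequence_span_props(1)[of "{f, g}"]] assms
    by (auto simp: plus_set_def)
qed

lemma regular_sequence_iff:
  "regular_sequence R (series_module (V t)) fs \<longleftrightarrow> set fs \<subseteq> Inv \<and>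
    (\<forall>i<length fs. nonzerodivisor_mod (sequence_span (set (take i fs))) (fs ! i)) \<and> sequence_span (set fs) \<noteq> V t"
proof -
  have "(\<forall>x\<in>carrier (quot_module (series_module (V t)) (sequence_span (set (take i fs)))).
      fs ! i \<odot>\<^bsub>quot_module (series_module (V t)) (sequence_span (set (take i fs)))\<^esub> x = \<zero>\<^bsub>quot_module (series_module (V t)) (sequence_span (set (take i fs)))\<^esub> \<longrightarrow>
      x = \<zero>\<^bsub>quot_module (series_module (V t)) (sequence_span (set (take i fs)))\<^esub>) \<longleftrightarrow>
      nonzerodivisor_mod (sequence_span (set (take i fs))) (fs ! i)"
    if "set fs \<subseteq> Inv" "i < length fs" for i
  proof -
    have s: "stable (sequence_span (set (take i fs)))" using that(1) set_take_subset[of i fs] by (intro sequence_span_props) auto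
    have "fs ! i \<in> Inv" using that by auto
    then show ?thesis
      by (simp add: quot_simps quot_smult[OF s] coset_eq_self_iff[OF s] nonzerodivisor_mod_def)
  qed
  then show ?thesis unfolding regular_sequence_def Let_def sequence_span_def[symmetric] by auto
qed

lemma depth_V: "depth R (series_module (V t)) = 2"
  unfolding depth_def max_ideal_eq
proof (rule antisym)
  show "Sup {enat (length fs) | fs. set fs \<subseteq> m_ideal \<and> regular_sequence R (series_module (V t)) fs} \<le> 2"
  proof (rule Sup_least)
    fix e assume "e \<in> {enat (length fs) | fs. set fs \<subseteq> m_ideal \<and> regular_sequence R (series_module (V t)) fs}"
    then obtain fs where e: "e = enat (length fs)" and m: "set fs \<subseteq> m_ideal" and reg: "regular_sequence R (series_module (V t)) fs"
      by blast
    have "\<not> 3 \<le> length fs"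
    proof
      assume l: "3 \<le> length fs"
      then obtain f g h rest where fs: "fs = f # g # h # rest" by (auto simp: numeral_3_eq_3 Suc_le_length_iff)
      have I: "f \<in> Inv" "g \<in> Inv" "h \<in> Inv" using m m_ideal_subset fs by auto
      have r: "nonzerodivisor_mod (sequence_span (set (take i fs))) (fs ! i)" if "i < length fs" for i
        using reg that by (simp add: regular_sequence_iff)
      have f: "nonzerodivisor_mod {0} f" using r[of 0] fs by (simp add: sequence_span_empty)
      have g: "nonzerodivisor_mod (multiples f) g" using r[of 1] fs I by (simp add: sequence_span_single)
      have h: "nonzerodivisor_mod (plus_set (multiples f) (multiples g)) h"
        using r[of 2] fs I by (simp add: sequence_span_pair numeral_2_eq_2)
      have "f \<noteq> 0" using f V_nonzero by (auto simp: nonzerodivisor_mod_def)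
      then have "has_socle (plus_set (multiples f) (multiples g))"
        using m fs g by (intro regular_pair_socle) auto
      then show False using h m fs by (auto simp: has_socle_def nonzerodivisor_mod_def)
    qed
    then show "e \<le> 2" by (simp add: e numeral_eq_enat)
  qed
  have reg: "regular_sequence R (series_module (V t)) [var_x ^ n, var_y ^ n]"
    unfolding regular_sequence_iff
  proof (intro conjI allI impI)
    show "set [var_x ^ n, var_y ^ n] \<subseteq> Inv" using axes_Inv by simp
    fix i assume "i < length [var_x ^ n, var_y ^ n :: 'k fps fps]"
    then have "i = 0 \<or> i = 1" by auto
    then show "nonzerodivisor_mod (sequence_span (set (take i [var_x ^ n, var_y ^ n]))) ([var_x ^ n, var_y ^ n] ! i)"
      using nonzerodivisor_mod_var_x[of "var_y ^ n"] axes_Inv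
      by (auto simp: sequence_span_empty sequence_span_single) (simp add: nonzerodivisor_mod_def)
  next
    show "sequence_span (set [var_x ^ n, var_y ^ n]) \<noteq> V t"
      using socle_axes sequence_span_pair[OF axes_Inv] by (auto simp: has_socle_def)
  qed
  show "2 \<le> Sup {enat (length fs) | fs. set fs \<subseteq> m_ideal \<and> regular_sequence R (series_module (V t)) fs}"
    using reg axes_m_ideal by (intro Sup_upper CollectI exI[of _ "[var_x ^ n, var_y ^ n]"]) (simp add: numeral_eq_enat)
qed

end

end

section \<open>Weierstrass division\<close>

text \<open>The convergent sum of \<open>x\<^sup>m s\<^sub>m\<close>.\<close>

definition xsum :: "(nat \<Rightarrow> 'k::field fps fps) \<Rightarrow> 'k fps fps" where
  "xsum s = Abs_fps (\<lambda>j. Abs_fps (\<lambda>i. \<Sum>m\<le>i. cf (s m) (i - m) j))"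

lemma cf_xsum:
  assumes "i < M"
  shows "cf (xsum s) i j = cf (\<Sum>m<M. var_x ^ m * s m) i j"
proof -
  have c: "cf (var_x ^ m * s m) i j = (if m \<le> i then cf (s m) (i - m) j else 0)" for m
    using cf_monom_mult[of m 0 "s m" i j] by simp
  have "cf (\<Sum>m<M. var_x ^ m * s m) i j = (\<Sum>m<M. if m \<le> i then cf (s m) (i - m) j else 0)"
    by (simp add: cf_sum c)
  also have "\<dots> = (\<Sum>m\<le>i. cf (s m) (i - m) j)"
    using assms by (intro sum.mono_neutral_cong_right) auto
  finally show ?thesis by (simp add: xsum_def)
qed

text \<open>
  Write \<open>f = x A + y\<^sup>d U\<close> with a unit \<open>U\<close>. The part of \<open>h\<close> of order at least \<open>d\<close> in \<open>y\<close> can be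
  cancelled by a multiple of \<open>f\<close> at the price of an error divisible by \<open>x\<close>; iterating pushes the
  error to infinity.
\<close>

lemma weierstrass_division:
  fixes f :: "'k::field fps fps"
  assumes "setx f \<noteq> 0"
  shows "\<exists>d. \<forall>h. \<exists>q l. h = f * q + l \<and> (\<forall>j\<ge>d. fps_nth l j = 0)"
proof -
  define d where "d = subdegree (setx f)"
  define lo hi :: "'k fps fps \<Rightarrow> 'k fps fps" where "lo = fps_cutoff d" and "hi = fps_shift d"
  have split: "h = lo h + var_y ^ d * hi h" for h
    using fps_shift_cutoff[of d h] by (simp add: lo_def hi_def var_y_def algebra_simps)
  have "setx (lo f) = 0"
    by (auto simp: setx_def lo_def cf_def fps_eq_iff d_def dest: nth_less_subdegree_zero)
  then obtain A where A: "lo f = var_x * A" by (rule setx_eq_0_obtain)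
  define U where "U = hi f"
  have "cf U 0 0 = setx f $ d" by (simp add: U_def hi_def cf_def setx_def)
  also have "\<dots> \<noteq> 0" using assms by (simp add: d_def)
  finally have "fps_nth U 0 * inverse (fps_nth U 0) = 1"
    by (intro inverse_mult_eq_1') (simp add: cf_def)
  then have "U * fps_right_inverse U (inverse (fps_nth U 0)) = 1" by (rule fps_right_inverse)
  then obtain U' where U': "U * U' = 1" by blast
  define T where "T = (\<lambda>h. U' * hi h)"
  define E where "E = (\<lambda>h. - A * T h)"
  have step: "h = lo h + f * T h + var_x * E h" for h
  proof -
    have "f * T h = (var_x * A + var_y ^ d * U) * T h" using split[of f] A by (simp add: U_def)
    also have "\<dots> = var_x * A * T h + var_y ^ d * ((U * U') * hi h)" by (simp add: T_def algebra_simps)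
    finally have "f * T h = var_x * A * T h + var_y ^ d * hi h" using U' by simp
    then show ?thesis using split[of h] by (simp add: E_def algebra_simps)
  qed
  have "\<exists>q l. h = f * q + l \<and> (\<forall>j\<ge>d. fps_nth l j = 0)" for h
  proof -
    define e where "e = (\<lambda>m. (E ^^ m) h)"
    have partial: "h = (\<Sum>m<M. var_x ^ m * (lo (e m) + f * T (e m))) + var_x ^ M * e M" for M
    proof (induction M)
      case (Suc M)
      have "e M = lo (e M) + f * T (e M) + var_x * e (Suc M)" using step[of "e M"] by (simp add: e_def)
      then have "var_x ^ M * e M = var_x ^ M * (lo (e M) + f * T (e M)) + var_x ^ Suc M * e (Suc M)"
        by (metis distrib_left mult.assoc power_Suc2)
      then show ?case using Suc by (simp add: add.assoc)
    qed (simp add: e_def)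
    define q l where "q = xsum (\<lambda>m. T (e m))" and "l = xsum (\<lambda>m. lo (e m))"
    have "h = f * q + l"
    proof (rule cf_eqI)
      fix i j
      define M where "M = Suc i"
      define qM lM where "qM = (\<Sum>m<M. var_x ^ m * T (e m))" and "lM = (\<Sum>m<M. var_x ^ m * lo (e m))"
      have "cf (f * q) i j = (\<Sum>r\<le>j. \<Sum>p\<le>i. cf f p r * cf qM (i - p) (j - r))"
        unfolding cf_mult by (intro sum.cong refl) (simp add: q_def qM_def cf_xsum[of _ M] M_def)
      also have "\<dots> = cf (f * qM) i j" by (simp add: cf_mult)
      finally have "cf (f * q + l) i j = cf (f * qM + lM) i j"
        by (simp add: l_def lM_def cf_xsum[of _ M] M_def)
      also have "f * qM + lM = (\<Sum>m<M. var_x ^ m * (lo (e m) + f * T (e m)))"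
        by (simp add: qM_def lM_def sum_distrib_left sum.distrib[symmetric] algebra_simps)
      also have "\<dots> = h - var_x ^ M * e M" using partial[of M] by simp
      also have "cf (h - var_x ^ M * e M) i j = cf h i j"
        using cf_monom_mult[of M 0 "e M" i j] by (simp add: M_def)
      finally show "cf h i j = cf (f * q + l) i j" by simp
    qed
    moreover have "fps_nth l j = 0" if "d \<le> j" for j
    proof (rule fps_ext)
      fix i
      have "cf (lo (e m)) p j = 0" for m p using that by (simp add: cf_def lo_def)
      then show "fps_nth (fps_nth l j) i = fps_nth 0 i" by (simp add: l_def xsum_def)
    qed
    ultimately show ?thesis by blast
  qed
  then show ?thesis by blast
qed

text \<open>
  Modulo \<open>f\<close>, the power series ring is generated by \<open>d\<close> elements over \<open>k[[x]]\<close>; hence the powers of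
  any \<open>g\<close> satisfy a linear relation with coefficients in \<open>k[[x]]\<close>.
\<close>

lemma algebraic_relation:
  fixes f g :: "'k::field fps fps"
  assumes "setx f \<noteq> 0"
  shows "\<exists>d c q. (\<exists>m\<le>d. c m \<noteq> 0) \<and> (\<Sum>m\<le>d. g ^ m * fps_const (c m)) = f * q"
proof -
  obtain d where d: "\<And>h. \<exists>q l. h = f * q + l \<and> (\<forall>j\<ge>d. fps_nth l j = 0)"
    using weierstrass_division[OF assms] by blast
  then have "\<forall>m. \<exists>q l. g ^ m = f * q + l \<and> (\<forall>j\<ge>d. fps_nth l j = 0)" by blast
  then obtain q l where ql: "\<And>m. g ^ m = f * q m + l m" "\<And>m j. d \<le> j \<Longrightarrow> fps_nth (l m) j = 0" by metis
  obtain c where c: "\<exists>m\<in>{..d}. c m \<noteq> 0" "\<And>j. j < d \<Longrightarrow> (\<Sum>m\<in>{..d}. c m * fps_nth (l m) j) = 0"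
    using linear_dependence[of "{..<d}" "{..d}" "\<lambda>m j. fps_nth (l m) j"] by auto
  have "(\<Sum>m\<le>d. l m * fps_const (c m)) = 0"
  proof (rule fps_ext)
    fix j
    show "fps_nth (\<Sum>m\<le>d. l m * fps_const (c m)) j = fps_nth 0 j"
      using c(2)[of j] ql(2)[of j] by (cases "j < d") (simp_all add: fps_sum_nth mult.commute)
  qed
  then have "(\<Sum>m\<le>d. g ^ m * fps_const (c m)) = f * (\<Sum>m\<le>d. q m * fps_const (c m))"
    by (simp add: ql(1) distrib_right sum.distrib sum_distrib_left mult.assoc)
  then show ?thesis using c(1) by blast
qed

section \<open>Krull dimension\<close>

text \<open>
  The inclusion of \<open>k[[y]]\<close> into \<open>k[[x, y]]\<close>, a section of \<^const>\<open>setx\<close>.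
\<close>

definition lift_y :: "'k::field fps \<Rightarrow> 'k fps fps" where
  "lift_y p = Abs_fps (\<lambda>j. fps_const (fps_nth p j))"

lemma cf_lift_y: "cf (lift_y p) i j = (if i = 0 then fps_nth p j else 0)"
  by (simp add: cf_def lift_y_def)

lemma lift_y_mult: "lift_y (p * q) = lift_y p * lift_y q"
proof (rule fps_ext)
  fix j
  have "fps_const (\<Sum>i\<le>j. fps_nth p i * fps_nth q (j - i)) = (\<Sum>i\<le>j. fps_const (fps_nth p i) * fps_const (fps_nth q (j - i)))"
    by (simp add: fps_eq_iff fps_sum_nth)
  then show "fps_nth (lift_y (p * q)) j = fps_nth (lift_y p * lift_y q) j"
    by (simp add: lift_y_def fps_mult_nth atLeast0AtMost)
qed

lemma setx_lift_y [simp]: "setx (lift_y p) = p"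
  by (simp add: setx_def cf_lift_y fps_eq_iff)

lemma lift_y_X_power: "lift_y (fps_X ^ e) = (var_y ^ e :: 'k::field fps fps)"
proof (rule cf_eqI)
  fix i j
  have "cf (var_x ^ 0 * var_y ^ e :: 'k fps fps) i j = (if i = 0 \<and> j = e then 1 else 0)" by (rule cf_monom)
  then show "cf (lift_y (fps_X ^ e)) i j = cf (var_y ^ e :: 'k fps fps) i j" by (simp add: cf_lift_y)
qed

lemma fps_associated_power:
  fixes p :: "'k::field fps"
  assumes "p \<noteq> 0"
  shows "\<exists>w. p * w = fps_X ^ subdegree p"
proof -
  have "unit_factor p * inverse (unit_factor p) = 1"
    using assms by (intro inverse_mult_eq_1') simp
  moreover have "p = unit_factor p * fps_X ^ subdegree p" by (simp add: subdegree_decompose)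
  ultimately have "p * inverse (unit_factor p) = fps_X ^ subdegree p"
    by (metis (no_types, lifting) mult.assoc mult.commute mult.right_neutral)
  then show ?thesis by blast
qed

context cyclic_sing
begin

definition prime_in :: "'k fps fps set \<Rightarrow> bool" where
  "prime_in P \<longleftrightarrow> P \<subseteq> Inv \<and> stable P \<and> 1 \<notin> P \<and> (\<forall>f\<in>Inv. \<forall>g\<in>Inv. f * g \<in> P \<longrightarrow> f \<in> P \<or> g \<in> P)"

lemma primeideal_iff: "primeideal P R \<longleftrightarrow> prime_in P"
proof
  assume "primeideal P R"
  then interpret P: primeideal P R .
  have id: "P \<subseteq> Inv" "stable P" using P.is_ideal by (auto simp: ideal_iff)
  have "1 \<notin> P"
  proof
    assume "1 \<in> P"
    then have "P = Inv" using ideal_with_unit[OF P.is_ideal] one_notin_m_ideal by simp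
    then show False using P.I_notcarr by simp
  qed
  then show "prime_in P" using id P.I_prime by (auto simp: prime_in_def)
next
  assume P: "prime_in P"
  show "primeideal P R"
  proof (rule primeidealI[OF _ cring_R])
    show "ideal P R" using P by (auto simp: prime_in_def ideal_iff)
    show "carrier R \<noteq> P" using P one_Inv by (auto simp: prime_in_def)
  qed (use P in \<open>auto simp: prime_in_def\<close>)
qed

lemma prime_power:
  assumes "prime_in P" "f \<in> Inv" "f ^ m \<in> P"
  shows "f \<in> P"
  using assms(3)
proof (induction m)
  case 0
  then show ?case using assms by (simp add: prime_in_def)
next
  case (Suc m)
  then show ?case using assms Inv_power[of f m] by (auto simp: prime_in_def)
qed

lemma prime_multiple: "prime_in P \<Longrightarrow> f \<in> P \<Longrightarrow> g \<in> Inv \<Longrightarrow> f * g \<in> P"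
  using stableD(3)[of P g f] by (auto simp: prime_in_def mult.commute)

lemma V_power: "f \<in> V s \<Longrightarrow> f ^ m \<in> V (int m * s)"
proof (induction m)
  case 0
  then show ?case using one_Inv by simp
next
  case (Suc m)
  then show ?case using V_mult[of f s "f ^ m" "int m * s"] by (simp add: algebra_simps)
qed

lemma V_power_n: "f \<in> V s \<Longrightarrow> f ^ n \<in> Inv"
  using V_power[of f s n] V_cong[of "int n * s" 0] by (simp add: cong_iff_dvd_diff)

text \<open>
  The \<open>n\<close>-th power of a semi-invariant is invariant, so \<open>r = x r'\<close> gives \<open>r\<^sup>n = x\<^sup>n r'\<^sup>n\<close> inside \<open>R\<close>.
\<close>

lemma divisible_in_prime:
  assumes P: "prime_in P" "var_x ^ n \<in> P" and r: "r \<in> Inv" "setx r = 0"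
  shows "r \<in> P"
proof -
  obtain r' where r': "r = var_x * r'" using setx_eq_0_obtain[OF r(2)] by blast
  then have "r' \<in> V (0 - 1)" using r by (intro V_cancel_var_x) simp
  then have "r' ^ n \<in> Inv" by (rule V_power_n)
  then have "r ^ n \<in> P" using prime_multiple[OF P] by (simp add: r' power_mult_distrib)
  then show ?thesis by (rule prime_power[OF P(1) r(1)])
qed

lemma lift_setx_Inv:
  assumes "r \<in> Inv"
  shows "lift_y (setx r) \<in> Inv"
  by (rule supportedI) (use assms in \<open>auto simp: cf_lift_y setx_def supportedD\<close>)

lemma power_in_prime:
  assumes P: "prime_in P" and z: "z ^ n \<in> Inv" and e: "z ^ e \<in> P" "n dvd e"
  shows "z ^ n \<in> P"
proof -
  obtain k where "e = n * k" using e(2) by blast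
  then have "(z ^ n) ^ k \<in> P" using e(1) by (simp add: power_mult)
  then show ?thesis by (rule prime_power[OF P z])
qed

text \<open>
  Modulo \<open>x\<^sup>n\<close>, every invariant agrees up to nilpotents with a series in \<open>y\<close> alone. The given \<open>h\<close> thus
  contributes a power of \<open>y\<close> to the prime, which therefore contains \<open>y\<^sup>n\<close> and then everything.
\<close>

lemma m_ideal_subset_prime:
  assumes P: "prime_in P" "var_x ^ n \<in> P" and h: "h \<in> P" "setx h \<noteq> 0"
  shows "m_ideal \<subseteq> P"
proof
  have PI: "P \<subseteq> Inv" "stable P" using P by (auto simp: prime_in_def)
  have hI: "h \<in> Inv" using h PI by auto
  have "h - lift_y (setx h) \<in> P"
    using divisible_in_prime[OF P supported_diff[OF hI lift_setx_Inv[OF hI]]] by simp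
  then have l: "lift_y (setx h) \<in> P" using stableD(5)[OF PI(2) h(1)] by fastforce
  define e where "e = subdegree (setx h)"
  have "setx h $ e \<noteq> 0" using h(2) by (simp add: e_def)
  then have "(0, e) \<in> expo 0" using hI by (auto simp: supported_def setx_def)
  then have "int n dvd int e * int a" by (simp add: expo_iff cong_0_iff)
  then have "int n dvd int e"
    using coprime_an by (subst (asm) coprime_dvd_mult_left_iff) (auto simp: coprime_iff_gcd_eq_1 gcd.commute)
  then have ne: "n dvd e" by (simp add: int_dvd_int_iff)
  obtain w where w: "setx h * w = fps_X ^ e" using fps_associated_power[OF h(2)] by (auto simp: e_def)
  have "lift_y (setx h) * lift_y w = var_y ^ e" by (simp add: lift_y_mult[symmetric] w lift_y_X_power)
  moreover have ye: "var_y ^ e \<in> Inv" using axes_Inv(2) ne Inv_power by (auto simp: power_mult)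
  ultimately have "lift_y (setx h) * project 0 (lift_y w) = var_y ^ e"
    using project_mult[of "lift_y (setx h)" 0 0 "lift_y w"] lift_setx_Inv[OF hI] project_id[OF ye] by simp
  then have "var_y ^ e \<in> P" using prime_multiple[OF P(1) l project_supported[of 0 "lift_y w"]] by simp
  then have yn: "var_y ^ n \<in> P" by (rule power_in_prime[OF P(1) axes_Inv(2) _ ne])
  fix r assume r: "r \<in> m_ideal"
  then have rI: "r \<in> Inv" using m_ideal_subset by auto
  have "setx r $ 0 = 0" using r by (simp add: m_ideal_iff setx_def)
  define p where "p = fps_shift 1 (setx r)"
  have p: "setx r = fps_X * p"
  proof (rule fps_ext)
    fix i show "setx r $ i = (fps_X * p) $ i" using \<open>setx r $ 0 = 0\<close> by (cases i) (auto simp: p_def)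
  qed
  have "lift_y fps_X = (var_y :: 'k fps fps)" by (simp add: lift_y_X_power[of 1, simplified])
  then have ly: "lift_y (setx r) = var_y * lift_y p" unfolding p lift_y_mult by simp
  have "lift_y p \<in> V (- int a)"
  proof (rule supportedI)
    fix i j assume n: "(i, j) \<notin> expo (- int a)"
    have "[int i + int j * int a = - int a] (mod int n) \<longleftrightarrow> [int i + int (Suc j) * int a = 0] (mod int n)"
      by (simp add: cong_iff_dvd_diff algebra_simps)
    then have "(i, Suc j) \<notin> expo 0" using n by (simp add: expo_iff)
    then have "cf (var_y * lift_y p) i (Suc j) = 0"
      using lift_setx_Inv[OF rI] unfolding ly[symmetric] by (simp add: supportedD)
    then show "cf (lift_y p) i j = 0" using cf_monom_mult[of 0 1 "lift_y p" i "Suc j"] by simp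
  qed
  then have "lift_y p ^ n \<in> Inv" by (rule V_power_n)
  then have "lift_y (setx r) ^ n \<in> P" using prime_multiple[OF P(1) yn] by (simp add: ly power_mult_distrib)
  then have "lift_y (setx r) \<in> P" by (rule prime_power[OF P(1) lift_setx_Inv[OF rI]])
  moreover have "r - lift_y (setx r) \<in> P"
    using divisible_in_prime[OF P supported_diff[OF rI lift_setx_Inv[OF rI]]] by simp
  ultimately show "r \<in> P" using stableD(2)[OF PI(2)] by fastforce
qed

text \<open>
  A prime that does not contain \<open>g\<close> allows cancelling powers of \<open>g\<close> until the constant coefficient
  of the relation is nonzero.
\<close>

lemma lowest_coefficient:
  assumes P: "prime_in P" and g: "g \<in> Inv" "g \<notin> P"
  shows "(\<Sum>m\<le>d. g ^ m * D m) \<in> P \<Longrightarrow> (\<And>m. D m \<in> Inv) \<Longrightarrow> \<exists>m\<le>d. D m \<noteq> 0 \<Longrightarrow>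
    \<exists>m\<le>d. D m \<noteq> 0 \<and> (\<exists>r\<in>Inv. D m + g * r \<in> P)"
proof (induction d arbitrary: D)
  case 0
  then show ?case using supported_zero by (intro exI[of _ 0]) (auto intro!: bexI[of _ 0])
next
  case (Suc d)
  have sumI: "(\<Sum>m\<le>d. g ^ m * D (Suc m)) \<in> Inv"
    using Suc.prems(2) Inv_power[OF g(1)] by (intro stable_sum[OF stable_V] Inv_mult) auto
  have e: "(\<Sum>m\<le>Suc d. g ^ m * D m) = D 0 + g * (\<Sum>m\<le>d. g ^ m * D (Suc m))"
    by (simp add: sum.atMost_Suc_shift sum_distrib_left mult.assoc del: sum.atMost_Suc)
  show ?case
  proof (cases "D 0 = 0")
    case False
    then show ?thesis using Suc.prems(1) sumI unfolding e by (intro exI[of _ 0]) auto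
  next
    case True
    then have "g * (\<Sum>m\<le>d. g ^ m * D (Suc m)) \<in> P" using Suc.prems(1) unfolding e by simp
    then have "(\<Sum>m\<le>d. g ^ m * D (Suc m)) \<in> P" using P g sumI by (auto simp: prime_in_def)
    moreover have "\<exists>m\<le>d. D (Suc m) \<noteq> 0" using Suc.prems(3) True by (metis Suc_le_mono not0_implies_Suc)
    ultimately obtain m where "m \<le> d" "D (Suc m) \<noteq> 0" "\<exists>r\<in>Inv. D (Suc m) + g * r \<in> P"
      using Suc.IH[of "\<lambda>m. D (Suc m)"] Suc.prems(2) by blast
    then show ?thesis by (intro exI[of _ "Suc m"]) simp
  qed
qed

text \<open>
  The algebraic relation of \<open>g\<close> over \<open>k[[x]]\<close> modulo \<open>f\<close> need not have invariant coefficients. Its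
  component of a suitable weight \<open>s\<close> is nonzero, and the factor \<open>x\<^sup>n\<^sup>-\<^sup>s\<close> makes that one invariant.
\<close>

lemma var_x_power_in_prime:
  assumes P: "prime_in P" and Q: "prime_in Q" "P \<subseteq> Q" and f: "f \<in> P" "setx f \<noteq> 0" and g: "g \<in> Q" "g \<notin> P"
  shows "var_x ^ n \<in> Q"
proof -
  have PI: "P \<subseteq> Inv" "stable P" "Q \<subseteq> Inv" "stable Q" using P Q by (auto simp: prime_in_def)
  have fI: "f \<in> Inv" and gI: "g \<in> Inv" using f g PI by auto
  obtain d c q where c: "\<exists>m\<le>d. c m \<noteq> 0" and rel: "(\<Sum>m\<le>d. g ^ m * fps_const (c m)) = f * q"
    using algebraic_relation[OF f(2)] by blast
  obtain m0 i where m0: "m0 \<le> d" "fps_nth (c m0) i \<noteq> 0" using c by (auto simp: fps_eq_iff)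
  define s where "s = i mod n"
  define D where "D = (\<lambda>m. var_x ^ (n - s) * project (int s) (fps_const (c m)))"
  have s: "s < n" using n_gt_1 by (simp add: s_def)
  have inI: "var_x ^ (n - s) * project (int s) h \<in> Inv" for h
  proof -
    have "var_x ^ (n - s) * project (int s) h \<in> V (int (n - s) + int s)"
      by (rule V_mult[OF var_x_power_V project_supported])
    also have "V (int (n - s) + int s) = V 0" using s by (intro V_cong) (simp add: of_nat_diff cong_0_iff)
    finally show ?thesis .
  qed
  have DI: "D m \<in> Inv" for m by (simp add: D_def inI)
  have cD: "cf (D m) p j = (if n - s \<le> p \<and> j = 0 \<and> (p - (n - s), 0) \<in> expo (int s) then fps_nth (c m) (p - (n - s)) else 0)" for m p j
  proof -
    have "cf (fps_const b) i j = (if j = 0 then fps_nth b i else 0)" for b :: "'k fps" and i by (simp add: cf_def)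
    then show ?thesis using cf_monom_mult[of "n - s" 0 "project (int s) (fps_const (c m))" p j]
      by (cases "j = 0") (auto simp: D_def cf_project)
  qed
  have "project (int s) (\<Sum>m\<le>d. g ^ m * fps_const (c m)) = (\<Sum>m\<le>d. g ^ m * project (int s) (fps_const (c m)))"
    unfolding project_sum using project_mult[OF Inv_power[OF gI], of "int s"] by simp
  moreover have "project (int s) (f * q) = f * project (int s) q" using project_mult[OF fI, of "int s" q] by simp
  ultimately have "(\<Sum>m\<le>d. g ^ m * project (int s) (fps_const (c m))) = f * project (int s) q" using rel by simp
  then have "var_x ^ (n - s) * (\<Sum>m\<le>d. g ^ m * project (int s) (fps_const (c m))) = f * (var_x ^ (n - s) * project (int s) q)"
    by (simp add: ac_simps)
  then have "(\<Sum>m\<le>d. g ^ m * D m) = f * (var_x ^ (n - s) * project (int s) q)"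
    by (simp add: D_def sum_distrib_left ac_simps)
  then have "(\<Sum>m\<le>d. g ^ m * D m) \<in> P" using prime_multiple[OF P f(1) inI] by simp
  moreover have "(i, 0) \<in> expo (int s)" by (simp add: expo_iff s_def cong_def zmod_int)
  then have "cf (D m0) (i + (n - s)) 0 \<noteq> 0" using m0 by (simp add: cD)
  then have "\<exists>m\<le>d. D m \<noteq> 0" using m0(1) by (intro exI[of _ m0]) auto
  ultimately obtain m r where mr: "D m \<noteq> 0" "r \<in> Inv" "D m + g * r \<in> P"
    using lowest_coefficient[OF P gI g(2), where d = d and D = D] DI by blast
  have "D m + g * r \<in> Q" "g * r \<in> Q" using mr Q(2) prime_multiple[OF Q(1) g(1)] by auto
  then have DQ: "D m \<in> Q" using stableD(5)[OF PI(4)] by fastforce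
  define p where "p = fps_nth (D m) 0"
  have Dp: "D m = fps_const p" by (rule cf_eqI) (use cD in \<open>auto simp: p_def cf_def\<close>)
  have p0: "p \<noteq> 0" using mr(1) Dp by auto
  define e where "e = subdegree p"
  obtain w where "p * w = fps_X ^ e" using fps_associated_power[OF p0] by (auto simp: e_def)
  then have w: "D m * fps_const w = var_x ^ e" by (simp add: Dp var_x_def fps_const_power)
  have "cf (D m) e 0 \<noteq> 0" using p0 by (simp add: Dp cf_def e_def)
  then have "(e, 0) \<in> expo 0" using DI by (auto simp: supported_def)
  then have ne: "n dvd e" by (simp add: expo_iff cong_0_iff int_dvd_int_iff)
  then have xe: "var_x ^ e \<in> Inv" using axes_Inv(1) Inv_power by (auto simp: power_mult)
  have "D m * project 0 (fps_const w) = var_x ^ e"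
    using project_mult[OF DI[of m], of 0 "fps_const w"] project_id[OF xe] w by simp
  then have "var_x ^ e \<in> Q" using prime_multiple[OF Q(1) DQ project_supported[of 0 "fps_const w"]] by simp
  then show ?thesis by (rule power_in_prime[OF Q(1) axes_Inv(1) _ ne])
qed

lemma factor_var_x:
  fixes f :: "'k fps fps"
  assumes "f \<noteq> 0"
  shows "\<exists>e f'. f = var_x ^ e * f' \<and> setx f' \<noteq> 0"
proof -
  have "\<exists>i j. cf f i j \<noteq> 0" using assms cf_eqI[of f 0] by auto
  then have ex: "\<exists>i. \<exists>j. cf f i j \<noteq> 0" .
  define e where "e = (LEAST i. \<exists>j. cf f i j \<noteq> 0)"
  have e: "\<exists>j. cf f e j \<noteq> 0" unfolding e_def by (rule LeastI_ex[OF ex])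
  have less: "cf f i j = 0" if "i < e" for i j
    using not_less_Least[of i "\<lambda>i. \<exists>j. cf f i j \<noteq> 0"] that by (auto simp: e_def)
  define f' where "f' = Abs_fps (\<lambda>j. Abs_fps (\<lambda>i. cf f (i + e) j))"
  have cf': "cf f' i j = cf f (i + e) j" for i j by (simp add: f'_def)
  have "f = var_x ^ e * f'" using cf_monom_mult[of e 0 f'] less by (intro cf_eqI) (simp add: cf')
  moreover have "setx f' \<noteq> 0" using e by (auto simp: setx_def fps_eq_iff cf')
  ultimately show ?thesis by blast
qed

text \<open>
  A prime strictly above a nonzero prime is the maximal ideal. Some element of the smaller prime is
  either \<open>x\<^sup>n\<close> or not divisible by \<open>x\<close>, and in the second case the algebraic relation over \<open>k[[x]]\<close>
  satisfied by a new element of the larger prime has its lowest coefficient in that prime.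
\<close>

lemma prime_above_nonzero_prime:
  assumes P: "prime_in P" and Q: "prime_in Q" "P \<subseteq> Q" and f: "f \<in> P" "f \<noteq> 0" and g: "g \<in> Q" "g \<notin> P"
  shows "m_ideal \<subseteq> Q"
proof -
  have PI: "P \<subseteq> Inv" "Q \<subseteq> Inv" using P Q by (auto simp: prime_in_def)
  obtain e f' where f': "f = var_x ^ e * f'" "setx f' \<noteq> 0" using factor_var_x[OF f(2)] by blast
  have "f' \<in> V (0 - int e)" using f(1) PI f' by (intro V_cancel_var_x_power) auto
  then have f'n: "f' ^ n \<in> Inv" by (rule V_power_n)
  have "f ^ n \<in> P"
  proof -
    have "f * f ^ (n - 1) \<in> P" using f PI Inv_power by (intro prime_multiple[OF P]) auto
    then show ?thesis using n_gt_1 by (simp add: power_eq_if)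
  qed
  then have "(var_x ^ n) ^ e * f' ^ n \<in> P"
    by (simp add: f' power_mult_distrib power_mult[symmetric] mult.commute)
  then have "(var_x ^ n) ^ e \<in> P \<or> f' ^ n \<in> P"
    using P f'n Inv_power[OF axes_Inv(1)] by (auto simp: prime_in_def)
  then show ?thesis
  proof
    assume "(var_x ^ n) ^ e \<in> P"
    then have x: "var_x ^ n \<in> P" by (rule prime_power[OF P axes_Inv(1)])
    have "setx g \<noteq> 0" using divisible_in_prime[OF P x, of g] g PI by auto
    then show ?thesis using m_ideal_subset_prime[OF Q(1) _ g(1)] x Q(2) by auto
  next
    assume f'P: "f' ^ n \<in> P"
    have s: "setx (f' ^ n) \<noteq> 0" using f'(2) by simp
    have "var_x ^ n \<in> Q" by (rule var_x_power_in_prime[OF P Q f'P s g])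
    then show ?thesis using m_ideal_subset_prime[OF Q(1) _ _ s] f'P Q(2) by auto
  qed
qed

text \<open>
  The chain \<open>0\<close>, multiples of \<open>x\<close>, \<open>\<mm>\<close> has length 2. A chain of length 3 would contain a prime strictly
  between a nonzero prime and another prime, but such a prime already contains \<open>\<mm>\<close>.
\<close>

lemma krull_dim_R: "krull_dim R = 2"
  unfolding krull_dim_def primeideal_iff
proof (rule antisym)
  show "Sup {enat k | k. \<exists>P. (\<forall>i\<le>k. prime_in (P i)) \<and> (\<forall>i<k. P i \<subset> P (Suc i))} \<le> 2"
  proof (rule Sup_least)
    fix x assume "x \<in> {enat k | k. \<exists>P. (\<forall>i\<le>k. prime_in (P i)) \<and> (\<forall>i<k. P i \<subset> P (Suc i))}"
    then obtain k P where x: "x = enat k" and P: "\<And>i. i \<le> k \<Longrightarrow> prime_in (P i)" "\<And>i. i < k \<Longrightarrow> P i \<subset> P (Suc i)"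
      by blast
    have "\<not> 3 \<le> k"
    proof
      assume k: "3 \<le> k"
      have pr: "prime_in (P 0)" "prime_in (P 1)" "prime_in (P 2)" "prime_in (P 3)" using P(1) k by auto
      have sub: "P 0 \<subset> P 1" "P 1 \<subset> P 2" "P 2 \<subset> P 3" using P(2)[of 0] P(2)[of 1] P(2)[of 2] k by (auto simp: numeral_eq_Suc)
      obtain f where f: "f \<in> P 1" "f \<notin> P 0" using sub by auto
      have "0 \<in> P 0" using pr(1) stableD(1) by (auto simp: prime_in_def)
      then have f0: "f \<noteq> 0" using f by auto
      obtain g where g: "g \<in> P 2" "g \<notin> P 1" using sub by auto
      have "m_ideal \<subseteq> P 2" using prime_above_nonzero_prime[OF pr(2,3) _ f(1) f0 g] sub by auto
      moreover obtain h where h: "h \<in> P 3" "h \<notin> P 2" using sub by auto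
      ultimately have "h \<notin> m_ideal" by auto
      moreover have "ideal (P 3) R" using pr(4) by (auto simp: prime_in_def ideal_iff)
      ultimately have "P 3 = Inv" using ideal_with_unit h(1) by blast
      then show False using pr(4) one_Inv by (auto simp: prime_in_def)
    qed
    then show "x \<le> 2" by (simp add: x numeral_eq_enat)
  qed
  define P where "P = (\<lambda>i :: nat. if i = 0 then {0} else if i = 1 then {f \<in> Inv. setx f = 0} else m_ideal)"
  have "prime_in {0}" by (auto simp: prime_in_def stable_zero supported_zero)
  moreover have "prime_in {f \<in> Inv. setx f = 0}"
    by (auto simp: prime_in_def stable_def supported_zero supported_add Inv_mult)
  moreover have "prime_in m_ideal"
    using stable_m_ideal one_notin_m_ideal by (auto simp: prime_in_def m_ideal_iff cf_mult)
  ultimately have "\<forall>i\<le>2. prime_in (P i)" by (auto simp: P_def)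
  moreover have "{0} \<subset> {f \<in> Inv. setx f = 0}"
  proof -
    have "var_x ^ n \<in> {f \<in> Inv. setx f = 0}" using axes_Inv n_gt_1 by (simp add: power_0_left)
    moreover have "var_x ^ n \<notin> {0 :: 'k fps fps}" by simp
    moreover have "{0} \<subseteq> {f \<in> Inv. setx f = 0}" by (simp add: supported_zero)
    ultimately show ?thesis by blast
  qed
  moreover have "{f \<in> Inv. setx f = 0} \<subset> m_ideal"
  proof
    show "{f \<in> Inv. setx f = 0} \<subseteq> m_ideal" by (auto simp: m_ideal_iff setx_def fps_eq_iff)
    have "var_y ^ n \<notin> {f \<in> Inv. setx f = 0}" by simp
    then show "{f \<in> Inv. setx f = 0} \<noteq> m_ideal" using axes_m_ideal(2) by blast
  qed
  ultimately have "(\<forall>i\<le>2. prime_in (P i)) \<and> (\<forall>i<2. P i \<subset> P (Suc i))"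
    by (auto simp: P_def less_2_cases_iff)
  then show "2 \<le> Sup {enat k | k. \<exists>P. (\<forall>i\<le>k. prime_in (P i)) \<and> (\<forall>i<k. P i \<subset> P (Suc i))}"
    by (intro Sup_upper CollectI exI[of _ 2]) (auto simp: numeral_eq_enat)
qed

end

section \<open>Ulrich modules\<close>

context cyclic_sing
begin

lemma MCM_V: "MCM R (series_module (V t))"
  by (simp add: MCM_def module_series[OF stable_V] finitely_generated_V depth_V krull_dim_R)

text \<open>
  All modules \<open>M\<^sub>t\<close> have the same multiplicity, as they have rank one: the number of monomials outside
  \<open>\<mm>\<^sup>l\<^sup>+\<^sup>1M\<^sub>t\<close> is asymptotically \<open>e l\<^sup>2 / 2\<close>, independently of \<open>t\<close>.
\<close>

lemma multiplicity_V:
  assumes "lattice_chain n a e px py"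
  shows "multiplicity_of R (series_module (V t)) = real e"
proof -
  interpret lattice_chain n a e px py by (rule assms)
  have "upward (power_expo t (Suc l))" for l
    using power_expo_add0 by (auto simp: upward_def)
  then have "module_length R (quot_module (series_module (V t))
      (ideal_smult R (ideal_power R (max_ideal R) (Suc l)) (series_module (V t)))) =
      enat (card (expo t - power_expo t (Suc l)))" for l
    unfolding max_ideal_eq ideal_power_smult
    using power_expo_subset expo_diff_upper by (intro length_monomial_quotient) auto
  then have "multiplicity_of R (series_module (V t)) =
      lim (\<lambda>l. 2 * real (card (expo t - power_expo t (Suc l))) / real l ^ 2)"
    by (simp add: multiplicity_of_def krull_dim_R numeral_eq_enat del: ideal_power.simps)
  then show ?thesis using limI[OF colength_limit] by simp
qed

lemma Ulrich_iff:
  assumes "lattice_chain n a e px py" "finite (gens t)"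
  shows "Ulrich const_xy R (M_mod n a \<zeta> t) \<longleftrightarrow> card (gens t) = e"
  by (simp add: Ulrich_def M_mod_eq MCM_V num_gens_eq[OF assms(2)] multiplicity_V[OF assms(1)])

end

theorem theorem1p3:
  fixes \<zeta> :: "'k::alg_closed_field" and n a :: nat and \<alpha>s :: "int list"
  assumes "1 \<le> a" and "a \<le> n - 1" and "gcd a n = 1"
    and "(of_nat n :: 'k) \<noteq> 0"
    and "primitive_root_of_unity n \<zeta>"
    and "HJ_expansion n a \<alpha>s"
  shows
    "(\<forall>t::int.
        (\<exists>b k. admissible_seq n a \<alpha>s b k \<and> t = t_of_seq n a \<alpha>s b k) \<or> t = int n - 1 \<longrightarrow>
        Ulrich const_xy (invariant_ring \<zeta> a) (M_mod n a \<zeta> t)) \<and>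
     (\<forall>t::int.
        0 \<le> t \<and> t \<le> int n - 1 \<and> t \<noteq> int n - 1 \<and>
        Ulrich const_xy (invariant_ring \<zeta> a) (M_mod n a \<zeta> t) \<longrightarrow>
        (\<exists>b k. admissible_seq n a \<alpha>s b k \<and> t = t_of_seq n a \<alpha>s b k))"
proof -
  interpret S: cyclic_sing n a \<zeta>
    using assms by unfold_locales auto
  interpret H: HJ_type n a \<alpha>s
    using assms by unfold_locales
  obtain px py where chain: "lattice_chain n a (nat (H.excess 0 + 2)) px py"
    using H.lattice_chain_exists by blast
  have main: "Ulrich const_xy (invariant_ring \<zeta> a) (M_mod n a \<zeta> t) \<longleftrightarrow>
      (\<exists>b k. admissible_seq n a \<alpha>s b k \<and> t = t_of_seq n a \<alpha>s b k) \<or> t = int n - 1"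
    if t: "0 \<le> t" "t < int n" for t
  proof -
    have "Ulrich const_xy (invariant_ring \<zeta> a) (M_mod n a \<zeta> t) \<longleftrightarrow> H.gen_count t = H.excess 0 + 2"
      using S.Ulrich_iff[OF chain H.finite_gens[OF t]] H.excess_nonneg[of 0]
      by (auto simp: H.gen_count_def)
    then show ?thesis using H.gen_count_maximal_iff_admissible[OF t] by simp
  qed
  show ?thesis
  proof (intro conjI allI impI)
    fix t assume h: "(\<exists>b k. admissible_seq n a \<alpha>s b k \<and> t = t_of_seq n a \<alpha>s b k) \<or> t = int n - 1"
    then show "Ulrich const_xy (invariant_ring \<zeta> a) (M_mod n a \<zeta> t)"
      using main[OF H.t_of_admissible_range[OF h]] by simp
  next
    fix t assume "0 \<le> t \<and> t \<le> int n - 1 \<and> t \<noteq> int n - 1 \<and>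
        Ulrich const_xy (invariant_ring \<zeta> a) (M_mod n a \<zeta> t)"
    then show "\<exists>b k. admissible_seq n a \<alpha>s b k \<and> t = t_of_seq n a \<alpha>s b k"
      using main[of t] by auto
  qed
qed

end
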